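(* The annihilation algebra $\mathfrak g(RE(3,6))$ is isomorphic, as a $\mathbb Z$-graded Lie superalgebra, to $E(3,6)$ with its principal gradation, via the map (extended linearly and continuously) $$a_i\boldsymbol y^M\mapsto-\boldsymbol x^M\partial_{x_i},\qquad b_{hk}\boldsymbol y^M\mapsto\boldsymbol x^Mdx_h\otimes e_k,\qquad c\,\boldsymbol y^M\mapsto\boldsymbol x^M\otimes c,$$ for $i,h\in\{1,2,3\}$, $k\in\{1,2\}$, $c\in\mathfrak{sl}_2$, $M\in\mathbb Z_{\ge0}^3$.
   Context: $\mathbb F$ is an algebraically closed field of characteristic $0$; $\boldsymbol\lambda=(\lambda_1,\lambda_2,\lambda_3)$, $\boldsymbol\mu$, $\boldsymbol\partial$, $\boldsymbol y$, $\boldsymbol x$ are sets of three even commuting variables; $\boldsymbol y^M=y_1^{m_1}y_2^{m_2}y_3^{m_3}$, $|M|=\sum m_i$; $p(\cdot)$ denotes parity. Notation: for $i\ne j$ in $\{1,2,3\}$, $t_{ij}$ is the third index and $\varepsilon_{ij}$ is the sign of the permutation $(i,j,t_{ij})$; $\varepsilon_{ii}=0$. $e_1,e_2$ is the standard basis of $\mathbb F^2$; $E,F,H$ the standard basis of $\mathfrak{sl}_2$; the symmetric square of $\mathbb F^2$ is identified with $\mathfrak{sl}_2$ by $E=e_1^2/2$, $F=-e_2^2/2$, $H=-e_1\cdot e_2$, and the exterior square with $\mathbb F$ by $e_1\wedge e_2=1$. $E(3,6)$: $\Omega^k(3)$ denotes $k$-forms in $x_1,x_2,x_3$ with formal power series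 coefficients, $W(3,0)$ the Lie algebra of formal vector fields. Even part: $W(3,0)\ltimes(\Omega^0(3)\otimes\mathfrak{sl}_2)$, with $W(3,0)$ acting naturally on functions and $[f\otimes c_1,g\otimes c_2]=fg\otimes[c_1,c_2]$. Odd part: $\Omega^1(3)^{-1/2}\otimes\mathbb F^2$ with $[X,\omega\otimes v]=\mathcal L_X(\omega)\otimes v-\frac12\mathrm{div}(X)\omega\otimes v$, $[f\otimes c,\omega\otimes v]=f\omega\otimes c.v$, and $[\omega_1\otimes u_1,\omega_2\otimes u_2]=(\omega_1\wedge\omega_2)\otimes(u_1\wedge u_2)+\frac12(d\omega_1\wedge\omega_2+\omega_1\wedge d\omega_2)\otimes u_1\cdot u_2$, where $2$-forms are identified with vector fields by contraction with the standard volume form $dx_1\wedge dx_2\wedge dx_3$ (so $dx_i\wedge dx_j\leftrightarrow\varepsilon_{ij}\partial_{x_{t_{ij}}}$) and $3$-forms with functions ($f\,dx_1\wedge dx_2\wedge dx_3\leftrightarrow f$). Principal gradation: $\deg x_i=-\deg\partial_{x_i}=2$, $\deg e_k=\deg E=\deg F=\deg H=0$, $\deg dx_i=-1$. Lie conformal superalgebra of type $(3,0)$: $\mathbb Z/2$-graded $\mathbb F[\boldsymbol\partial]$-module with $\boldsymbol\lambda$-bracket $R\otimes R\to\mathbb F[\boldsymbol\lambda]\otimes R$ satisfying $[(\partial_ia)_{\boldsymbol\lambda}b]=-\lambda_i[a_{\boldsymbol\lambda}b]$, $[a_{\boldsymbol\lambda}(\partial_ib)]=(\partial_i+\lambda_i)[a_{\boldsymbol\lambda}b]$,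 $[b_{\boldsymbol\lambda}a]=-(-1)^{p(a)p(b)}[a_{-\boldsymbol\lambda-\boldsymbol\partial}b]$ and $[a_{\boldsymbol\lambda}[b_{\boldsymbol\mu}c]]=[[a_{\boldsymbol\lambda}b]_{\boldsymbol\lambda+\boldsymbol\mu}c]+(-1)^{p(a)p(b)}[b_{\boldsymbol\mu}[a_{\boldsymbol\lambda}c]]$. $RE(3,6)$ is the free $\mathbb F[\boldsymbol\partial]$-module on $A\oplus B\oplus C$, $A=\langle a_1,a_2,a_3\rangle$ even of degree $-2$, $B=\langle b_1,b_2,b_3\rangle\otimes\mathbb F^2$ odd of degree $-1$, $C=\mathfrak{sl}_2$ even of degree $0$ ($\deg\partial_i=\deg\lambda_i=-2$). With $b_{hk}=b_h\otimes e_k$, $c,c'\in C$, $v\in\mathbb F^2$: $[{a_i}_{\boldsymbol\lambda}a_j]=(\partial_i+\lambda_i)a_j+\lambda_ja_i$; $[{a_i}_{\boldsymbol\lambda}b_{hk}]=(\partial_i+\frac32\lambda_i)b_{hk}-\delta_{ih}\sum_{j=1}^3\lambda_jb_{jk}$; $[{b_{ij}}_{\boldsymbol\lambda}b_{hk}]=(j-k)\varepsilon_{ih}a_{t_{ih}}$; $[{a_i}_{\boldsymbol\lambda}c]=(\partial_i+\lambda_i)c$; $[c_{\boldsymbol\lambda}(b_h\otimes v)]=b_h\otimes c.v$; $[c_{\boldsymbol\lambda}c']=[c,c']$; extended by sesquilinearity, the brackets of generators in the opposite order being those given by skew-symmetry. Annihilation algebra: $\mathcal A(R)=(R\otimes\mathbb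 F[[\boldsymbol y]])/\sum_i(\partial_i+\partial_{y_i})(R\otimes\mathbb F[[\boldsymbol y]])$ with (continuous) bracket $[a\boldsymbol y^M,b\boldsymbol y^N]=\sum_J\frac1{J!}(a_Jb)(\partial_{\boldsymbol y}^J\boldsymbol y^M)\boldsymbol y^N$, where $[a_{\boldsymbol\lambda}b]=\sum_J\frac{\boldsymbol\lambda^J}{J!}(a_Jb)$; gradation $\deg(a\boldsymbol y^M)=\deg a+2|M|$. $\mathfrak g(R)=(D\ltimes\mathcal A(R))/\{x-\mathrm{ad}(x):x\in\mathcal A(R)_{-2}\}$, $D=\langle\partial_{y_1},\partial_{y_2},\partial_{y_3}\rangle$, which here is identified with $\mathcal A(R)$.
   Formalization: The bracket of b_ij and b_hk in RE(3,6) is corrected to (j−k)ε_ih a_t + ε_ih(∂_t/2+λ_t) e_j·e_k, t=t_ih; with the printed first term alone the map is not a homomorphism: [x_1dx_2⊗e_1, dx_3⊗e_1]=E, but [b_21 y_1, b_31]=0. *)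

theory Defs
  imports
    "HOL-Analysis.Analysis"
    "HOL-Library.Poly_Mapping"
    "HOL-Computational_Algebra.Polynomial"
    "HOL-Computational_Algebra.Formal_Power_Series"
begin

section \<open>Complete graded Lie superalgebras\<close>

text \<open>
  Degrees of parity live in the type \<open>2\<close>, i.e. in Z/2Z.  The algebras below are algebras of formal
  power series, so a Z-gradation is understood in the completed sense: the algebra is the product
  (not the sum) of its homogeneous components.  \<open>gs_filt L n\<close> is the closed subspace of elements all
  of whose components have degree at least \<open>n\<close>; these subspaces form a basis of neighbourhoods
  of 0.
\<close>

record ('k, 'v) gsalg =
  gs_carrier :: "'v set"
  gs_add :: "'v \<Rightarrow> 'v \<Rightarrow> 'v"
  gs_zero :: "'v"
  gs_smult :: "'k \<Rightarrow> 'v \<Rightarrow> 'v"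
  gs_bracket :: "'v \<Rightarrow> 'v \<Rightarrow> 'v"
  gs_parity :: "2 \<Rightarrow> 'v set"
  gs_comp :: "int \<Rightarrow> 'v set"
  gs_filt :: "int \<Rightarrow> 'v set"

definition super_sign :: "2 \<Rightarrow> 2 \<Rightarrow> 'k::ring_1" where
  "super_sign p q = (if p = 1 \<and> q = 1 then - 1 else 1)"

definition gs_subspace :: "('k, 'v) gsalg \<Rightarrow> 'v set \<Rightarrow> bool" where
  "gs_subspace L S \<longleftrightarrow> S \<subseteq> gs_carrier L \<and> gs_zero L \<in> S \<and>
     (\<forall>x\<in>S. \<forall>y\<in>S. gs_add L x y \<in> S) \<and> (\<forall>c. \<forall>x\<in>S. gs_smult L c x \<in> S)"

definition gs_direct_sum :: "('k, 'v) gsalg \<Rightarrow> 'v set \<Rightarrow> 'v set \<Rightarrow> 'v set \<Rightarrow> bool" where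
  "gs_direct_sum L S T U \<longleftrightarrow>
     S = {gs_add L x y | x y. x \<in> T \<and> y \<in> U} \<and> T \<inter> U = {gs_zero L}"

primrec gs_partial_sum :: "('k, 'v) gsalg \<Rightarrow> int \<Rightarrow> (int \<Rightarrow> 'v) \<Rightarrow> nat \<Rightarrow> 'v" where
  "gs_partial_sum L N x 0 = gs_zero L"
| "gs_partial_sum L N x (Suc n) = gs_add L (gs_partial_sum L N x n) (x (N + int n))"

locale graded_lie_superalgebra =
  fixes L :: "('k::field, 'v) gsalg"
  assumes carrier_subspace: "gs_subspace L (gs_carrier L)"
    and add_assoc: "\<lbrakk>x \<in> gs_carrier L; y \<in> gs_carrier L; z \<in> gs_carrier L\<rbrakk>
          \<Longrightarrow> gs_add L (gs_add L x y) z = gs_add L x (gs_add L y z)"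
    and add_commute: "\<lbrakk>x \<in> gs_carrier L; y \<in> gs_carrier L\<rbrakk> \<Longrightarrow> gs_add L x y = gs_add L y x"
    and add_zero: "x \<in> gs_carrier L \<Longrightarrow> gs_add L (gs_zero L) x = x"
    and add_inverse: "x \<in> gs_carrier L \<Longrightarrow> gs_add L x (gs_smult L (- 1) x) = gs_zero L"
    and smult_add_right: "\<lbrakk>x \<in> gs_carrier L; y \<in> gs_carrier L\<rbrakk>
          \<Longrightarrow> gs_smult L c (gs_add L x y) = gs_add L (gs_smult L c x) (gs_smult L c y)"
    and smult_add_left: "x \<in> gs_carrier L
          \<Longrightarrow> gs_smult L (c + c') x = gs_add L (gs_smult L c x) (gs_smult L c' x)"
    and smult_assoc: "x \<in> gs_carrier L \<Longrightarrow> gs_smult L c (gs_smult L c' x) = gs_smult L (c * c') x"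
    and smult_one: "x \<in> gs_carrier L \<Longrightarrow> gs_smult L 1 x = x"
    and bracket_closed: "\<lbrakk>x \<in> gs_carrier L; y \<in> gs_carrier L\<rbrakk> \<Longrightarrow> gs_bracket L x y \<in> gs_carrier L"
    and bracket_add_left: "\<lbrakk>x \<in> gs_carrier L; y \<in> gs_carrier L; z \<in> gs_carrier L\<rbrakk>
          \<Longrightarrow> gs_bracket L (gs_add L x y) z = gs_add L (gs_bracket L x z) (gs_bracket L y z)"
    and bracket_add_right: "\<lbrakk>x \<in> gs_carrier L; y \<in> gs_carrier L; z \<in> gs_carrier L\<rbrakk>
          \<Longrightarrow> gs_bracket L x (gs_add L y z) = gs_add L (gs_bracket L x y) (gs_bracket L x z)"
    and bracket_smult_left: "\<lbrakk>x \<in> gs_carrier L; y \<in> gs_carrier L\<rbrakk>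
          \<Longrightarrow> gs_bracket L (gs_smult L c x) y = gs_smult L c (gs_bracket L x y)"
    and bracket_smult_right: "\<lbrakk>x \<in> gs_carrier L; y \<in> gs_carrier L\<rbrakk>
          \<Longrightarrow> gs_bracket L x (gs_smult L c y) = gs_smult L c (gs_bracket L x y)"
    and parity_subspace: "gs_subspace L (gs_parity L p)"
    and parity_sum: "gs_direct_sum L (gs_carrier L) (gs_parity L 0) (gs_parity L 1)"
    and parity_bracket: "\<lbrakk>x \<in> gs_parity L p; y \<in> gs_parity L q\<rbrakk>
          \<Longrightarrow> gs_bracket L x y \<in> gs_parity L (p + q)"
    and super_skew: "\<lbrakk>x \<in> gs_parity L p; y \<in> gs_parity L q\<rbrakk>
          \<Longrightarrow> gs_bracket L y x = gs_smult L (- super_sign p q) (gs_bracket L x y)"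
    and super_jacobi: "\<lbrakk>x \<in> gs_parity L p; y \<in> gs_parity L q; z \<in> gs_carrier L\<rbrakk>
          \<Longrightarrow> gs_bracket L x (gs_bracket L y z) =
              gs_add L (gs_bracket L (gs_bracket L x y) z)
                (gs_smult L (super_sign p q) (gs_bracket L y (gs_bracket L x z)))"
    and comp_subspace: "gs_subspace L (gs_comp L d)"
    and comp_parity: "gs_direct_sum L (gs_comp L d)
          (gs_comp L d \<inter> gs_parity L 0) (gs_comp L d \<inter> gs_parity L 1)"
    and comp_bracket: "\<lbrakk>x \<in> gs_comp L d; y \<in> gs_comp L e\<rbrakk>
          \<Longrightarrow> gs_bracket L x y \<in> gs_comp L (d + e)"
    and filt_subspace: "gs_subspace L (gs_filt L d)"
    and filt_parity: "gs_direct_sum L (gs_filt L d)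
          (gs_filt L d \<inter> gs_parity L 0) (gs_filt L d \<inter> gs_parity L 1)"
    and filt_bracket: "\<lbrakk>x \<in> gs_filt L d; y \<in> gs_filt L e\<rbrakk>
          \<Longrightarrow> gs_bracket L x y \<in> gs_filt L (d + e)"
    and filt_comp: "gs_direct_sum L (gs_filt L d) (gs_comp L d) (gs_filt L (d + 1))"
    and filt_exhaustive: "\<exists>N. gs_filt L N = gs_carrier L"
    and filt_separated: "(\<Inter>d. gs_filt L d) = {gs_zero L}"
    and complete: "(\<And>d. h d \<in> gs_comp L d) \<Longrightarrow>
          \<exists>z\<in>gs_carrier L. \<forall>n. \<exists>r\<in>gs_filt L (N + int n). z = gs_add L (gs_partial_sum L N h n) r"

definition gs_linear :: "('k, 'v) gsalg \<Rightarrow> ('k, 'w) gsalg \<Rightarrow> ('v \<Rightarrow> 'w) \<Rightarrow> bool" where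
  "gs_linear L L' \<Phi> \<longleftrightarrow> \<Phi> \<in> gs_carrier L \<rightarrow> gs_carrier L' \<and>
     (\<forall>x\<in>gs_carrier L. \<forall>y\<in>gs_carrier L. \<Phi> (gs_add L x y) = gs_add L' (\<Phi> x) (\<Phi> y)) \<and>
     (\<forall>c. \<forall>x\<in>gs_carrier L. \<Phi> (gs_smult L c x) = gs_smult L' c (\<Phi> x))"

text \<open>Continuity at 0, hence everywhere, when \<open>\<Phi>\<close> is linear.\<close>

definition gs_continuous :: "('k, 'v) gsalg \<Rightarrow> ('k, 'w) gsalg \<Rightarrow> ('v \<Rightarrow> 'w) \<Rightarrow> bool" where
  "gs_continuous L L' \<Phi> \<longleftrightarrow> (\<forall>n. \<exists>m. \<Phi> ` gs_filt L m \<subseteq> gs_filt L' n)"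

definition gs_iso :: "('k, 'v) gsalg \<Rightarrow> ('k, 'w) gsalg \<Rightarrow> ('v \<Rightarrow> 'w) \<Rightarrow> bool" where
  "gs_iso L L' \<Phi> \<longleftrightarrow> gs_linear L L' \<Phi> \<and> bij_betw \<Phi> (gs_carrier L) (gs_carrier L') \<and>
     (\<forall>x\<in>gs_carrier L. \<forall>y\<in>gs_carrier L. \<Phi> (gs_bracket L x y) = gs_bracket L' (\<Phi> x) (\<Phi> y)) \<and>
     (\<forall>p. \<Phi> ` gs_parity L p = gs_parity L' p) \<and>
     (\<forall>d. \<Phi> ` gs_comp L d = gs_comp L' d)"

text \<open>
  The quotient by a subspace \<open>N\<close>.  Operations on classes are unions over all representatives, so
  they return a class only if they are independent of the representatives.
\<close>

definition gs_quot_rel :: "('k, 'v) gsalg \<Rightarrow> 'v set \<Rightarrow> ('v \<times> 'v) set" where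
  "gs_quot_rel L N =
     {(x, y). x \<in> gs_carrier L \<and> y \<in> gs_carrier L \<and> (\<exists>n\<in>N. y = gs_add L x n)}"

definition gs_class :: "('k, 'v) gsalg \<Rightarrow> 'v set \<Rightarrow> 'v \<Rightarrow> 'v set" where
  "gs_class L N x = gs_quot_rel L N `` {x}"

definition gs_quotient :: "('k, 'v) gsalg \<Rightarrow> 'v set \<Rightarrow> ('k, 'v set) gsalg" where
  "gs_quotient L N =
    \<lparr>gs_carrier = gs_carrier L // gs_quot_rel L N,
     gs_add = (\<lambda>X Y. \<Union>x\<in>X. \<Union>y\<in>Y. gs_class L N (gs_add L x y)),
     gs_zero = gs_class L N (gs_zero L),
     gs_smult = (\<lambda>c X. \<Union>x\<in>X. gs_class L N (gs_smult L c x)),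
     gs_bracket = (\<lambda>X Y. \<Union>x\<in>X. \<Union>y\<in>Y. gs_class L N (gs_bracket L x y)),
     gs_parity = (\<lambda>p. gs_class L N ` gs_parity L p),
     gs_comp = (\<lambda>d. gs_class L N ` gs_comp L d),
     gs_filt = (\<lambda>d. gs_class L N ` gs_filt L d)\<rparr>"


section \<open>Three variables\<close>

text \<open>
  The index set {1,2,3} is the type \<open>3\<close>, in which \<open>3 = 0\<close> and arithmetic is modulo 3: the index
  different from \<open>i \<noteq> j\<close> is \<open>- i - j\<close>, and (i,j,t) is an even permutation iff \<open>j = i + 1\<close>.
\<close>

definition third :: "3 \<Rightarrow> 3 \<Rightarrow> 3" where
  "third i j = - i - j"

definition eps :: "3 \<Rightarrow> 3 \<Rightarrow> 'r::ring_1" where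
  "eps i j = (if j = i + 1 then 1 else if i = j + 1 then - 1 else 0)"

type_synonym mon = "nat ^ 3"

definition mdeg :: "mon \<Rightarrow> nat" where
  "mdeg M = (\<Sum>i\<in>UNIV. M $ i)"

text \<open>
  Power series in three variables, as iterated power series: the outermost variable is the third
  one.
\<close>

type_synonym 'a fps3 = "'a fps fps fps"

definition coeff3 :: "'a fps3 \<Rightarrow> mon \<Rightarrow> 'a" where
  "coeff3 f M = fps_nth (fps_nth (fps_nth f (M $ 3)) (M $ 2)) (M $ 1)"

definition const3 :: "'a::zero \<Rightarrow> 'a fps3" where
  "const3 c = fps_const (fps_const (fps_const c))"

definition var3 :: "3 \<Rightarrow> 'a::comm_ring_1 fps3" where
  "var3 i = (if i = 1 then fps_const (fps_const fps_X) else if i = 2 then fps_const fps_X else fps_X)"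

definition monom3 :: "mon \<Rightarrow> 'a::comm_ring_1 fps3" where
  "monom3 M = (\<Prod>i\<in>UNIV. var3 i ^ (M $ i))"

definition pderiv3 :: "3 \<Rightarrow> 'a::comm_ring_1 fps3 \<Rightarrow> 'a fps3" where
  "pderiv3 i f =
    (if i = 1 then Abs_fps (\<lambda>n. Abs_fps (\<lambda>m. fps_deriv (fps_nth (fps_nth f n) m)))
     else if i = 2 then Abs_fps (\<lambda>n. fps_deriv (fps_nth f n))
     else fps_deriv f)"

definition pderivs3 :: "mon \<Rightarrow> 'a::comm_ring_1 fps3 \<Rightarrow> 'a fps3" where
  "pderivs3 J f = (pderiv3 1 ^^ (J $ 1)) ((pderiv3 2 ^^ (J $ 2)) ((pderiv3 3 ^^ (J $ 3)) f))"

text \<open>Polynomials in three variables.\<close>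

type_synonym 'r poly3 = "mon \<Rightarrow>\<^sub>0 'r"

definition mfact :: "mon \<Rightarrow> 'a::field_char_0" where
  "mfact J = (\<Prod>i\<in>UNIV. fact (J $ i))"


section \<open>The Lie algebra sl2 and its standard module\<close>

datatype sl2_basis = bE | bF | bH

instance sl2_basis :: finite
proof
  have "(UNIV :: sl2_basis set) = {bE, bF, bH}"
    using sl2_basis.exhaust by blast
  then show "finite (UNIV :: sl2_basis set)"
    by (metis finite.emptyI finite_insert)
qed

text \<open>
  \<open>'r ^ sl2_basis\<close> is sl2 with coefficients in \<open>'r\<close>.  \<open>sl2_sym u w\<close> is the product of \<open>u\<close> and \<open>w\<close> in
  the symmetric square, identified with sl2 by E = e1 e1 / 2, F = - e2 e2 / 2, H = - e1 e2.
\<close>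

definition sl2_bracket :: "'r::comm_ring_1 ^ sl2_basis \<Rightarrow> 'r ^ sl2_basis \<Rightarrow> 'r ^ sl2_basis" where
  "sl2_bracket c d = (\<chi> z. case z of
      bE \<Rightarrow> 2 * (c $ bH * d $ bE - c $ bE * d $ bH)
    | bF \<Rightarrow> 2 * (c $ bF * d $ bH - c $ bH * d $ bF)
    | bH \<Rightarrow> c $ bE * d $ bF - c $ bF * d $ bE)"

definition sl2_act :: "'r::comm_ring_1 ^ sl2_basis \<Rightarrow> 'r ^ 2 \<Rightarrow> 'r ^ 2" where
  "sl2_act c v = (\<chi> k. if k = 1 then c $ bH * v $ 1 + c $ bE * v $ 2
                         else c $ bF * v $ 1 - c $ bH * v $ 2)"

definition sl2_sym :: "'r::comm_ring_1 ^ 2 \<Rightarrow> 'r ^ 2 \<Rightarrow> 'r ^ sl2_basis" where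
  "sl2_sym u w = (\<chi> z. case z of
      bE \<Rightarrow> 2 * (u $ 1 * w $ 1)
    | bF \<Rightarrow> - 2 * (u $ 2 * w $ 2)
    | bH \<Rightarrow> - (u $ 1 * w $ 2 + u $ 2 * w $ 1))"

definition sl2_ext :: "'r::comm_ring_1 ^ 2 \<Rightarrow> 'r ^ 2 \<Rightarrow> 'r" where
  "sl2_ext u w = u $ 1 * w $ 2 - u $ 2 * w $ 1"


section \<open>The Lie superalgebra E(3,6)\<close>

text \<open>
  An element (X, c, w) stands for the sum of the vector field with components X, of
  c in Omega0 tensor sl2, and of the odd element given by the sum over h, k of
  \<open>w $ h $ k\<close> dx_h tensor e_k.
\<close>

type_synonym 'a e36 = "('a fps3 ^ 3) \<times> ('a fps3 ^ sl2_basis) \<times> ('a fps3 ^ 2 ^ 3)"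

definition vf_apply :: "'a::comm_ring_1 fps3 ^ 3 \<Rightarrow> 'a fps3 \<Rightarrow> 'a fps3" where
  "vf_apply X f = (\<Sum>i\<in>UNIV. X $ i * pderiv3 i f)"

definition vf_bracket :: "'a::comm_ring_1 fps3 ^ 3 \<Rightarrow> 'a fps3 ^ 3 \<Rightarrow> 'a fps3 ^ 3" where
  "vf_bracket X Y = (\<chi> j. vf_apply X (Y $ j) - vf_apply Y (X $ j))"

definition vf_div :: "'a::comm_ring_1 fps3 ^ 3 \<Rightarrow> 'a fps3" where
  "vf_div X = (\<Sum>i\<in>UNIV. pderiv3 i (X $ i))"

text \<open>
  1-forms are given by their coefficients, 2-forms by the corresponding vector field (dx_i dx_j being
  \<open>eps i j\<close> times the basis field of index \<open>third i j\<close>), and 3-forms by the corresponding function.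
  1-forms and 2-forms commute.
\<close>

definition lie_deriv1 :: "'a::comm_ring_1 fps3 ^ 3 \<Rightarrow> 'a fps3 ^ 3 \<Rightarrow> 'a fps3 ^ 3" where
  "lie_deriv1 X \<alpha> = (\<chi> h. vf_apply X (\<alpha> $ h) + (\<Sum>i\<in>UNIV. \<alpha> $ i * pderiv3 h (X $ i)))"

definition wedge11 :: "'a::comm_ring_1 fps3 ^ 3 \<Rightarrow> 'a fps3 ^ 3 \<Rightarrow> 'a fps3 ^ 3" where
  "wedge11 \<alpha> \<beta> =
    (\<chi> t. \<Sum>i\<in>UNIV. \<Sum>j\<in>UNIV. if third i j = t then eps i j * (\<alpha> $ i * \<beta> $ j) else 0)"

definition ext_deriv1 :: "'a::comm_ring_1 fps3 ^ 3 \<Rightarrow> 'a fps3 ^ 3" where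
  "ext_deriv1 \<alpha> =
    (\<chi> t. \<Sum>i\<in>UNIV. \<Sum>j\<in>UNIV. if third i j = t then eps i j * pderiv3 i (\<alpha> $ j) else 0)"

definition wedge21 :: "'a::comm_ring_1 fps3 ^ 3 \<Rightarrow> 'a fps3 ^ 3 \<Rightarrow> 'a fps3" where
  "wedge21 \<sigma> \<beta> = (\<Sum>t\<in>UNIV. \<sigma> $ t * \<beta> $ t)"

definition odd_form :: "'r ^ 2 ^ 3 \<Rightarrow> 2 \<Rightarrow> 'r ^ 3" where
  "odd_form w k = (\<chi> h. w $ h $ k)"

definition e36_even_on_odd ::
  "'a::field_char_0 fps3 ^ 3 \<Rightarrow> 'a fps3 ^ sl2_basis \<Rightarrow> 'a fps3 ^ 2 ^ 3 \<Rightarrow> 'a fps3 ^ 2 ^ 3" where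
  "e36_even_on_odd X c w =
    (\<chi> h. \<chi> k. lie_deriv1 X (odd_form w k) $ h - const3 (1 / 2) * vf_div X * w $ h $ k
               + sl2_act c (w $ h) $ k)"

definition e36_odd_vf :: "'a::field_char_0 fps3 ^ 2 ^ 3 \<Rightarrow> 'a fps3 ^ 2 ^ 3 \<Rightarrow> 'a fps3 ^ 3" where
  "e36_odd_vf w w' =
    (\<Sum>k\<in>UNIV. \<Sum>l\<in>UNIV.
       sl2_ext (axis k 1) (axis l 1) *s wedge11 (odd_form w k) (odd_form w' l))"

definition e36_odd_sl2 ::
  "'a::field_char_0 fps3 ^ 2 ^ 3 \<Rightarrow> 'a fps3 ^ 2 ^ 3 \<Rightarrow> 'a fps3 ^ sl2_basis" where
  "e36_odd_sl2 w w' =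
    (\<Sum>k\<in>UNIV. \<Sum>l\<in>UNIV.
       (const3 (1 / 2) *
          (wedge21 (ext_deriv1 (odd_form w k)) (odd_form w' l)
           + wedge21 (ext_deriv1 (odd_form w' l)) (odd_form w k)))
       *s sl2_sym (axis k 1) (axis l 1))"

fun e36_bracket :: "'a::field_char_0 e36 \<Rightarrow> 'a e36 \<Rightarrow> 'a e36" where
  "e36_bracket (X, c, w) (X', c', w') =
    (vf_bracket X X' + e36_odd_vf w w',
     (\<chi> z. vf_apply X (c' $ z) - vf_apply X' (c $ z)) + sl2_bracket c c' + e36_odd_sl2 w w',
     e36_even_on_odd X c w' - e36_even_on_odd X' c' w)"

fun e36_smult :: "'a::field_char_0 \<Rightarrow> 'a e36 \<Rightarrow> 'a e36" where
  "e36_smult r (X, c, w) = (const3 r *s X, const3 r *s c, (\<chi> h. const3 r *s w $ h))"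

text \<open>Elements all of whose terms have a principal degree satisfying \<open>P\<close>.\<close>

definition e36_degrees :: "(int \<Rightarrow> bool) \<Rightarrow> 'a::field_char_0 e36 set" where
  "e36_degrees P = {(X, c, w). \<forall>M.
     (\<forall>i. coeff3 (X $ i) M \<noteq> 0 \<longrightarrow> P (2 * int (mdeg M) - 2)) \<and>
     (\<forall>z. coeff3 (c $ z) M \<noteq> 0 \<longrightarrow> P (2 * int (mdeg M))) \<and>
     (\<forall>h k. coeff3 (w $ h $ k) M \<noteq> 0 \<longrightarrow> P (2 * int (mdeg M) - 1))}"

definition E36 :: "('a::field_char_0, 'a e36) gsalg" where
  "E36 =
    \<lparr>gs_carrier = UNIV, gs_add = (+), gs_zero = 0, gs_smult = e36_smult, gs_bracket = e36_bracket,
     gs_parity = (\<lambda>p. if p = 0 then {(X, c, w). w = 0} else {(X, c, w). X = 0 \<and> c = 0}),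
     gs_comp = (\<lambda>d. e36_degrees (\<lambda>e. e = d)),
     gs_filt = (\<lambda>d. e36_degrees (\<lambda>e. e \<ge> d))\<rparr>"


section \<open>The Lie conformal superalgebra RE(3,6)\<close>

datatype gen = GA "3" | GB "3" "2" | GC sl2_basis

instance gen :: finite
proof
  have "x \<in> range GA \<union> case_prod GB ` UNIV \<union> range GC" for x
    by (cases x) auto
  then have "(UNIV :: gen set) = range GA \<union> case_prod GB ` UNIV \<union> range GC"
    by blast
  then show "finite (UNIV :: gen set)"
    by (metis finite_UN finite_Un finite_imageI finite)
qed

fun gen_parity :: "gen \<Rightarrow> 2" where
  "gen_parity (GA i) = 0"
| "gen_parity (GB h k) = 1"
| "gen_parity (GC z) = 0"

fun gen_degree :: "gen \<Rightarrow> int" where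
  "gen_degree (GA i) = - 2"
| "gen_degree (GB h k) = - 1"
| "gen_degree (GC z) = 0"

text \<open>
  \<open>'a poly3 ^ gen\<close> is the free module over the polynomials in the three derivations, and
  \<open>'a poly3 poly3 ^ gen\<close> (outer variables lambda, inner variables the derivations) its tensor product
  with the polynomials in lambda.
\<close>

type_synonym 'a re36 = "'a poly3 ^ gen"
type_synonym 'a lam_re36 = "'a poly3 poly3 ^ gen"

definition scal :: "'a::comm_ring_1 \<Rightarrow> 'a poly3 poly3" where
  "scal c = Poly_Mapping.single 0 (Poly_Mapping.single 0 c)"

definition del :: "3 \<Rightarrow> 'a::comm_ring_1 poly3 poly3" where
  "del i = Poly_Mapping.single 0 (Poly_Mapping.single (axis i 1) 1)"

definition lam :: "3 \<Rightarrow> 'a::comm_ring_1 poly3 poly3" where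
  "lam i = Poly_Mapping.single (axis i 1) 1"

definition gen_vec :: "gen \<Rightarrow> 'a::comm_ring_1 lam_re36" where
  "gen_vec g = axis g 1"

definition sl2_vec :: "'a::comm_ring_1 ^ sl2_basis \<Rightarrow> 'a lam_re36" where
  "sl2_vec c = (\<Sum>z\<in>UNIV. scal (c $ z) *s gen_vec (GC z))"

definition b_vec :: "3 \<Rightarrow> 'a::comm_ring_1 ^ 2 \<Rightarrow> 'a lam_re36" where
  "b_vec h v = (\<Sum>k\<in>UNIV. scal (v $ k) *s gen_vec (GB h k))"

text \<open>The label 1 or 2 as an integer (in the type \<open>2\<close> itself, \<open>2 = 0\<close>).\<close>

definition label2 :: "2 \<Rightarrow> int" where
  "label2 k = (if k = 1 then 1 else 2)"

text \<open>
  Lambda-brackets of generators.  Correction to the source: it prints only the first term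
  (j - k) eps_ih a_t of the bracket of b_ij and b_hk (t the third index).  The sl2-valued term
    eps_ih (del_t / 2 + lam_t) e_j e_k
  is added here, because the printed table is not that of a Lie conformal superalgebra (the Jacobi
  identity fails for c, b_ij, b_hk, since the bracket of c and a_t is lam_t c) and its brackets do
  not match those of E(3,6), where x_1 dx_2 tensor e_1 and dx_3 tensor e_1 have bracket E rather
  than 0.  The added term is the only one for which they match.
\<close>

fun gen_bracket_table :: "gen \<Rightarrow> gen \<Rightarrow> 'a::field_char_0 lam_re36" where
  "gen_bracket_table (GA i) (GA j) = (del i + lam i) *s gen_vec (GA j) + lam j *s gen_vec (GA i)"
| "gen_bracket_table (GA i) (GB h k) =
     (del i + scal (3 / 2) * lam i) *s gen_vec (GB h k)
     - (if i = h then \<Sum>j\<in>UNIV. lam j *s gen_vec (GB j k) else 0)"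
| "gen_bracket_table (GB i j) (GB h k) =
     scal (of_int (label2 j - label2 k) * eps i h) *s gen_vec (GA (third i h))
     + (scal (eps i h) * (scal (1 / 2) * del (third i h) + lam (third i h)))
         *s sl2_vec (sl2_sym (axis j 1) (axis k 1))"
| "gen_bracket_table (GA i) (GC z) = (del i + lam i) *s gen_vec (GC z)"
| "gen_bracket_table (GC z) (GB h k) = b_vec h (sl2_act (axis z 1) (axis k 1))"
| "gen_bracket_table (GC z) (GC z') = sl2_vec (sl2_bracket (axis z 1) (axis z' 1))"
| "gen_bracket_table _ _ = 0"

text \<open>The substitution of - lambda - del for lambda.\<close>

definition lam_reflect :: "'a::comm_ring_1 poly3 poly3 \<Rightarrow> 'a poly3 poly3" where
  "lam_reflect Q =
    (\<Sum>J\<in>Poly_Mapping.keys Q. Poly_Mapping.single 0 (Poly_Mapping.lookup Q J) *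
       (\<Prod>i\<in>UNIV. (- lam i - del i) ^ (J $ i)))"

text \<open>In the three pairs missing from the table one of the generators is even.\<close>

fun gen_bracket :: "gen \<Rightarrow> gen \<Rightarrow> 'a::field_char_0 lam_re36" where
  "gen_bracket (GB h k) (GA i) = (\<chi> u. - lam_reflect (gen_bracket_table (GA i) (GB h k) $ u))"
| "gen_bracket (GC z) (GA i) = (\<chi> u. - lam_reflect (gen_bracket_table (GA i) (GC z) $ u))"
| "gen_bracket (GB h k) (GC z) = (\<chi> u. - lam_reflect (gen_bracket_table (GC z) (GB h k) $ u))"
| "gen_bracket g h = gen_bracket_table g h"

definition poly3_subst ::
  "(3 \<Rightarrow> 'a::comm_ring_1 poly3 poly3) \<Rightarrow> 'a poly3 \<Rightarrow> 'a poly3 poly3" where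
  "poly3_subst v P =
    (\<Sum>K\<in>Poly_Mapping.keys P. scal (Poly_Mapping.lookup P K) * (\<Prod>i\<in>UNIV. v i ^ (K $ i)))"

text \<open>Sesquilinear extension: the bracket of P(del) g and Q(del) h is P(-lam) Q(del + lam) times that of g and h.\<close>

definition lam_bracket :: "'a::field_char_0 re36 \<Rightarrow> 'a re36 \<Rightarrow> 'a lam_re36" where
  "lam_bracket a b =
    (\<Sum>g\<in>UNIV. \<Sum>h\<in>UNIV.
       (poly3_subst (\<lambda>i. - lam i) (a $ g) * poly3_subst (\<lambda>i. del i + lam i) (b $ h))
       *s gen_bracket g h)"

text \<open>\<open>J!\<close> times the coefficient of \<open>lambda ^ J\<close>.\<close>

definition j_product :: "mon \<Rightarrow> 'a::field_char_0 re36 \<Rightarrow> 'a re36 \<Rightarrow> 'a re36" where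
  "j_product J a b =
    (\<chi> u. Poly_Mapping.single 0 (mfact J) * Poly_Mapping.lookup (lam_bracket a b $ u) J)"


section \<open>The annihilation algebra\<close>

text \<open>
  The tensor product of the free module with the power series in y: polynomials in the derivations
  with power series coefficients.
\<close>

type_synonym 'a aff_re36 = "'a fps3 poly3 ^ gen"

definition tensor :: "'a::field_char_0 re36 \<Rightarrow> 'a fps3 \<Rightarrow> 'a aff_re36" where
  "tensor a f = (\<chi> g. Poly_Mapping.map (\<lambda>c. const3 c * f) (a $ g))"

definition aff_del :: "3 \<Rightarrow> 'a::field_char_0 aff_re36 \<Rightarrow> 'a aff_re36" where
  "aff_del i U = Poly_Mapping.single (axis i 1) 1 *s U"

definition aff_dy :: "3 \<Rightarrow> 'a::field_char_0 aff_re36 \<Rightarrow> 'a aff_re36" where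
  "aff_dy i U = (\<chi> g. Poly_Mapping.map (pderiv3 i) (U $ g))"

definition aff_smult :: "'a::field_char_0 \<Rightarrow> 'a aff_re36 \<Rightarrow> 'a aff_re36" where
  "aff_smult c U = Poly_Mapping.single 0 (const3 c) *s U"

definition basis_re36 :: "gen \<Rightarrow> mon \<Rightarrow> 'a::field_char_0 re36" where
  "basis_re36 g K = axis g (Poly_Mapping.single K 1)"

text \<open>
  [a f, b g] is the sum over J of (a_J b) (D^J f) g / J!, for a, b in RE(3,6) and power
  series f, g; only finitely many J contribute.
\<close>

definition aff_bracket_pure ::
  "'a::field_char_0 re36 \<Rightarrow> 'a fps3 \<Rightarrow> 'a re36 \<Rightarrow> 'a fps3 \<Rightarrow> 'a aff_re36" where
  "aff_bracket_pure a f b g =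
    (\<Sum>J | j_product J a b \<noteq> 0.
       aff_smult (1 / mfact J) (tensor (j_product J a b) (pderivs3 J f * g)))"

definition aff_bracket :: "'a::field_char_0 aff_re36 \<Rightarrow> 'a aff_re36 \<Rightarrow> 'a aff_re36" where
  "aff_bracket U V =
    (\<Sum>g\<in>UNIV. \<Sum>K\<in>Poly_Mapping.keys (U $ g). \<Sum>h\<in>UNIV. \<Sum>N\<in>Poly_Mapping.keys (V $ h).
       aff_bracket_pure (basis_re36 g K) (Poly_Mapping.lookup (U $ g) K)
                        (basis_re36 h N) (Poly_Mapping.lookup (V $ h) N))"

definition aff_degrees :: "(int \<Rightarrow> bool) \<Rightarrow> 'a::field_char_0 aff_re36 set" where
  "aff_degrees P = {U. \<forall>g K M. coeff3 (Poly_Mapping.lookup (U $ g) K) M \<noteq> 0 \<longrightarrow>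
     P (gen_degree g - 2 * int (mdeg K) + 2 * int (mdeg M))}"

definition aff_RE36 :: "('a::field_char_0, 'a aff_re36) gsalg" where
  "aff_RE36 =
    \<lparr>gs_carrier = UNIV, gs_add = (+), gs_zero = 0, gs_smult = aff_smult, gs_bracket = aff_bracket,
     gs_parity = (\<lambda>p. {U. \<forall>g. U $ g \<noteq> 0 \<longrightarrow> gen_parity g = p}),
     gs_comp = (\<lambda>d. aff_degrees (\<lambda>e. e = d)),
     gs_filt = (\<lambda>d. aff_degrees (\<lambda>e. e \<ge> d))\<rparr>"

definition aff_total :: "'a::field_char_0 aff_re36 set" where
  "aff_total = {(\<Sum>i\<in>UNIV. aff_del i (U i) + aff_dy i (U i)) | U. True}"

definition A_RE36 :: "('a::field_char_0, 'a aff_re36 set) gsalg" where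
  "A_RE36 = gs_quotient aff_RE36 aff_total"

text \<open>\<open>'a ^ 3\<close> is D, the span of the three derivations with respect to y; it acts on \<open>A_RE36\<close>.\<close>

definition D_act :: "'a::field_char_0 ^ 3 \<Rightarrow> 'a aff_re36 set \<Rightarrow> 'a aff_re36 set" where
  "D_act d X = (\<Union>x\<in>X. gs_class aff_RE36 aff_total (\<Sum>i\<in>UNIV. aff_smult (d $ i) (aff_dy i x)))"

definition D_A_RE36 :: "('a::field_char_0, ('a ^ 3) \<times> 'a aff_re36 set) gsalg" where
  "D_A_RE36 =
    \<lparr>gs_carrier = UNIV \<times> gs_carrier A_RE36,
     gs_add = (\<lambda>(d, x) (d', x'). (d + d', gs_add A_RE36 x x')),
     gs_zero = (0, gs_zero A_RE36),
     gs_smult = (\<lambda>c (d, x). (c *s d, gs_smult A_RE36 c x)),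
     gs_bracket = (\<lambda>(d, x) (d', x').
       (0, gs_add A_RE36 (gs_bracket A_RE36 x x')
             (gs_add A_RE36 (D_act d x') (gs_smult A_RE36 (- 1) (D_act d' x))))),
     gs_parity = (\<lambda>p. {(d, x). x \<in> gs_parity A_RE36 p \<and> (p \<noteq> 0 \<longrightarrow> d = 0)}),
     gs_comp = (\<lambda>e. {(d, x). x \<in> gs_comp A_RE36 e \<and> (e \<noteq> - 2 \<longrightarrow> d = 0)}),
     gs_filt = (\<lambda>e. {(d, x). x \<in> gs_filt A_RE36 e \<and> (e > - 2 \<longrightarrow> d = 0)})\<rparr>"

text \<open>The elements x - ad x, for x of degree -2 and ad x (which acts as an element d of D) in D.\<close>

definition g_ideal :: "(('a::field_char_0 ^ 3) \<times> 'a aff_re36 set) set" where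
  "g_ideal = {(- d, x) | d x. x \<in> gs_comp A_RE36 (- 2) \<and>
     (\<forall>z\<in>gs_carrier A_RE36. gs_bracket A_RE36 x z = D_act d z)}"

definition g_RE36 :: "('a::field_char_0, (('a ^ 3) \<times> 'a aff_re36 set) set) gsalg" where
  "g_RE36 = gs_quotient D_A_RE36 g_ideal"

definition g_elt :: "'a::field_char_0 re36 \<Rightarrow> 'a fps3 \<Rightarrow> (('a ^ 3) \<times> 'a aff_re36 set) set" where
  "g_elt a f = gs_class D_A_RE36 g_ideal (0, gs_class aff_RE36 aff_total (tensor a f))"

definition c_elt :: "'a::field_char_0 ^ sl2_basis \<Rightarrow> 'a re36" where
  "c_elt c = (\<chi> g. case g of GC z \<Rightarrow> Poly_Mapping.single 0 (c $ z) | _ \<Rightarrow> 0)"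

definition prescribed_values ::
  "((('a::field_char_0 ^ 3) \<times> 'a aff_re36 set) set \<Rightarrow> 'a e36) \<Rightarrow> bool" where
  "prescribed_values \<Phi> \<longleftrightarrow> (\<forall>M.
     (\<forall>i. \<Phi> (g_elt (axis (GA i) 1) (monom3 M)) = (axis i (- monom3 M), 0, 0)) \<and>
     (\<forall>h k. \<Phi> (g_elt (axis (GB h k) 1) (monom3 M)) = (0, 0, axis h (axis k (monom3 M)))) \<and>
     (\<forall>c. \<Phi> (g_elt (c_elt c) (monom3 M)) = (0, (\<chi> z. const3 (c $ z) * monom3 M), 0)))"

end

theory Submission
  imports Defs
begin

text \<open>
  Modulo total derivatives, \<open>\<partial>^K a \<otimes> f\<close> equals \<open>a \<otimes> (- \<partial>_y)^K f\<close>, so the affinised module has the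
  normal form of one power series for each of the twelve generators, just as E(3,6) is a sum of
  twelve copies of the power series.  On a pair of series \<open>(f, g)\<close> a lambda-bracket is evaluated
  by letting \<open>lambda\<close> act as the derivation of \<open>f\<close> and \<open>- lambda - \<partial>\<close> as the derivation of \<open>g\<close>;
  sesquilinearity then makes the normal form compatible with brackets as soon as this holds for the
  brackets of generators.  The kernel of the resulting map from the semidirect product of \<open>D\<close> and
  \<open>A(R)\<close> onto E(3,6) is the ideal of the \<open>x - ad x\<close>, because a constant vector field is determined
  by its adjoint action.
  The axioms of a Lie superalgebra are verified only for E(3,6) and transported back; there, the
  Jacobi identity reduces by multilinearity and skew-symmetry to ten types of triples.
\<close>

section \<open>Power series in three variables\<close>

text \<open>The sign in a_i y^M \<mapsto> - x^M \<partial>_i is forced: \<open>del i + lam i\<close>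
  differentiates only the second series, with a minus sign, so without it the brackets of the a_i
  would give the negative of the commutator of vector fields. The obstacle is that RE(3,6) enters
  only through its table of brackets: neither a conformal Jacobi identity nor the ideal property of
  the total derivatives, or of the elements x - ad x, is at hand. Both quotients are therefore taken
  along a map to E(3,6) that preserves every operation and whose fibres are the classes, so that
  well-definedness on classes comes for free. A(R) alone already maps isomorphically onto E(3,6).
  Its part of degree -2 consists of the constant vector fields, whose adjoint actions are the
  derivations in D, and dividing by the x - ad x removes exactly this duplication. Uniqueness of the
  isomorphism holds because finite combinations of monomials are dense: below any given degree there
  are only finitely many of them.\<close>

lemma coeff3_eqI: "(\<And>M. coeff3 f M = coeff3 g M) \<Longrightarrow> f = g"
proof (intro fps_ext)
  fix n m l
  assume *: "\<And>M. coeff3 f M = coeff3 g M"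
  show "fps_nth (fps_nth (fps_nth f n) m) l = fps_nth (fps_nth (fps_nth g n) m) l"
    using *[of "\<chi> i. if i = 1 then l else if i = 2 then m else n"] by (simp add: coeff3_def)
qed

text \<open>The inverse of \<open>coeff3\<close>. It allows series to be cut by a condition on
  exponents (\<open>e36_filter\<close>) and to be assembled from homogeneous components
  (\<open>e36_complete\<close>).\<close>

definition mk_fps3 :: "(mon \<Rightarrow> 'a) \<Rightarrow> 'a fps3" where
  "mk_fps3 c = Abs_fps (\<lambda>n. Abs_fps (\<lambda>m. Abs_fps (\<lambda>l. c (\<chi> i. if i = 1 then l else if i = 2 then m else n))))"

lemma coeff3_mk [simp]: "coeff3 (mk_fps3 c) M = c M"
proof -
  have "(\<chi> i. if i = 1 then M $ 1 else if i = 2 then M $ 2 else M $ 3) = M"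
    by (simp add: vec_eq_iff forall_3)
  then show ?thesis by (simp add: coeff3_def mk_fps3_def)
qed

lemma coeff3_zero [simp]: "coeff3 0 M = 0"
  and coeff3_add: "coeff3 (f + g) M = coeff3 f M + (coeff3 g M :: 'b::monoid_add)"
  and coeff3_uminus: "coeff3 (- h) M = - (coeff3 h M :: 'c::group_add)"
  and coeff3_diff: "coeff3 (h - h') M = coeff3 h M - (coeff3 h' M :: 'c::group_add)"
  by (simp_all add: coeff3_def)

lemma coeff3_sum: "coeff3 (sum f A) M = (\<Sum>a\<in>A. coeff3 (f a) M :: 'a::comm_monoid_add)"
  by (induction A rule: infinite_finite_induct) (simp_all add: coeff3_add)

lemma coeff3_const3_mult [simp]: "coeff3 (const3 c * f) M = c * (coeff3 f M :: 'a::comm_ring_1)"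
  by (simp add: coeff3_def const3_def)

lemma const3_0 [simp]: "const3 0 = 0" and const3_1 [simp]: "const3 1 = 1"
  and const3_add: "const3 (a + b) = const3 a + const3 (b::'a::comm_ring_1)"
  and const3_uminus: "const3 (- a) = - const3 (a::'a::comm_ring_1)"
  and const3_mult: "const3 (a * b) = const3 a * const3 (b::'a::comm_ring_1)"
  by (simp_all add: const3_def)

text \<open>Gradations only ask where coefficients can be nonzero, so this replaces the full Cauchy
  product in three variables.\<close>

lemma coeff3_mult_nonzero:
  fixes f g :: "'a::comm_ring_1 fps3"
  assumes "coeff3 (f * g) M \<noteq> 0"
  obtains K N where "M = K + N" "coeff3 f K \<noteq> 0" "coeff3 g N \<noteq> 0"
proof -
  let ?t = "\<lambda>n m l. fps_nth (fps_nth (fps_nth f n) m) l *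
    fps_nth (fps_nth (fps_nth g (M $ 3 - n)) (M $ 2 - m)) (M $ 1 - l)"
  have "coeff3 (f * g) M = (\<Sum>n=0..M $ 3. \<Sum>m=0..M $ 2. \<Sum>l=0..M $ 1. ?t n m l)"
    unfolding coeff3_def fps_mult_nth fps_sum_nth ..
  also have "\<dots> = 0" if "\<forall>n\<le>M $ 3. \<forall>m\<le>M $ 2. \<forall>l\<le>M $ 1. ?t n m l = 0"
    by (intro sum.neutral ballI) (use that in auto)
  finally have "\<not> (\<forall>n\<le>M $ 3. \<forall>m\<le>M $ 2. \<forall>l\<le>M $ 1. ?t n m l = 0)"
    using assms by blast
  then obtain n m l where nml: "n \<le> M $ 3" "m \<le> M $ 2" "l \<le> M $ 1" and t: "?t n m l \<noteq> 0"
    by blast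
  define K :: mon where "K = (\<chi> i. if i = 1 then l else if i = 2 then m else n)"
  define N :: mon where "N = (\<chi> i. if i = 1 then M $ 1 - l else if i = 2 then M $ 2 - m else M $ 3 - n)"
  have "M = K + N" using nml by (simp add: vec_eq_iff forall_3 K_def N_def)
  moreover have "coeff3 f K \<noteq> 0" "coeff3 g N \<noteq> 0"
    using t by (auto simp: coeff3_def K_def N_def)
  ultimately show thesis using that by blast
qed

lemma prod_UNIV_3: "prod f (UNIV :: 3 set) = f 1 * f 2 * f 3"
  unfolding UNIV_3 by (simp add: mult.assoc)

lemma coeff3_monom3: "coeff3 (monom3 M) N = (if N = M then 1 else (0::'a::comm_ring_1))"
proof -
  have *: "monom3 M = fps_const (fps_const (fps_X ^ (M $ 1))) * (fps_const (fps_X ^ (M $ 2)) * (fps_X ^ (M $ 3) :: 'a fps3))"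
    by (simp add: monom3_def prod_UNIV_3 var3_def mult_ac)
  show ?thesis
    unfolding * coeff3_def
    by (auto simp: fps_X_power_nth vec_eq_iff forall_3)
qed

section \<open>Partial derivatives of power series\<close>

definition derivation :: "('a::comm_ring_1 \<Rightarrow> 'a) \<Rightarrow> bool" where
  "derivation D \<longleftrightarrow> (\<forall>a b. D (a + b) = D a + D b) \<and> (\<forall>a b. D (a * b) = D a * b + a * D b)"

definition fps_map :: "('a \<Rightarrow> 'a) \<Rightarrow> 'a fps \<Rightarrow> 'a fps" where
  "fps_map D f = Abs_fps (\<lambda>n. D (fps_nth f n))"

text \<open>Since series in three variables are nested, the Leibniz rule for an inner variable is
  that of \<open>fps_deriv\<close> on coefficients, carried outwards one layer at a time by this
  lemma.\<close>

lemma derivation_fps_map: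
  assumes "derivation D"
  shows "derivation (fps_map D)"
proof -
  have add: "D (a + b) = D a + D b" and mul: "D (a * b) = D a * b + a * D b" for a b
    using assms by (auto simp: derivation_def)
  have z: "D 0 = 0" using add[of 0 0] by simp
  have sum: "D (sum h A) = (\<Sum>a\<in>A. D (h a))" for h :: "nat \<Rightarrow> 'a" and A
    by (induction A rule: infinite_finite_induct) (simp_all add: z add)
  have "fps_map D (f + g) = fps_map D f + fps_map D g" for f g
    by (rule fps_ext) (simp add: fps_map_def add)
  moreover have "fps_map D (f * g) = fps_map D f * g + f * fps_map D g" for f g
    by (rule fps_ext) (simp add: fps_map_def fps_mult_nth sum mul sum.distrib)
  ultimately show ?thesis unfolding derivation_def by blast
qed

lemma derivation_fps_deriv: "derivation (fps_deriv :: 'a::comm_ring_1 fps \<Rightarrow> 'a fps)"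
  by (simp add: derivation_def)

lemma derivation_pderiv3: "derivation (pderiv3 i :: 'a::comm_ring_1 fps3 \<Rightarrow> _)"
proof -
  have "pderiv3 i = (if i = 1 then fps_map (fps_map fps_deriv)
     else if i = 2 then fps_map fps_deriv else (fps_deriv :: 'a fps3 \<Rightarrow> _))"
    by (rule ext) (simp add: pderiv3_def fps_map_def)
  then show ?thesis
    by (simp add: derivation_fps_map derivation_fps_deriv)
qed

lemma pderiv3_add: "pderiv3 i (f + g) = pderiv3 i f + pderiv3 i g"
  and pderiv3_mult: "pderiv3 i (f * g) = pderiv3 i f * g + f * pderiv3 i g"
  using derivation_pderiv3[of i] by (auto simp: derivation_def)

lemma pderiv3_0 [simp]: "pderiv3 i 0 = 0"
  using pderiv3_add[of i 0 0] by simp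

lemma pderiv3_uminus: "pderiv3 i (- f) = - pderiv3 i f"
  using pderiv3_add[of i f "- f"] by (simp add: minus_unique)

lemma pderiv3_diff: "pderiv3 i (f - g) = pderiv3 i f - pderiv3 i g"
  using pderiv3_add[of i f "- g"] by (simp add: pderiv3_uminus)

lemma pderiv3_sum: "pderiv3 i (sum f A) = (\<Sum>a\<in>A. pderiv3 i (f a))"
  by (induction A rule: infinite_finite_induct) (simp_all add: pderiv3_add)

lemma pderiv3_const3 [simp]: "pderiv3 i (const3 c) = 0"
  by (rule coeff3_eqI) (simp add: coeff3_def pderiv3_def const3_def)

lemma coeff3_pderiv3:
  "coeff3 (pderiv3 i f) M = of_nat (M $ i + 1) * (coeff3 f (M + axis i 1) :: 'a::comm_ring_1)"
proof -
  have of_nat_mult_nth: "fps_nth (of_nat n * h) m = of_nat n * fps_nth h m" for n m and h :: "'b::comm_ring_1 fps"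
    by (simp add: fps_of_nat[symmetric])
  have "i = 1 \<or> i = 2 \<or> i = 3" using exhaust_3 by blast
  then show ?thesis
    by (elim disjE)
      (simp_all add: coeff3_def pderiv3_def axis_def of_nat_mult_nth del: of_nat_add of_nat_Suc)
qed

lemma pderiv3_commute: "pderiv3 i (pderiv3 j f) = pderiv3 j (pderiv3 i (f :: 'a::comm_ring_1 fps3))"
proof (cases "i = j")
  case False
  then show ?thesis
    by (intro coeff3_eqI) (simp add: coeff3_pderiv3 axis_def add_ac mult.left_commute)
qed simp

lemma pderiv3_const3_mult [simp]: "pderiv3 i (const3 c * f) = const3 c * pderiv3 i f"
  by (simp add: pderiv3_mult)

lemma const3_numeral [simp]: "const3 (numeral n) = (numeral n :: 'a::comm_ring_1 fps3)"
  by (simp add: const3_def numeral_fps_const)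

section \<open>The bracket of E(3,6)\<close>

text \<open>The twelve components of E(3,6) are indexed by the generators of RE(3,6), so that the
  two sides can be compared coordinate by coordinate.\<close>

fun e36_coord :: "'a e36 \<Rightarrow> gen \<Rightarrow> 'a fps3" where
  "e36_coord (X, c, w) (GA i) = X $ i"
| "e36_coord (X, c, w) (GB h k) = w $ h $ k"
| "e36_coord (X, c, w) (GC z) = c $ z"

definition e36_of :: "(gen \<Rightarrow> 'a fps3) \<Rightarrow> 'a e36" where
  "e36_of F = (\<chi> i. F (GA i), \<chi> z. F (GC z), \<chi> h k. F (GB h k))"

lemma coord_e36_of [simp]: "e36_coord (e36_of F) g = F g"
  by (cases g) (simp_all add: e36_of_def)

lemma e36_eqI: "(\<And>g. e36_coord x g = e36_coord y g) \<Longrightarrow> x = y"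
proof -
  assume *: "\<And>g. e36_coord x g = e36_coord y g"
  obtain X c w X' c' w' where "x = (X, c, w)" "y = (X', c', w')" by (metis prod_cases3)
  then show ?thesis using *[of "GA _"] *[of "GB _ _"] *[of "GC _"] by (simp add: vec_eq_iff)
qed

lemma coord_zero [simp]: "e36_coord 0 g = 0"
  by (cases g) (simp_all add: zero_prod_def)

lemma coord_add [simp]: "e36_coord (x + y) g = e36_coord x g + e36_coord y g"
  by (cases x; cases y; cases g) simp_all

lemma coord_uminus [simp]: "e36_coord (- x) g = - e36_coord (x :: 'a::comm_ring_1 e36) g"
  by (cases x; cases g) simp_all

lemma coord_diff [simp]: "e36_coord (x - y) g = e36_coord x g - e36_coord (y :: 'a::comm_ring_1 e36) g"
  by (cases x; cases y; cases g) simp_all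

lemma coord_sum: "e36_coord (sum f A) g = (\<Sum>a\<in>A. e36_coord (f a) g)"
  by (induction A rule: infinite_finite_induct) simp_all

lemma coord_smult [simp]: "e36_coord (e36_smult r x) g = const3 r * e36_coord x g"
  by (cases x; cases g) simp_all

definition e36_single :: "gen \<Rightarrow> 'a::zero fps3 \<Rightarrow> 'a e36" where
  "e36_single g f = e36_of (\<lambda>h. if h = g then f else 0)"

lemma coord_single: "e36_coord (e36_single g f) h = (if h = g then f else 0)"
  by (simp add: e36_single_def)

lemma e36_single_add: "e36_single g (f + f') = e36_single g f + e36_single g (f' :: 'a::comm_ring_1 fps3)"
  and e36_single_uminus: "e36_single g (- f) = - e36_single g f"
  and e36_single_zero [simp]: "e36_single g (0 :: 'a fps3) = 0"
  by (rule e36_eqI; simp add: coord_single)+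

text \<open>The sum is finite, so bilinearity alone reduces statements about brackets to single
  coordinates with arbitrary series; no convergence is involved.\<close>

lemma e36_expand: "x = (\<Sum>g\<in>UNIV. e36_single g (e36_coord x g))"
  by (rule e36_eqI) (simp add: coord_sum coord_single)

section \<open>Bilinearity and skew-symmetry of the bracket\<close>

lemma vf_apply_add: "vf_apply (X + Y) f = vf_apply X f + vf_apply Y f"
  and vf_apply_add_right: "vf_apply X (f + g) = vf_apply X f + vf_apply X g"
  by (simp_all add: vf_apply_def pderiv3_add algebra_simps sum.distrib)

lemma vf_apply_smult: "vf_apply (const3 c *s X) f = const3 c * vf_apply X f"
  and vf_apply_smult_right: "vf_apply X (const3 c * f) = const3 c * vf_apply X f"
  by (simp_all add: vf_apply_def sum_distrib_left mult.assoc mult.left_commute)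

text \<open>With 2-forms read as vector fields, the wedge product of 1-forms is the cross product;
  likewise \<open>ext_deriv1\<close> is the curl.\<close>

lemma wedge11_nth:
  "wedge11 a b $ 1 = a $ 2 * b $ 3 - a $ 3 * b $ 2"
  "wedge11 a b $ 2 = a $ 3 * b $ 1 - a $ 1 * b $ 3"
  "wedge11 a b $ 3 = a $ 1 * b $ 2 - a $ 2 * b $ 1"
  by (simp_all add: wedge11_def sum_3 third_def eps_def)

lemma ext_deriv1_nth:
  "ext_deriv1 a $ 1 = pderiv3 2 (a $ 3) - pderiv3 3 (a $ 2)"
  "ext_deriv1 a $ 2 = pderiv3 3 (a $ 1) - pderiv3 1 (a $ 3)"
  "ext_deriv1 a $ 3 = pderiv3 1 (a $ 2) - pderiv3 2 (a $ 1)"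
  by (simp_all add: ext_deriv1_def sum_3 third_def eps_def)

lemma e36_odd_vf_nth:
  "e36_odd_vf w w' $ t = wedge11 (odd_form w 1) (odd_form w' 2) $ t - wedge11 (odd_form w 2) (odd_form w' 1) $ t"
  by (simp add: e36_odd_vf_def sum_2 sl2_ext_def axis_def)

lemma UNIV_sl2: "(UNIV :: sl2_basis set) = {bE, bF, bH}"
  using sl2_basis.exhaust by blast

lemma e36_odd_sl2_nth:
  "e36_odd_sl2 w w' $ z = (\<Sum>k\<in>UNIV. \<Sum>l\<in>UNIV. const3 (1 / 2) *
          (wedge21 (ext_deriv1 (odd_form w k)) (odd_form w' l)
           + wedge21 (ext_deriv1 (odd_form w' l)) (odd_form w k)) * sl2_sym (axis k 1) (axis l 1) $ z)"
  by (simp add: e36_odd_sl2_def)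

lemma odd_form_add: "odd_form (w + w') k = odd_form w k + odd_form w' k"
  and odd_form_smult: "odd_form (\<chi> h. r *s v $ h) k = r *s odd_form v k"
  by (simp_all add: odd_form_def vec_eq_iff)

lemma wedge11_add: "wedge11 (a + a') b = wedge11 a b + wedge11 a' b"
  by (simp add: vec_eq_iff forall_3 wedge11_nth algebra_simps)

lemma wedge11_smult: "wedge11 (r *s a) b = r *s wedge11 a b"
  by (simp add: vec_eq_iff forall_3 wedge11_nth algebra_simps)

lemma ext_deriv1_add: "ext_deriv1 (a + b) = ext_deriv1 a + ext_deriv1 b"
  by (simp add: vec_eq_iff forall_3 ext_deriv1_nth pderiv3_add)

lemma ext_deriv1_smult: "ext_deriv1 (const3 r *s a) = const3 r *s ext_deriv1 a"
  by (simp add: vec_eq_iff forall_3 ext_deriv1_nth right_diff_distrib)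

lemma wedge21_add: "wedge21 (a + a') b = wedge21 a b + wedge21 a' b"
  and wedge21_add_right: "wedge21 a (b + b') = wedge21 a b + wedge21 a b'"
  and wedge21_smult: "wedge21 (r *s a) b = r * wedge21 a b"
  and wedge21_smult_right: "wedge21 a (r *s b) = r * wedge21 a b"
  by (simp_all add: wedge21_def algebra_simps sum.distrib sum_distrib_left)

lemma vf_bracket_add: "vf_bracket (X + X') Y = vf_bracket X Y + vf_bracket X' Y"
  and vf_bracket_skew: "vf_bracket X Y = - vf_bracket Y X"
  and vf_bracket_smult: "vf_bracket (const3 r *s X) Y = const3 r *s vf_bracket X Y"
  by (simp_all add: vf_bracket_def vec_eq_iff vf_apply_add vf_apply_add_right
      vf_apply_smult vf_apply_smult_right algebra_simps)

lemma sl2_bracket_add: "sl2_bracket (c + c') d = sl2_bracket c d + sl2_bracket c' d"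
  and sl2_bracket_skew: "sl2_bracket c d = - sl2_bracket d c"
  and sl2_bracket_smult: "sl2_bracket (r *s c) d = r *s sl2_bracket c d"
  by (simp_all add: sl2_bracket_def vec_eq_iff algebra_simps split: sl2_basis.splits)

lemma wedge11_skew: "wedge11 a b = - wedge11 b a"
  by (simp add: vec_eq_iff forall_3 wedge11_nth mult.commute)

lemma sl2_sym_commute: "sl2_sym u w = sl2_sym w u"
  by (simp add: sl2_sym_def vec_eq_iff add.commute mult.commute split: sl2_basis.splits)

text \<open>Two antisymmetric operations, the wedge of 1-forms and the exterior square, combine to a
  symmetric one. In \<open>e36_odd_sl2_commute\<close> both the form part and \<open>sl2_sym\<close>
  are symmetric.\<close>

lemma e36_odd_vf_commute: "e36_odd_vf w w' = e36_odd_vf w' w"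
  using wedge11_skew[of "odd_form w 1"] wedge11_skew[of "odd_form w 2"]
  by (simp add: vec_eq_iff e36_odd_vf_nth)

lemma e36_odd_sl2_commute: "e36_odd_sl2 w w' = e36_odd_sl2 w' w"
proof -
  have "e36_odd_sl2 w w' $ z = e36_odd_sl2 w' w $ z" for z
    unfolding e36_odd_sl2_nth
    by (subst sum.swap) (simp add: sl2_sym_commute add.commute)
  then show ?thesis by (simp add: vec_eq_iff)
qed

lemma e36_odd_add:
  "e36_odd_vf (w + w') v = e36_odd_vf w v + e36_odd_vf w' v"
  "e36_odd_sl2 (w + w') v = e36_odd_sl2 w v + e36_odd_sl2 w' v"
  by (simp_all add: vec_eq_iff e36_odd_vf_nth e36_odd_sl2_nth odd_form_add wedge11_add
      wedge21_add wedge21_add_right ext_deriv1_add algebra_simps sum.distrib)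

lemma e36_odd_smult:
  "e36_odd_vf (\<chi> h. const3 r *s w $ h) v = const3 r *s e36_odd_vf w v"
  "e36_odd_sl2 (\<chi> h. const3 r *s w $ h) v = const3 r *s e36_odd_sl2 w v"
  by (simp_all add: vec_eq_iff e36_odd_vf_nth e36_odd_sl2_nth odd_form_smult wedge11_smult
      wedge21_smult wedge21_smult_right ext_deriv1_smult algebra_simps sum_distrib_left)

lemma vf_div_add: "vf_div (X + Y) = vf_div X + vf_div Y"
  and vf_div_smult: "vf_div (const3 r *s X) = const3 r * vf_div X"
  by (simp_all add: vf_div_def pderiv3_add sum.distrib sum_distrib_left)

lemma lie_deriv1_add: "lie_deriv1 (X + Y) a = lie_deriv1 X a + lie_deriv1 Y a"
  and lie_deriv1_add_right: "lie_deriv1 X (a + b) = lie_deriv1 X a + lie_deriv1 X b"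
  and lie_deriv1_smult: "lie_deriv1 (const3 r *s X) a = const3 r *s lie_deriv1 X a"
  and lie_deriv1_smult_right: "lie_deriv1 X (const3 r *s a) = const3 r *s lie_deriv1 X a"
  by (simp_all add: lie_deriv1_def vec_eq_iff vf_apply_add vf_apply_add_right vf_apply_smult
      vf_apply_smult_right pderiv3_add ring_distribs sum.distrib sum_distrib_left mult.assoc mult.left_commute)

lemma sl2_act_add: "sl2_act (c + d) v = sl2_act c v + sl2_act d v"
  and sl2_act_add_right: "sl2_act c (v + w) = sl2_act c v + sl2_act c w"
  and sl2_act_smult: "sl2_act (r *s c) v = r *s sl2_act c v"
  and sl2_act_smult_right: "sl2_act c (r *s v) = r *s sl2_act c v"
  by (simp_all add: sl2_act_def vec_eq_iff algebra_simps)

lemma e36_even_on_odd_add: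
  "e36_even_on_odd (X + X') (c + c') w = e36_even_on_odd X c w + e36_even_on_odd X' c' w"
  "e36_even_on_odd X c (w + w') = e36_even_on_odd X c w + e36_even_on_odd X c w'"
  by (simp_all add: e36_even_on_odd_def vec_eq_iff lie_deriv1_add lie_deriv1_add_right odd_form_add
      vf_div_add sl2_act_add sl2_act_add_right algebra_simps)

lemma e36_even_on_odd_smult:
  "e36_even_on_odd (const3 r *s X) (const3 r *s c) w $ h = const3 r *s e36_even_on_odd X c w $ h"
  "e36_even_on_odd X c (\<chi> h. const3 r *s w $ h) $ h = const3 r *s e36_even_on_odd X c w $ h"
  by (simp_all add: e36_even_on_odd_def vec_eq_iff lie_deriv1_smult lie_deriv1_smult_right odd_form_smult
      vf_div_smult sl2_act_smult sl2_act_smult_right algebra_simps)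

lemma e36_bracket_add_left: "e36_bracket (x + y) z = e36_bracket x z + e36_bracket y z"
  by (cases x; cases y; cases z)
    (simp add: vf_bracket_add e36_odd_add sl2_bracket_add vf_apply_add vf_apply_add_right
      e36_even_on_odd_add vec_eq_iff)

lemma e36_bracket_smult_left: "e36_bracket (e36_smult r x) z = e36_smult r (e36_bracket x z)"
  by (cases x; cases z)
    (simp add: vf_bracket_smult e36_odd_smult sl2_bracket_smult vf_apply_smult vf_apply_smult_right
      e36_even_on_odd_smult vec_eq_iff right_diff_distrib distrib_left)

lemma e36_even_on_odd_zero [simp]: "e36_even_on_odd 0 0 w = 0" "e36_even_on_odd X c 0 = 0"
  using e36_even_on_odd_add(1)[of 0 0 0 0 w] e36_even_on_odd_add(2)[of X c 0 0] by simp_all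

lemma e36_odd_zero [simp]: "e36_odd_vf 0 v = 0" "e36_odd_sl2 0 v = 0" "e36_odd_vf v 0 = 0" "e36_odd_sl2 v 0 = 0"
  using e36_odd_add[of 0 0 v] by (simp_all add: e36_odd_vf_commute[of v] e36_odd_sl2_commute[of v])

lemma vf_apply_zero [simp]: "vf_apply 0 f = 0" "vf_apply X 0 = 0"
  by (simp_all add: vf_apply_def)

lemma vf_bracket_zero [simp]: "vf_bracket 0 Y = 0" "vf_bracket X 0 = 0"
  by (simp_all add: vf_bracket_def vec_eq_iff)

lemma sl2_bracket_zero [simp]: "sl2_bracket 0 d = 0" "sl2_bracket c 0 = 0"
  using sl2_bracket_add[of 0 0 d] sl2_bracket_add[of 0 0 c] sl2_bracket_skew[of c 0] by simp_all

lemma zero_vec_lambda [simp]: "(\<chi> i. 0) = 0"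
  by (simp add: vec_eq_iff)

text \<open>The only symmetric contribution to the bracket pairs two odd components, and it vanishes
  as soon as one of them is 0.\<close>

lemma e36_bracket_skew_even:
  "e36_bracket (X, c, 0) y = - e36_bracket y (X, c, 0)"
  by (cases y) (simp add: vf_bracket_skew[of X] sl2_bracket_skew[of c] vec_eq_iff)

lemma vf_bracket_add_right: "vf_bracket X (Y + Y') = vf_bracket X Y + vf_bracket X Y'"
  and vf_bracket_smult_right: "vf_bracket X (const3 r *s Y) = const3 r *s vf_bracket X Y"
  unfolding vf_bracket_skew[of X] vf_bracket_add vf_bracket_smult by (simp_all add: vec_eq_iff)

lemma sl2_bracket_add_right: "sl2_bracket c (d + d') = sl2_bracket c d + sl2_bracket c d'"
  and sl2_bracket_smult_right: "sl2_bracket c (r *s d) = r *s sl2_bracket c d"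
  unfolding sl2_bracket_skew[of c] sl2_bracket_add sl2_bracket_smult by (simp_all add: vec_eq_iff)

lemma e36_odd_add_right:
  "e36_odd_vf v (w + w') = e36_odd_vf v w + e36_odd_vf v w'"
  "e36_odd_sl2 v (w + w') = e36_odd_sl2 v w + e36_odd_sl2 v w'"
  by (simp_all add: e36_odd_vf_commute[of v] e36_odd_sl2_commute[of v] e36_odd_add)

lemma e36_odd_smult_right:
  "e36_odd_vf v (\<chi> h. const3 r *s w $ h) = const3 r *s e36_odd_vf v w"
  "e36_odd_sl2 v (\<chi> h. const3 r *s w $ h) = const3 r *s e36_odd_sl2 v w"
  by (simp_all add: e36_odd_vf_commute[of v] e36_odd_sl2_commute[of v] e36_odd_smult)

lemma e36_bracket_add_right: "e36_bracket z (x + y) = e36_bracket z x + e36_bracket z y"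
  by (cases x; cases y; cases z)
    (simp add: vf_bracket_add_right e36_odd_add_right sl2_bracket_add_right vf_apply_add vf_apply_add_right
      e36_even_on_odd_add vec_eq_iff)

lemma e36_bracket_smult_right: "e36_bracket z (e36_smult r x) = e36_smult r (e36_bracket z x)"
  by (cases x; cases z)
    (simp add: vf_bracket_smult_right e36_odd_smult_right sl2_bracket_smult_right vf_apply_smult
      vf_apply_smult_right e36_even_on_odd_smult vec_eq_iff right_diff_distrib distrib_left)

lemma e36_bracket_zero [simp]: "e36_bracket 0 y = 0" "e36_bracket y 0 = 0"
  using e36_bracket_add_left[of 0 0 y] e36_bracket_add_right[of y 0 0] by simp_all

lemma e36_bracket_uminus: "e36_bracket (- x) y = - e36_bracket x y" "e36_bracket y (- x) = - e36_bracket y x"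
  using e36_bracket_add_left[of x "- x" y] e36_bracket_add_right[of y x "- x"]
  by (simp_all add: minus_unique)

lemma e36_bracket_diff:
  "e36_bracket (x - x') y = e36_bracket x y - e36_bracket x' y"
  "e36_bracket y (x - x') = e36_bracket y x - e36_bracket y x'"
  using e36_bracket_add_left[of x "- x'" y] e36_bracket_add_right[of y x "- x'"]
  by (simp_all add: e36_bracket_uminus)

lemma e36_bracket_sum:
  "e36_bracket (sum f A) y = (\<Sum>a\<in>A. e36_bracket (f a) y)"
  "e36_bracket y (sum f A) = (\<Sum>a\<in>A. e36_bracket y (f a))"
  by (induction A rule: infinite_finite_induct) (simp_all add: e36_bracket_add_left e36_bracket_add_right)

lemma e36_single_GA: "e36_single (GA i) f = (axis i f, 0, 0)"
  and e36_single_GB: "e36_single (GB h k) f = (0, 0, axis h (axis k f))"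
  and e36_single_GC: "e36_single (GC z) f = (0, axis z f, 0)"
  by (rule e36_eqI; case_tac g; simp add: coord_single axis_def)+

section \<open>Brackets of elements with a single nonzero coordinate\<close>

lemma vf_apply_axis: "vf_apply (axis i f) g = f * pderiv3 i g"
  by (simp add: vf_apply_def axis_def if_distrib[of "\<lambda>x. x * _"] cong: if_cong)

lemma bracket_single_AA: "e36_bracket (e36_single (GA i) f) (e36_single (GA j) g) =
    e36_single (GA j) (f * pderiv3 i g) - e36_single (GA i) (g * pderiv3 j f)"
  by (simp add: e36_single_GA vf_bracket_def vf_apply_axis)
   (auto simp: axis_def vec_eq_iff zero_prod_def)

lemma bracket_single_AC: "e36_bracket (e36_single (GA i) f) (e36_single (GC z) g) =
    e36_single (GC z) (f * pderiv3 i g)"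
  by (simp add: e36_single_GA e36_single_GC vf_apply_axis)
   (auto simp: axis_def vec_eq_iff)

lemma bracket_single_CC: "e36_bracket (e36_single (GC z) f) (e36_single (GC z') g) =
    (\<Sum>u\<in>UNIV. e36_single (GC u) (const3 (sl2_bracket (axis z 1) (axis z' 1) $ u) * f * g))"
  by (rule e36_eqI, case_tac ga; cases z; cases z')
    (simp_all add: e36_single_GC coord_sum coord_single sl2_bracket_def axis_def const3_uminus mult_ac split: sl2_basis.splits)

lemma bracket_single_CB: "e36_bracket (e36_single (GC z) f) (e36_single (GB h k) g) =
    (\<Sum>l\<in>UNIV. e36_single (GB h l) (const3 (sl2_act (axis z 1) (axis k 1) $ l) * f * g))"
  apply (rule e36_eqI, case_tac ga; cases z)
  using exhaust_2[of k]
  by (auto simp: e36_single_GC e36_single_GB coord_sum coord_single e36_even_on_odd_def sl2_act_def axis_def lie_deriv1_def odd_form_def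
     vf_div_def const3_uminus mult_ac)

lemma bracket_single_AB: "e36_bracket (e36_single (GA i) f) (e36_single (GB h k) g) =
    e36_single (GB h k) (f * pderiv3 i g - const3 (1 / 2) * pderiv3 i f * g)
    + (if i = h then \<Sum>j\<in>UNIV. e36_single (GB j k) (g * pderiv3 j f) else 0)"
proof -
  \<comment> \<open>The Lie derivative of g dx_h along X is X(g) dx_h + g d(X_h); for X = f
    \<partial>_i the second term is g df if i = h and 0 otherwise.\<close>
  have *: "lie_deriv1 (axis i f) (odd_form (axis h (axis k g)) l) $ h' =
     (if l = k then (if h' = h then f * pderiv3 i g else 0) + (if i = h then g * pderiv3 h' f else 0) else 0)" for l h'
    unfolding lie_deriv1_def vec_lambda_beta vf_apply_axis odd_form_def
    using exhaust_3[of h] exhaust_3[of i] exhaust_3[of h']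
    by (cases "l = k"; elim disjE) (simp_all add: axis_def sum_3)
  have **: "vf_div (axis i f) = pderiv3 i f"
    by (simp add: vf_div_def axis_def if_distrib[of "pderiv3 _"] cong: if_cong)
  have "e36_bracket (e36_single (GA i) f) (e36_single (GB h k) g) = (0, 0, e36_even_on_odd (axis i f) 0 (axis h (axis k g)))"
    by (simp add: e36_single_GA e36_single_GB)
  moreover have "sl2_act 0 v = 0" for v :: "'a fps3 ^ 2" by (simp add: sl2_act_def vec_eq_iff)
  ultimately show ?thesis
    by (intro e36_eqI, case_tac ga)
      (simp_all add: coord_single coord_sum e36_even_on_odd_def * **, auto simp: axis_def)
qed

lemma third_simps [simp]:
  "third 1 2 = 3" "third 2 1 = 3" "third 1 3 = 2" "third 3 1 = 2" "third 2 3 = 1" "third 3 2 = 1"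
  by (simp_all add: third_def)

lemma eps_simps [simp]:
  "eps 1 2 = 1" "eps 2 1 = - 1" "eps 1 3 = - 1" "eps 3 1 = 1" "eps 2 3 = 1" "eps 3 2 = - 1" "eps i i = 0"
  by (simp_all add: eps_def)

text \<open>Only the derivative in the third direction survives: d(f dx_h) wedge g dx_i is
  \<open>eps h i\<close> times (\<partial>_t f) g. In d(g dx_i) wedge f dx_h the indices are
  exchanged, which flips the sign and produces the difference. The factor
  \<open>label2 l - label2 k\<close> is the value of e_k wedge e_l.\<close>

lemma bracket_single_BB: "e36_bracket (e36_single (GB h k) f) (e36_single (GB i l) g) =
    e36_single (GA (third h i)) (const3 (of_int (label2 l - label2 k) * eps h i) * (f * g))
    + (\<Sum>z\<in>UNIV. e36_single (GC z) (const3 (eps h i) * const3 (1 / 2) * const3 (sl2_sym (axis k 1) (axis l 1) $ z) *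
         (pderiv3 (third h i) f * g - f * pderiv3 (third h i) g)))"
proof -
  have 1: "e36_odd_vf (axis h (axis k f)) (axis i (axis l g)) $ t =
     (if t = third h i then const3 (of_int (label2 l - label2 k) * eps h i) * (f * g) else 0)" for t
    using exhaust_3[of h] exhaust_3[of i] exhaust_3[of t] exhaust_2[of k] exhaust_2[of l]
    by (elim disjE)
     (simp_all add: e36_odd_vf_nth wedge11_nth odd_form_def axis_def third_def eps_def label2_def const3_uminus)
  have s: "ext_deriv1 (odd_form (axis h (axis k f)) k') = (if k' = k then ext_deriv1 (axis h f) else 0)" for h k f k'
    by (auto simp: odd_form_def vec_eq_iff axis_def forall_3 ext_deriv1_nth)
  have s': "odd_form (axis h (axis k f)) k' = (if k' = k then axis h f else 0)" for h k f k'
    by (auto simp: odd_form_def vec_eq_iff axis_def)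
  have 0: "wedge21 0 a = 0" "wedge21 a 0 = 0" "ext_deriv1 0 = 0" for a
    by (simp_all add: wedge21_def vec_eq_iff forall_3 ext_deriv1_nth)
  have 2: "e36_odd_sl2 (axis h (axis k f)) (axis i (axis l g)) $ z = const3 (1 / 2) *
     (wedge21 (ext_deriv1 (axis h f)) (axis i g) + wedge21 (ext_deriv1 (axis i g)) (axis h f)) * sl2_sym (axis k 1) (axis l 1) $ z" for z
    unfolding e36_odd_sl2_nth s s'
    using exhaust_2[of k] exhaust_2[of l]
    by (elim disjE) (simp_all add: sum_2 0)
  have 3: "wedge21 (ext_deriv1 (axis h f)) (axis i g) + wedge21 (ext_deriv1 (axis i g)) (axis h f)
     = eps h i * (pderiv3 (third h i) f * g - f * pderiv3 (third h i) g)"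
    using exhaust_3[of h] exhaust_3[of i]
    by (elim disjE) (simp_all add: wedge21_def sum_3 ext_deriv1_nth axis_def algebra_simps)
  have 4: "const3 (eps h i :: 'a) = eps h i" by (simp add: eps_def const3_uminus)
  have 5: "const3 (sl2_sym (axis k (1 :: 'a)) (axis l 1) $ z) = sl2_sym (axis k 1) (axis l 1) $ z" for z
    using exhaust_2[of k] exhaust_2[of l] by (elim disjE; cases z) (simp_all add: sl2_sym_def axis_def const3_uminus)
  show ?thesis
    unfolding e36_single_GB e36_bracket.simps
    by (rule e36_eqI, case_tac ga) (simp_all add: coord_single coord_sum 1 2 3 const3_mult 4 5 mult_ac)
qed

section \<open>The Jacobi identity for E(3,6)\<close>

lemma sum_sl2: "sum f (UNIV :: sl2_basis set) = f bE + f bF + f bH"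
  unfolding UNIV_sl2 by (simp add: add.assoc)

lemma single_skew_CA: "e36_bracket (e36_single (GC z) f) (e36_single (GA i) g) = - e36_bracket (e36_single (GA i) g) (e36_single (GC z) f)"
  and single_skew_BA: "e36_bracket (e36_single (GB h k) f) (e36_single (GA i) g) = - e36_bracket (e36_single (GA i) g) (e36_single (GB h k) f)"
  and single_skew_BC: "e36_bracket (e36_single (GB h k) f) (e36_single (GC z) g) = - e36_bracket (e36_single (GC z) g) (e36_single (GB h k) f)"
  using e36_bracket_skew_even[of "axis i g" 0] e36_bracket_skew_even[of 0 "axis z g"]
  by (simp_all add: e36_single_GA e36_single_GC del: e36_bracket.simps)

lemma half_const3:
  "2 * const3 (1 / 2) = (1 :: 'a::field_char_0 fps3)"
  "2 * (const3 (1 / 2) * x) = (x :: 'a::field_char_0 fps3)"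
  "2 * (x * const3 (1 / 2)) = (x :: 'a::field_char_0 fps3)"
  "2 * (x * (const3 (1 / 2) * y)) = x * (y :: 'a::field_char_0 fps3)"
proof -
  have "const3 (2 * (1 / 2)) = const3 2 * (const3 (1 / 2) :: 'a fps3)" by (rule const3_mult)
  then show *: "2 * const3 (1 / 2) = (1 :: 'a fps3)" by simp
  show "2 * (const3 (1 / 2) * x) = x" "2 * (x * const3 (1 / 2)) = x"
    "2 * (x * (const3 (1 / 2) * y)) = x * y"
    using * by (metis mult.assoc mult.left_commute mult_1 mult.right_neutral)+
qed

text \<open>
  Ring normalisation sorts a factor \<open>a\<close> with \<open>2 a = 1\<close> to the front of a monomial, but leaves the
  numeral 2 at an arbitrary place.
\<close>

lemma half_cancel:
  fixes a :: "'b::comm_ring_1"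
  assumes "2 * a = 1"
  shows "2 * (a * x) = x" "a * (2 * x) = x"
    "a * (x * 2) = x" "a * (x * (2 * y)) = x * y"
    "a * (x * (y * 2)) = x * y" "a * (x * (y * (2 * v))) = x * (y * v)"
    "a * (x * (y * (v * 2))) = x * (y * v)" "a * (x * (y * (v * (2 * w)))) = x * (y * (v * w))"
    "a * (x * (y * (v * (w * 2)))) = x * (y * (v * w))" "a * (x * (y * (v * (w * (2 * t))))) = x * (y * (v * (w * t)))"
proof -
  have *: "a * (2 * x) = x" for x
    using assms by (metis mult.assoc mult.commute mult_1)
  show "2 * (a * x) = x" "a * (2 * x) = x"
    using *[of x] by (simp_all add: mult.left_commute)
  show "a * (x * 2) = x" "a * (x * (2 * y)) = x * y"
    "a * (x * (y * 2)) = x * y" "a * (x * (y * (2 * v))) = x * (y * v)"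
    "a * (x * (y * (v * 2))) = x * (y * v)" "a * (x * (y * (v * (2 * w)))) = x * (y * (v * w))"
    "a * (x * (y * (v * (w * 2)))) = x * (y * (v * w))" "a * (x * (y * (v * (w * (2 * t))))) = x * (y * (v * (w * t)))"
    using *[of x] *[of "x * y"] *[of "x * (y * v)"] *[of "x * (y * (v * w))"] *[of "x * (y * (v * (w * t)))"]
    by (simp_all only: mult.left_commute[of _ 2] mult.commute[of _ 2])
qed

text \<open>Here -2 = 1 modulo 3. This value is harmless, because \<open>third i i\<close> only
  occurs together with the factor \<open>eps i i = 0\<close>.\<close>

lemma third_same [simp]: "third i i = i"
  using exhaust_3[of i] by (elim disjE; simp add: third_def)

lemma const3_diff: "const3 (a - b) = const3 a - const3 (b::'a::comm_ring_1)"
  using const3_add[of a "- b"] by (simp add: const3_uminus)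

lemma label2_simps [simp]: "label2 1 = 1" "label2 2 = 2"
  by (simp_all add: label2_def)

lemma sl2_concrete:
  "sl2_bracket (axis z 1) (axis z' 1) $ bE =
    2 * ((if z = bH \<and> z' = bE then 1 else 0) - (if z = bE \<and> z' = bH then 1 else 0) :: 'b::comm_ring_1)"
  "sl2_bracket (axis z 1) (axis z' 1) $ bF =
    2 * ((if z = bF \<and> z' = bH then 1 else 0) - (if z = bH \<and> z' = bF then 1 else 0) :: 'b)"
  "sl2_bracket (axis z 1) (axis z' 1) $ bH =
    ((if z = bE \<and> z' = bF then 1 else 0) - (if z = bF \<and> z' = bE then 1 else 0) :: 'b)"
  "sl2_act (axis z 1) (axis k 1) $ 1 = ((if z = bH \<and> k = 1 then 1 else 0) + (if z = bE \<and> k = 2 then 1 else 0) :: 'b)"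
  "sl2_act (axis z 1) (axis k 1) $ 2 = ((if z = bF \<and> k = 1 then 1 else 0) - (if z = bH \<and> k = 2 then 1 else 0) :: 'b)"
  "sl2_sym (axis k 1) (axis l 1) $ bE = (if k = 1 \<and> l = 1 then 2 else 0 :: 'b)"
  "sl2_sym (axis k 1) (axis l 1) $ bF = (if k = 2 \<and> l = 2 then - 2 else 0 :: 'b)"
  "sl2_sym (axis k 1) (axis l 1) $ bH = (if k \<noteq> l then - 1 else 0 :: 'b)"
  using exhaust_2[of k] exhaust_2[of l]
  by (auto simp: sl2_bracket_def sl2_act_def sl2_sym_def axis_def)

lemmas single_bracket = bracket_single_AA bracket_single_AC bracket_single_AB bracket_single_CC
  bracket_single_CB bracket_single_BB single_skew_CA single_skew_BA single_skew_BC

lemmas e36_bracket_linear = e36_bracket_add_left e36_bracket_add_right e36_bracket_uminus e36_bracket_diff e36_bracket_sum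

lemma if_bracket:
  "e36_bracket (if P then x else y) z = (if P then e36_bracket x z else e36_bracket y z)"
  "e36_bracket z (if P then x else y) = (if P then e36_bracket z x else e36_bracket z y)"
  by simp_all

lemmas pderiv3_simps = pderiv3_add pderiv3_uminus pderiv3_diff pderiv3_mult

lemma pderiv3_order:
  "pderiv3 2 (pderiv3 1 f) = pderiv3 1 (pderiv3 2 (f :: 'a::comm_ring_1 fps3))"
  "pderiv3 3 (pderiv3 1 f) = pderiv3 1 (pderiv3 3 f)"
  "pderiv3 3 (pderiv3 2 f) = pderiv3 2 (pderiv3 3 f)"
  by (rule pderiv3_commute)+

text \<open>The parities are separate arguments: 0 is homogeneous of both parities, so they cannot
  be read off from \<open>x\<close> and \<open>y\<close>.\<close>

definition e36_jac :: "2 \<Rightarrow> 2 \<Rightarrow> 'a::field_char_0 e36 \<Rightarrow> 'a e36 \<Rightarrow> 'a e36 \<Rightarrow> bool" where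
  "e36_jac p q x y z \<longleftrightarrow> e36_bracket x (e36_bracket y z) = e36_bracket (e36_bracket x y) z +
     (if p = 1 \<and> q = 1 then - e36_bracket y (e36_bracket x z) else e36_bracket y (e36_bracket x z))"

lemma e36_jac_0: "e36_jac 0 q x y z \<longleftrightarrow>
    e36_bracket x (e36_bracket y z) = e36_bracket (e36_bracket x y) z + e36_bracket y (e36_bracket x z)"
  and e36_jac_1: "e36_jac 1 1 x y z \<longleftrightarrow>
    e36_bracket x (e36_bracket y z) = e36_bracket (e36_bracket x y) z - e36_bracket y (e36_bracket x z)"
  by (simp_all add: e36_jac_def)

text \<open>
  The Jacobi identity is checked on elements with a single nonzero coordinate, where it becomes an
  identity between differential monomials in three arbitrary power series.
\<close>

lemmas jac_simps = coord_single coord_sum sum_sl2 sum_2 sum_3 sl2_concrete const3_uminus pderiv3_simps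

lemma jac_AAA:
  "e36_jac 0 0 (e36_single (GA i) f) (e36_single (GA j) g) (e36_single (GA h) u)"
  unfolding e36_jac_0 single_bracket e36_bracket_linear
  by (rule e36_eqI)
    (simp add: coord_single pderiv3_simps algebra_simps
      pderiv3_commute[of _ _ f] pderiv3_commute[of _ _ g] pderiv3_commute[of _ _ u])

lemma jac_AAC:
  "e36_jac 0 0 (e36_single (GA i) f) (e36_single (GA j) g) (e36_single (GC z) u)"
  unfolding e36_jac_0 single_bracket e36_bracket_linear
  by (rule e36_eqI) (simp add: coord_single pderiv3_simps algebra_simps pderiv3_commute[of _ _ u])

lemma jac_ACC:
  "e36_jac 0 0 (e36_single (GA i) f) (e36_single (GC y) g) (e36_single (GC z) u)"
  unfolding e36_jac_0 single_bracket e36_bracket_linear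
  by (rule e36_eqI, case_tac ga) (simp_all add: coord_single coord_sum pderiv3_simps algebra_simps)

lemma jac_CCC:
  "e36_jac 0 0 (e36_single (GC x) f) (e36_single (GC y) g) (e36_single (GC z) u)"
  unfolding e36_jac_0 single_bracket e36_bracket_linear
  by (rule e36_eqI; cases x; cases y; cases z; simp add: jac_simps algebra_simps)

lemma jac_CCB:
  "e36_jac 0 0 (e36_single (GC y) f) (e36_single (GC z) g) (e36_single (GB h k) u)"
  unfolding e36_jac_0 single_bracket e36_bracket_linear
  using exhaust_2[of k]
  by (intro e36_eqI; elim disjE; cases y; cases z; simp add: jac_simps algebra_simps)

lemma jac_ACB:
  "e36_jac 0 0 (e36_single (GA i) f) (e36_single (GC z) g) (e36_single (GB h k) u)"
  unfolding e36_jac_0 single_bracket e36_bracket_linear if_bracket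
  using exhaust_3[of i] exhaust_3[of h] exhaust_2[of k]
  apply (intro e36_eqI, simp add: coord_single coord_sum)
  apply (elim disjE; cases z; simp add: jac_simps algebra_simps)
  done

lemma jac_AAB:
  "e36_jac 0 0 (e36_single (GA i) f) (e36_single (GA j) g) (e36_single (GB h k) u)"
  unfolding e36_jac_0 single_bracket e36_bracket_linear if_bracket
  apply (rule e36_eqI)
  apply (simp add: coord_single coord_sum)
  using exhaust_3[of i] exhaust_3[of j] exhaust_3[of h]
  apply (elim disjE; simp add: sum_3 coord_single pderiv3_simps algebra_simps half_const3 pderiv3_order)
  done

lemma jac_CBB:
  "e36_jac 0 1 (e36_single (GC z) f) (e36_single (GB i j) g) (e36_single (GB h k) u)"
  unfolding e36_jac_0 single_bracket e36_bracket_linear if_bracket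
  apply (rule e36_eqI)
  apply (simp add: coord_single coord_sum)
  using exhaust_3[of i] exhaust_3[of h] exhaust_2[of j] exhaust_2[of k]
  apply (elim disjE; cases z; simp add: jac_simps algebra_simps half_const3 pderiv3_order)
  done

lemma jac_ABB:
  "e36_jac 0 1 (e36_single (GA z) f) (e36_single (GB i j) g) (e36_single (GB h k) u)"
proof -
  \<comment> \<open>With an opaque symbol for 1/2, subject only to 2 a = 1, ring normalisation does
    not evaluate the constant, and \<open>half_cancel\<close> applies.\<close>
  obtain a :: "'a fps3" where a: "const3 (1 / 2) = a" by blast
  note half = half_cancel[OF half_const3(1)[where 'a = 'a, unfolded a]] half_const3(1)[where 'a = 'a, unfolded a]
  show ?thesis
    unfolding e36_jac_0 single_bracket e36_bracket_linear if_bracket a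
    apply (rule e36_eqI)
    using exhaust_3[of i] exhaust_3[of h] exhaust_3[of z]
    \<comment> \<open>Differentiation must see that 1/2 is a constant, so \<open>a\<close> is
      expanded for this step and folded again afterwards.\<close>
    apply (elim disjE; case_tac ga; simp add: coord_single coord_sum sum_3 const3_uminus const3_mult
        const3_diff pderiv3_simps a[symmetric])
    unfolding a
    apply (simp_all add: algebra_simps half pderiv3_order)
    done
qed

lemma jac_BBB:
  "e36_jac 1 1 (e36_single (GB z l) f) (e36_single (GB i j) g) (e36_single (GB h k) u)"
proof -
  obtain a :: "'a fps3" where a: "const3 (1 / 2) = a" by blast
  note half = half_cancel[OF half_const3(1)[where 'a = 'a, unfolded a]] half_const3(1)[where 'a = 'a, unfolded a]
  note cases3 = exhaust_3[of z] exhaust_3[of i] exhaust_3[of h]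
  show ?thesis
    unfolding e36_jac_1 single_bracket e36_bracket_linear if_bracket
    apply (rule e36_eqI)
    subgoal for ga
      \<comment> \<open>Fixing the labels of e_1 and e_2 first decides all values of
        \<open>sl2_act\<close> and \<open>sl2_sym\<close>; what remains in each of the eight cases
        ranges over the indices of the 1-forms.\<close>
      using exhaust_2[of l] exhaust_2[of j] exhaust_2[of k]
      apply (elim disjE)
      subgoal using cases3
        by (elim disjE; cases ga; (simp add: jac_simps)?; (simp add: a algebra_simps half pderiv3_order)?)
      subgoal using cases3
        by (elim disjE; cases ga; (simp add: jac_simps)?; (simp add: a algebra_simps half pderiv3_order)?)
      subgoal using cases3
        by (elim disjE; cases ga; (simp add: jac_simps)?; (simp add: a algebra_simps half pderiv3_order)?)
      subgoal using cases3
        by (elim disjE; cases ga; (simp add: jac_simps)?; (simp add: a algebra_simps half pderiv3_order)?)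
      subgoal using cases3
        by (elim disjE; cases ga; (simp add: jac_simps)?; (simp add: a algebra_simps half pderiv3_order)?)
      subgoal using cases3
        by (elim disjE; cases ga; (simp add: jac_simps)?; (simp add: a algebra_simps half pderiv3_order)?)
      subgoal using cases3
        by (elim disjE; cases ga; (simp add: jac_simps)?; (simp add: a algebra_simps half pderiv3_order)?)
      subgoal using cases3
        by (elim disjE; cases ga; (simp add: jac_simps)?; (simp add: a algebra_simps half pderiv3_order)?)
      done
    done
qed

section \<open>Parity, and the Jacobi identity for arbitrary homogeneous elements\<close>

definition e36_parity :: "2 \<Rightarrow> 'a::field_char_0 e36 set" where
  "e36_parity p = (if p = 0 then {(X, c, w). w = 0} else {(X, c, w). X = 0 \<and> c = 0})"

lemma two_cases: "(p::2) = 0 \<or> p = 1"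
  using exhaust_2[of p] by auto

lemma e36_parity_iff: "x \<in> e36_parity p \<longleftrightarrow> (\<forall>g. e36_coord x g \<noteq> 0 \<longrightarrow> gen_parity g = p)"
proof -
  obtain X c w where x: "x = (X, c, w)" by (metis prod_cases3)
  have all: "(\<forall>g. P g) \<longleftrightarrow> (\<forall>i. P (GA i)) \<and> (\<forall>h k. P (GB h k)) \<and> (\<forall>z. P (GC z))" for P
    using gen.exhaust by metis
  show ?thesis using two_cases[of p] by (auto simp: x e36_parity_def all vec_eq_iff)
qed

lemma single_parity: "e36_single g f \<in> e36_parity (gen_parity g)"
  by (simp add: e36_parity_iff coord_single)

lemma e36_parity_bracket:
  assumes "x \<in> e36_parity p" "y \<in> e36_parity q"
  shows "e36_bracket x y \<in> e36_parity (p + q)"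
proof -
  have z: "lie_deriv1 0 a = 0" "vf_div 0 = 0" "sl2_act 0 v = 0" for a :: "'a fps3 ^ 3" and v :: "'a fps3 ^ 2"
    by (simp_all add: lie_deriv1_def vf_div_def sl2_act_def vec_eq_iff)
  have 0: "\<exists>X c. x = (X, c, 0)" if "x \<in> e36_parity 0" for x :: "'a e36"
    using that by (auto simp: e36_parity_def)
  have 1: "\<exists>w. x = (0, 0, w)" if "x \<in> e36_parity 1" for x :: "'a e36"
    using that by (auto simp: e36_parity_def)
  show ?thesis
    using two_cases[of p] two_cases[of q] assms
    by (elim disjE) (auto simp: e36_parity_def z dest!: 0 1)
qed

lemma e36_parity_skew:
  assumes "x \<in> e36_parity p" "y \<in> e36_parity q"
  shows "e36_bracket y x = (if p = 1 \<and> q = 1 then e36_bracket x y else - e36_bracket x y)"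
proof (cases "p = 1 \<and> q = 1")
  case True
  then show ?thesis using assms by (auto simp: e36_parity_def intro: e36_odd_vf_commute e36_odd_sl2_commute)
next
  case False
  then have "p = 0 \<or> q = 0" using two_cases by blast
  then show ?thesis
  proof
    assume "p = 0"
    then obtain X c where x: "x = (X, c, 0)" using assms by (auto simp: e36_parity_def)
    have "e36_bracket x y = - e36_bracket y x" unfolding x by (rule e36_bracket_skew_even)
    with False show ?thesis by auto
  next
    assume "q = 0"
    then obtain X c where y: "y = (X, c, 0)" using assms by (auto simp: e36_parity_def)
    have "e36_bracket y x = - e36_bracket x y" unfolding y by (rule e36_bracket_skew_even)
    with False show ?thesis by auto
  qed
qed

text \<open>Adjacent transpositions generate all permutations of three arguments, so with
  \<open>e36_jac_swap23\<close> the identity need only be checked in one order.\<close>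

lemma e36_jac_swap12:
  assumes "x \<in> e36_parity p" "y \<in> e36_parity q" "e36_jac p q x y z"
  shows "e36_jac q p y x z"
  using assms(3) e36_parity_skew[OF assms(1,2)]
  by (auto simp: e36_jac_def e36_bracket_uminus)

text \<open>Skew-symmetry is applied not only to \<open>y\<close> and \<open>z\<close> but also to
  the outer brackets of [x,y] with \<open>z\<close> and of [x,z] with \<open>y\<close>, whose
  parities are sums.\<close>

lemma e36_jac_swap23:
  assumes "x \<in> e36_parity p" "y \<in> e36_parity q" "z \<in> e36_parity r" "e36_jac p q x y z"
  shows "e36_jac p r x z y"
  using assms(4) e36_parity_skew[OF assms(2,3)]
    e36_parity_skew[OF e36_parity_bracket[OF assms(1,2)] assms(3)]
    e36_parity_skew[OF e36_parity_bracket[OF assms(1,3)] assms(2)]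
    two_cases[of p] two_cases[of q] two_cases[of r]
  by (elim disjE) (simp_all add: e36_jac_def e36_bracket_uminus)

lemma e36_jac_single:
  "e36_jac (gen_parity a) (gen_parity b) (e36_single a f) (e36_single b g) (e36_single c h)"
proof -
  define sj where "sj a b c \<longleftrightarrow> (\<forall>f g h. e36_jac (gen_parity a) (gen_parity b)
    (e36_single a f) (e36_single b g) (e36_single c h :: 'a e36))" for a b c
  have s12: "sj a b c \<Longrightarrow> sj b a c" for a b c
    unfolding sj_def using e36_jac_swap12[OF single_parity single_parity] by blast
  have s23: "sj a b c \<Longrightarrow> sj a c b" for a b c
    unfolding sj_def using e36_jac_swap23[OF single_parity single_parity single_parity] by blast
  note base = jac_AAA jac_AAC jac_ACC jac_CCC jac_AAB jac_ACB jac_CCB jac_ABB jac_CBB jac_BBB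
  have 1: "sj (GA i) (GA j) (GA k)" "sj (GA i) (GA j) (GC y)" "sj (GA i) (GC x) (GC y)" "sj (GC x) (GC y) (GC z)"
    "sj (GA i) (GA j) (GB k l)" "sj (GA i) (GC x) (GB k l)" "sj (GC x) (GC y) (GB k l)"
    "sj (GA i) (GB j m) (GB k l)" "sj (GC x) (GB j m) (GB k l)" "sj (GB i n) (GB j m) (GB k l)"
    for i j k x y z l m n
    by (simp_all only: sj_def gen_parity.simps) (intro allI base)+
  \<comment> \<open>Together with \<open>s12\<close>, \<open>s23\<close> and the identity these are
    all six orders. Every triple of generators is a rearrangement of one sorted as A, C, B, and the
    sorted ones are in \<open>1\<close>.\<close>
  have s: "sj a b c \<Longrightarrow> sj b c a" "sj a b c \<Longrightarrow> sj c a b" "sj a b c \<Longrightarrow> sj c b a" for a b c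
    by (blast intro: s12 s23)+
  have "sj a b c"
    by (cases a; cases b; cases c; hypsubst; (rule 1 | rule s12, rule 1 | rule s23, rule 1
      | rule s(1), rule 1 | rule s(2), rule 1 | rule s(3), rule 1))
  then show ?thesis by (simp add: sj_def)
qed

lemma e36_jacobi:
  assumes "x \<in> e36_parity p" "y \<in> e36_parity q"
  shows "e36_jac p q x y z"
proof -
  \<comment> \<open>A coordinate of the wrong parity vanishes by homogeneity, and then the identity
    is trivial; the third argument may have any parity.\<close>
  have 1: "e36_jac p q (e36_single a (e36_coord x a)) (e36_single b (e36_coord y b)) (e36_single c h)" for a b c h
  proof (cases "e36_coord x a = 0 \<or> e36_coord y b = 0")
    case True then show ?thesis by (auto simp: e36_jac_def)
  next
    case False
    then have "gen_parity a = p" "gen_parity b = q" using assms by (auto simp: e36_parity_iff)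
    then show ?thesis using e36_jac_single by blast
  qed
  have s: "e36_jac p q (sum F A) y z" if "\<And>a. e36_jac p q (F a) y z" for F :: "gen \<Rightarrow> _" and A y z
    using that by (cases "p = 1 \<and> q = 1") (auto simp: e36_jac_def e36_bracket_sum sum.distrib sum_subtractf)
  have s': "e36_jac p q y (sum F A) z" if "\<And>a. e36_jac p q y (F a) z" for F :: "gen \<Rightarrow> _" and A y z
    using that by (cases "p = 1 \<and> q = 1") (auto simp: e36_jac_def e36_bracket_sum sum.distrib sum_subtractf)
  have s'': "e36_jac p q y z (sum F A)" if "\<And>a. e36_jac p q y z (F a)" for F :: "gen \<Rightarrow> _" and A y z
    using that by (cases "p = 1 \<and> q = 1") (auto simp: e36_jac_def e36_bracket_sum sum.distrib sum_subtractf)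
  have "e36_jac p q (\<Sum>g\<in>UNIV. e36_single g (e36_coord x g)) (\<Sum>g\<in>UNIV. e36_single g (e36_coord y g))
    (\<Sum>g\<in>UNIV. e36_single g (e36_coord z g))"
    by (intro s s' s'' 1)
  then show ?thesis by (simp flip: e36_expand)
qed

section \<open>The gradation of E(3,6)\<close>

text \<open>\<open>d\<close> is the degree of the generator that has the series \<open>f\<close> as a coefficient.\<close>

definition fps3_deg :: "int \<Rightarrow> (int \<Rightarrow> bool) \<Rightarrow> 'a::zero fps3 \<Rightarrow> bool" where
  "fps3_deg d P f \<longleftrightarrow> (\<forall>M. coeff3 f M \<noteq> 0 \<longrightarrow> P (d + 2 * int (mdeg M)))"

lemma mdeg_add: "mdeg (M + N) = mdeg M + mdeg N"
  by (simp add: mdeg_def sum.distrib)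

lemma mdeg_axis [simp]: "mdeg (axis i n) = n"
  by (simp add: mdeg_def axis_def)

lemma fps3_deg_zero [simp]: "fps3_deg d P 0"
  by (simp add: fps3_deg_def)

lemma fps3_deg_add: "fps3_deg d P f \<Longrightarrow> fps3_deg d P g \<Longrightarrow> fps3_deg d P (f + g :: 'a::comm_ring_1 fps3)"
  unfolding fps3_deg_def coeff3_add by (metis add.right_neutral)

lemma fps3_deg_uminus: "fps3_deg d P f \<Longrightarrow> fps3_deg d P (- f :: 'a::comm_ring_1 fps3)"
  by (simp add: fps3_deg_def coeff3_uminus)

lemma fps3_deg_diff: "fps3_deg d P f \<Longrightarrow> fps3_deg d P g \<Longrightarrow> fps3_deg d P (f - g :: 'a::comm_ring_1 fps3)"
  using fps3_deg_add[of d P f "- g"] fps3_deg_uminus[of d P g] by simp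

lemma fps3_deg_const3_mult: "fps3_deg d P f \<Longrightarrow> fps3_deg d P (const3 c * f :: 'a::comm_ring_1 fps3)"
  unfolding fps3_deg_def coeff3_const3_mult by (metis mult_zero_right)

text \<open>The predicates stay arbitrary so that the components (e = d) and the filtration (e \<ge>
  d) are treated by the same proofs.\<close>

lemma fps3_deg_mult:
  fixes f g :: "'a::comm_ring_1 fps3"
  assumes "fps3_deg d P f" "fps3_deg e Q g" "d + e = k" "\<And>a b. P a \<Longrightarrow> Q b \<Longrightarrow> R (a + b)"
  shows "fps3_deg k R (f * g)"
  unfolding fps3_deg_def
proof (intro allI impI)
  fix M assume "coeff3 (f * g) M \<noteq> 0"
  then obtain K N where M: "M = K + N" "coeff3 f K \<noteq> 0" "coeff3 g N \<noteq> 0" by (rule coeff3_mult_nonzero)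
  then have "R ((d + 2 * int (mdeg K)) + (e + 2 * int (mdeg N)))"
    using assms(1,2) by (intro assms(4)) (auto simp: fps3_deg_def)
  then show "R (k + 2 * int (mdeg M))"
    by (simp add: M(1) mdeg_add assms(3)[symmetric] algebra_simps)
qed

text \<open>A derivative lowers the exponent by one and hence the degree by 2; the offset
  \<open>d + 2\<close> compensates for this.\<close>

lemma fps3_deg_pderiv3:
  "fps3_deg d P f \<Longrightarrow> fps3_deg (d + 2) P (pderiv3 i f :: 'a::comm_ring_1 fps3)"
  unfolding fps3_deg_def coeff3_pderiv3
proof (intro allI impI)
  fix M assume *: "\<forall>M. coeff3 f M \<noteq> 0 \<longrightarrow> P (d + 2 * int (mdeg M))"
    and "of_nat (M $ i + 1) * coeff3 f (M + axis i 1) \<noteq> 0"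
  then have "coeff3 f (M + axis i 1) \<noteq> 0" by auto
  with * have "P (d + 2 * int (mdeg (M + axis i 1)))" by blast
  then show "P (d + 2 + 2 * int (mdeg M))" by (simp add: mdeg_add algebra_simps)
qed

lemma all_gen: "(\<forall>g. P g) \<longleftrightarrow> (\<forall>i. P (GA i)) \<and> (\<forall>z. P (GC z)) \<and> (\<forall>h k. P (GB h k))"
  using gen.exhaust by metis

lemma e36_degrees_iff: "x \<in> e36_degrees P \<longleftrightarrow> (\<forall>g. fps3_deg (gen_degree g) P (e36_coord x g))"
proof -
  obtain X c w where x: "x = (X, c, w)" by (metis prod_cases3)
  show ?thesis
    unfolding all_gen by (auto simp: x e36_degrees_def fps3_deg_def algebra_simps)
qed

lemma single_degrees: "fps3_deg (gen_degree g) P f \<Longrightarrow> e36_single g f \<in> e36_degrees P"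
  by (simp add: e36_degrees_iff coord_single)

lemma e36_degrees_add: "x \<in> e36_degrees P \<Longrightarrow> y \<in> e36_degrees P \<Longrightarrow> x + y \<in> e36_degrees P"
  and e36_degrees_uminus: "x \<in> e36_degrees P \<Longrightarrow> - x \<in> e36_degrees P"
  and e36_degrees_smult: "x \<in> e36_degrees P \<Longrightarrow> e36_smult c x \<in> e36_degrees P"
  and e36_degrees_zero [simp]: "0 \<in> e36_degrees P"
  by (simp_all add: e36_degrees_iff fps3_deg_add fps3_deg_uminus fps3_deg_const3_mult)

lemma e36_degrees_diff: "x \<in> e36_degrees P \<Longrightarrow> y \<in> e36_degrees P \<Longrightarrow> x - y \<in> e36_degrees P"
  using e36_degrees_add[of x P "- y"] by (simp add: e36_degrees_uminus)

lemma e36_degrees_sum: "(\<And>a. a \<in> A \<Longrightarrow> f a \<in> e36_degrees P) \<Longrightarrow> sum f A \<in> e36_degrees P"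
  by (induction A rule: infinite_finite_induct) (simp_all add: e36_degrees_add)

text \<open>In the brackets of single coordinates, a term without derivative lands in a generator
  whose degree is the sum of the two degrees, and a term with one derivative in a generator of
  degree 2 higher.\<close>

lemma e36_degrees_bracket_single:
  assumes f: "fps3_deg (gen_degree a) P f" and g: "fps3_deg (gen_degree b) Q g"
    and PQ: "\<And>m n. P m \<Longrightarrow> Q n \<Longrightarrow> R (m + n)"
  shows "e36_bracket (e36_single a f) (e36_single b g) \<in> e36_degrees R"
proof -
  have 1: "fps3_deg k R (f * pderiv3 i g)" if "k = gen_degree a + gen_degree b + 2" for k i
    by (rule fps3_deg_mult[OF f fps3_deg_pderiv3[OF g]]) (simp_all add: PQ that)
  have 2: "fps3_deg k R (pderiv3 i f * g)" if "k = gen_degree a + gen_degree b + 2" for k i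
    by (rule fps3_deg_mult[OF fps3_deg_pderiv3[OF f] g]) (simp_all add: PQ that)
  have 3: "fps3_deg k R (f * g)" if "k = gen_degree a + gen_degree b" for k
    by (rule fps3_deg_mult[OF f g]) (simp_all add: PQ that)
  note comm = mult.commute[of g f] mult.commute[of g "pderiv3 _ f"] mult.commute[of "pderiv3 _ g" f]
  have if_closed: "(if B then x else y) \<in> e36_degrees R" if "x \<in> e36_degrees R" "y \<in> e36_degrees R" for B x y
    using that by simp
  note closure = single_degrees e36_degrees_add e36_degrees_uminus e36_degrees_diff e36_degrees_sum
    fps3_deg_diff fps3_deg_const3_mult 1 2 3
  show ?thesis
    by (cases a; cases b; hypsubst; simp only: single_bracket comm mult.assoc; intro closure if_closed; simp)
qed

lemma e36_degrees_bracket: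
  assumes x: "x \<in> e36_degrees P" and y: "y \<in> e36_degrees Q"
    and PQ: "\<And>m n. P m \<Longrightarrow> Q n \<Longrightarrow> R (m + n)"
  shows "e36_bracket x y \<in> e36_degrees R"
proof -
  have "e36_bracket (e36_single a (e36_coord x a)) (e36_single b (e36_coord y b)) \<in> e36_degrees R" for a b
    using x y PQ by (intro e36_degrees_bracket_single[where P = P and Q = Q]) (auto simp: e36_degrees_iff)
  then have "e36_bracket (\<Sum>g\<in>UNIV. e36_single g (e36_coord x g)) (\<Sum>g\<in>UNIV. e36_single g (e36_coord y g)) \<in> e36_degrees R"
    unfolding e36_bracket_sum by (intro e36_degrees_sum)
  then show ?thesis by (simp flip: e36_expand)
qed

section \<open>E(3,6) as a complete graded Lie superalgebra\<close>

lemma E36_sel: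
  "gs_carrier E36 = UNIV" "gs_add E36 = (+)" "gs_zero E36 = 0" "gs_smult E36 = e36_smult"
  "gs_bracket E36 = e36_bracket" "gs_comp E36 = (\<lambda>d. e36_degrees (\<lambda>e. e = d))"
  "gs_filt E36 = (\<lambda>d. e36_degrees (\<lambda>e. e \<ge> d))"
  by (simp_all add: E36_def)

lemma gs_subspace_E36I:
  "0 \<in> S \<Longrightarrow> (\<And>x y. x \<in> S \<Longrightarrow> y \<in> S \<Longrightarrow> x + y \<in> S) \<Longrightarrow> (\<And>c x. x \<in> S \<Longrightarrow> e36_smult c x \<in> S)
   \<Longrightarrow> gs_subspace E36 S"
  by (simp add: gs_subspace_def E36_def)

text \<open>The common form of the projections onto parities, homogeneous components and filtration
  steps; for finitely many pairs it is a polynomial truncation.\<close>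

definition e36_filter :: "(gen \<Rightarrow> mon \<Rightarrow> bool) \<Rightarrow> 'a::zero e36 \<Rightarrow> 'a e36" where
  "e36_filter p x = e36_of (\<lambda>g. mk_fps3 (\<lambda>M. if p g M then coeff3 (e36_coord x g) M else 0))"

lemma coeff3_coord_filter [simp]:
  "coeff3 (e36_coord (e36_filter p x) g) M = (if p g M then coeff3 (e36_coord x g) M else 0)"
  by (simp add: e36_filter_def)

lemma e36_coeff_eqI: "(\<And>g M. coeff3 (e36_coord x g) M = coeff3 (e36_coord y g) M) \<Longrightarrow> x = y"
  by (intro e36_eqI coeff3_eqI)

lemma e36_filter_split: "e36_filter p x + e36_filter (\<lambda>g M. \<not> p g M) x = (x :: 'a::field_char_0 e36)"
  by (rule e36_coeff_eqI) (simp add: coeff3_add)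

lemma e36_direct_sumI:
  assumes "\<And>x. x \<in> S \<Longrightarrow> e36_filter p x \<in> T" "\<And>x. x \<in> S \<Longrightarrow> e36_filter (\<lambda>g M. \<not> p g M) x \<in> U"
    and "\<And>x y. x \<in> T \<Longrightarrow> y \<in> U \<Longrightarrow> x + y \<in> S" "0 \<in> T" "0 \<in> U" "\<And>x. x \<in> T \<Longrightarrow> x \<in> U \<Longrightarrow> x = 0"
  shows "gs_direct_sum E36 S T (U :: 'a::field_char_0 e36 set)"
proof -
  have "S = {x + y | x y. x \<in> T \<and> y \<in> U}"
  proof (intro equalityI subsetI)
    show "x \<in> {x + y | x y. x \<in> T \<and> y \<in> U}" if "x \<in> S" for x
      using e36_filter_split[of p x, symmetric] assms(1,2)[OF that] by blast
  qed (use assms(3) in blast)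
  moreover have "T \<inter> U = {0}" using assms(4-6) by blast
  ultimately show ?thesis by (simp add: gs_direct_sum_def E36_def)
qed

lemma e36_parity_coeff: "x \<in> e36_parity p \<longleftrightarrow> (\<forall>g M. coeff3 (e36_coord x g) M \<noteq> 0 \<longrightarrow> gen_parity g = p)"
  unfolding e36_parity_iff by (metis coeff3_eqI coeff3_zero)

lemma e36_degrees_coeff:
  "x \<in> e36_degrees P \<longleftrightarrow> (\<forall>g M. coeff3 (e36_coord x g) M \<noteq> 0 \<longrightarrow> P (gen_degree g + 2 * int (mdeg M)))"
  by (simp add: e36_degrees_iff fps3_deg_def)

lemma e36_degrees_mono: "x \<in> e36_degrees P \<Longrightarrow> (\<And>e. P e \<Longrightarrow> Q e) \<Longrightarrow> x \<in> e36_degrees Q"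
  by (simp add: e36_degrees_coeff)

lemma e36_parity_add: "x \<in> e36_parity p \<Longrightarrow> y \<in> e36_parity p \<Longrightarrow> x + y \<in> e36_parity p"
  and e36_parity_smult: "x \<in> e36_parity p \<Longrightarrow> e36_smult c x \<in> e36_parity p"
  and e36_parity_zero: "0 \<in> e36_parity p"
  unfolding e36_parity_iff coord_add coord_smult coord_zero
  by (metis add.right_neutral, metis mult_zero_right, simp)

lemma gs_parity_E36: "gs_parity E36 p = e36_parity p"
  by (simp add: E36_def e36_parity_def)

lemma e36_degrees_direct_sum_parity:
  "gs_direct_sum E36 (e36_degrees P) (e36_degrees P \<inter> e36_parity 0) (e36_degrees P \<inter> e36_parity 1)"
proof (rule e36_direct_sumI[where p = "\<lambda>g M. gen_parity g = 0"])
  fix x y :: "'a e36"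
  show "x + y \<in> e36_degrees P" if "x \<in> e36_degrees P \<inter> e36_parity 0" "y \<in> e36_degrees P \<inter> e36_parity 1"
    using that by (simp add: e36_degrees_add)
  show "x = 0" if "x \<in> e36_degrees P \<inter> e36_parity 0" "x \<in> e36_degrees P \<inter> e36_parity 1"
    using that by (intro e36_coeff_eqI) (auto simp: e36_parity_coeff)
qed (use two_cases in \<open>auto simp: e36_degrees_coeff e36_parity_coeff\<close>)

lemma e36_complete:
  fixes h :: "int \<Rightarrow> 'a::field_char_0 e36"
  assumes h: "\<And>d. h d \<in> e36_degrees (\<lambda>e. e = d)"
  shows "\<exists>z. \<forall>n. \<exists>r\<in>e36_degrees (\<lambda>e. e \<ge> N + int n). z = gs_partial_sum E36 N h n + r"
proof -
  define D where "D g M = gen_degree g + 2 * int (mdeg M)" for g M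
  \<comment> \<open>Each coefficient has one degree and is taken from the component of that degree.
    Degrees below \<open>N\<close> are left out because the partial sums start at
    \<open>N\<close>.\<close>
  define z where "z = e36_of (\<lambda>g. mk_fps3 (\<lambda>M. if D g M \<ge> N then coeff3 (e36_coord (h (D g M)) g) M else 0))"
  have h0: "coeff3 (e36_coord (h d) g) M = 0" if "D g M \<noteq> d" for d g M
    using h[of d] that by (auto simp: e36_degrees_coeff D_def)
  have ps: "coeff3 (e36_coord (gs_partial_sum E36 N h n) g) M =
    (if N \<le> D g M \<and> D g M < N + int n then coeff3 (e36_coord (h (D g M)) g) M else 0)" for n g M
  proof (induction n)
    case 0 show ?case by (auto simp: E36_def)
  next
    case (Suc n)
    show ?case
      using Suc h0[of g M "N + int n"]
      by (cases "D g M = N + int n") (auto simp: E36_sel coeff3_add)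
  qed
  have "z - gs_partial_sum E36 N h n \<in> e36_degrees (\<lambda>e. e \<ge> N + int n)" for n
    by (auto simp: e36_degrees_coeff coeff3_diff ps z_def D_def[symmetric])
  then show ?thesis by (intro exI[of _ z] allI bexI[of _ "z - gs_partial_sum E36 N h _"]) auto
qed

lemma e36_smult_assoc: "e36_smult c (e36_smult c' x) = e36_smult (c * c') x"
  by (rule e36_eqI) (simp add: const3_mult mult.assoc)

lemma e36_smult_1: "e36_smult 1 x = x" and e36_smult_neg1: "e36_smult (- 1) x = - x"
  by (rule e36_eqI; simp add: const3_uminus)+

theorem graded_lie_superalgebra_E36: "graded_lie_superalgebra (E36 :: ('a::field_char_0, 'a e36) gsalg)"
proof
  fix x y z :: "'a e36" and c c' :: 'a and p q :: 2 and d e :: int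
  note sel [simp] = E36_sel
  show "gs_subspace E36 (gs_carrier E36 :: 'a e36 set)" by (rule gs_subspace_E36I) auto
  show "gs_add E36 (gs_add E36 x y) z = gs_add E36 x (gs_add E36 y z)" by (simp add: add.assoc)
  show "gs_add E36 x y = gs_add E36 y x" by (simp add: add.commute)
  show "gs_add E36 (gs_zero E36) x = x" by simp
  show "gs_add E36 x (gs_smult E36 (- 1) x) = gs_zero E36" by (simp add: e36_smult_neg1)
  show "gs_smult E36 c (gs_add E36 x y) = gs_add E36 (gs_smult E36 c x) (gs_smult E36 c y)"
    by (rule e36_eqI) (simp add: distrib_left)
  show "gs_smult E36 (c + c') x = gs_add E36 (gs_smult E36 c x) (gs_smult E36 c' x)"
    by (rule e36_eqI) (simp add: distrib_right const3_add)
  show "gs_smult E36 c (gs_smult E36 c' x) = gs_smult E36 (c * c') x" by (simp add: e36_smult_assoc)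
  show "gs_smult E36 1 x = x" by (simp add: e36_smult_1)
  show "gs_bracket E36 x y \<in> gs_carrier E36" by simp
  show "gs_bracket E36 (gs_add E36 x y) z = gs_add E36 (gs_bracket E36 x z) (gs_bracket E36 y z)"
    by (simp add: e36_bracket_add_left)
  show "gs_bracket E36 x (gs_add E36 y z) = gs_add E36 (gs_bracket E36 x y) (gs_bracket E36 x z)"
    by (simp add: e36_bracket_add_right)
  show "gs_bracket E36 (gs_smult E36 c x) y = gs_smult E36 c (gs_bracket E36 x y)"
    by (simp add: e36_bracket_smult_left)
  show "gs_bracket E36 x (gs_smult E36 c y) = gs_smult E36 c (gs_bracket E36 x y)"
    by (simp add: e36_bracket_smult_right)
  show "gs_subspace E36 (gs_parity E36 p :: 'a e36 set)"
    unfolding gs_parity_E36 by (rule gs_subspace_E36I) (auto intro: e36_parity_add e36_parity_smult e36_parity_zero)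
  have 1: "e36_degrees (\<lambda>_. True) = (UNIV :: 'a e36 set)" by (auto simp: e36_degrees_coeff)
  show "gs_direct_sum E36 (gs_carrier E36 :: 'a e36 set) (gs_parity E36 0) (gs_parity E36 1)"
    using e36_degrees_direct_sum_parity[where 'a = 'a and P = "\<lambda>_. True"] by (simp add: 1 gs_parity_E36)
  show "gs_bracket E36 x y \<in> gs_parity E36 (p + q)" if "x \<in> gs_parity E36 p" "y \<in> gs_parity E36 q"
    using e36_parity_bracket that by (simp add: gs_parity_E36)
  show "gs_bracket E36 y x = gs_smult E36 (- super_sign p q) (gs_bracket E36 x y)"
    if "x \<in> gs_parity E36 p" "y \<in> gs_parity E36 q"
    using e36_parity_skew[of x p y q] that by (simp add: gs_parity_E36 super_sign_def e36_smult_neg1 e36_smult_1)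
  show "gs_bracket E36 x (gs_bracket E36 y z) = gs_add E36 (gs_bracket E36 (gs_bracket E36 x y) z)
                (gs_smult E36 (super_sign p q) (gs_bracket E36 y (gs_bracket E36 x z)))"
    if "x \<in> gs_parity E36 p" "y \<in> gs_parity E36 q"
    using e36_jacobi[of x p y q z] that by (simp add: gs_parity_E36 super_sign_def e36_smult_neg1 e36_smult_1 e36_jac_def)
  show "gs_subspace E36 (gs_comp E36 d :: 'a e36 set)" "gs_subspace E36 (gs_filt E36 d :: 'a e36 set)"
    by (auto intro!: gs_subspace_E36I intro: e36_degrees_add e36_degrees_smult)
  show "gs_direct_sum E36 (gs_comp E36 d :: 'a e36 set)
          (gs_comp E36 d \<inter> gs_parity E36 0) (gs_comp E36 d \<inter> gs_parity E36 1)"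
    "gs_direct_sum E36 (gs_filt E36 d :: 'a e36 set)
          (gs_filt E36 d \<inter> gs_parity E36 0) (gs_filt E36 d \<inter> gs_parity E36 1)"
    by (simp_all add: gs_parity_E36 e36_degrees_direct_sum_parity)
  show "gs_bracket E36 x y \<in> gs_comp E36 (d + e)" if "x \<in> gs_comp E36 d" "y \<in> gs_comp E36 e"
    using that unfolding sel by (rule e36_degrees_bracket) simp
  show "gs_bracket E36 x y \<in> gs_filt E36 (d + e)" if "x \<in> gs_filt E36 d" "y \<in> gs_filt E36 e"
    using that unfolding sel by (rule e36_degrees_bracket) simp
  show "gs_direct_sum E36 (gs_filt E36 d :: 'a e36 set) (gs_comp E36 d) (gs_filt E36 (d + 1))"
    unfolding sel
  proof (rule e36_direct_sumI[where p = "\<lambda>g M. gen_degree g + 2 * int (mdeg M) = d"])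
    fix x y :: "'a e36"
    show "x + y \<in> e36_degrees (\<lambda>e. d \<le> e)" if "x \<in> e36_degrees (\<lambda>e. e = d)" "y \<in> e36_degrees (\<lambda>e. d + 1 \<le> e)"
      by (rule e36_degrees_add[OF e36_degrees_mono[OF that(1)] e36_degrees_mono[OF that(2)]]) auto
    show "x = 0" if "x \<in> e36_degrees (\<lambda>e. e = d)" "x \<in> e36_degrees (\<lambda>e. d + 1 \<le> e)"
    proof (rule e36_coeff_eqI)
      show "coeff3 (e36_coord x g) M = coeff3 (e36_coord 0 g) M" for g M
        using that[unfolded e36_degrees_coeff, rule_format, of g M] by auto
    qed
  qed (auto simp: e36_degrees_coeff add1_zle_eq less_le)
  have "gen_degree g \<ge> - 2" for g by (cases g) auto
  then have "gs_filt E36 (- 2) = (gs_carrier E36 :: 'a e36 set)"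
    unfolding sel by (auto simp: e36_degrees_coeff add_increasing2)
  then show "\<exists>N. gs_filt E36 N = (gs_carrier E36 :: 'a e36 set)" ..
  \<comment> \<open>A coefficient has a fixed degree, and membership in the step one above that
    degree forces it to vanish.\<close>
  have "x = 0" if "\<And>d. x \<in> e36_degrees (\<lambda>e. e \<ge> d)" for x :: "'a e36"
  proof (rule e36_coeff_eqI)
    fix g M
    show "coeff3 (e36_coord x g) M = coeff3 (e36_coord 0 g) M"
      using that[of "gen_degree g + 2 * int (mdeg M) + 1", unfolded e36_degrees_coeff, rule_format, of g M] by auto
  qed
  then show "(\<Inter>d. gs_filt E36 d) = {gs_zero E36 :: 'a e36}" by auto
next
  fix h :: "int \<Rightarrow> 'a e36" and N :: int
  assume "\<And>d. h d \<in> gs_comp E36 d"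
  then have "\<And>d. h d \<in> e36_degrees (\<lambda>e. e = d)" by (simp add: E36_def)
  then show "\<exists>z\<in>gs_carrier E36. \<forall>n. \<exists>r\<in>gs_filt E36 (N + int n). z = gs_add E36 (gs_partial_sum E36 N h n) r"
    using e36_complete[of h N] by (simp add: E36_def)
qed

section \<open>Evaluation of lambda-brackets on pairs of power series\<close>

text \<open>Keeps the exponent \<open>axis i 1\<close> from being rewritten to \<open>axis i (Suc 0)\<close>.\<close>

declare One_nat_def [simp del]

text \<open>The common shape of \<open>ev\<close>, \<open>ev_inner\<close>,
  \<open>lam_reflect\<close>, \<open>poly3_subst\<close> and \<open>normal_form\<close>, whose
  additivity is thereby proved once.\<close>

definition pm_sum :: "('k \<Rightarrow> 'b::zero \<Rightarrow> 'c::comm_monoid_add) \<Rightarrow> ('k \<Rightarrow>\<^sub>0 'b) \<Rightarrow> 'c" where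
  "pm_sum F p = (\<Sum>K\<in>Poly_Mapping.keys p. F K (Poly_Mapping.lookup p K))"

text \<open>Cancellation can shrink the support of a sum, so supports are enlarged to a common
  finite set before they are compared.\<close>

lemma pm_sum_superset:
  assumes "finite S" "Poly_Mapping.keys p \<subseteq> S" "\<And>K. F K 0 = 0"
  shows "pm_sum F p = (\<Sum>K\<in>S. F K (Poly_Mapping.lookup p K))"
  unfolding pm_sum_def using assms
  by (intro sum.mono_neutral_left) (auto simp: in_keys_iff)

lemma pm_sum_add:
  fixes p q :: "'k \<Rightarrow>\<^sub>0 'b::monoid_add"
  assumes "\<And>K. F K 0 = 0" "\<And>K a b. F K (a + b) = F K a + F K b"
  shows "pm_sum F (p + q) = pm_sum F p + pm_sum F q"
proof -
  let ?S = "Poly_Mapping.keys p \<union> Poly_Mapping.keys q"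
  have "pm_sum F (p + q) = (\<Sum>K\<in>?S. F K (Poly_Mapping.lookup (p + q) K))"
    by (intro pm_sum_superset assms(1) keys_add) auto
  also have "\<dots> = (\<Sum>K\<in>?S. F K (Poly_Mapping.lookup p K)) + (\<Sum>K\<in>?S. F K (Poly_Mapping.lookup q K))"
    by (simp add: lookup_add assms(2) sum.distrib)
  also have "\<dots> = pm_sum F p + pm_sum F q"
    by (simp add: pm_sum_superset[where S = ?S] assms(1))
  finally show ?thesis .
qed

lemma pm_sum_single: "F K 0 = 0 \<Longrightarrow> pm_sum F (Poly_Mapping.single K a) = F K a"
  by (cases "a = 0") (simp_all add: pm_sum_def lookup_single)

lemma pm_sum_zero [simp]: "pm_sum F 0 = 0"
  by (simp add: pm_sum_def)

lemma poly_mapping_expand: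
  fixes p :: "'k \<Rightarrow>\<^sub>0 'b::comm_monoid_add"
  shows "p = (\<Sum>K\<in>Poly_Mapping.keys p. Poly_Mapping.single K (Poly_Mapping.lookup p K))"
  by (rule poly_mapping_eqI) (simp add: lookup_sum lookup_single when_def in_keys_iff)

lemma poly_mapping_additive_induct:
  fixes p :: "'k \<Rightarrow>\<^sub>0 'b::comm_monoid_add"
  assumes "\<And>K a. P (Poly_Mapping.single K a)" "\<And>p q. P p \<Longrightarrow> P q \<Longrightarrow> P (p + q)"
  shows "P p"
proof -
  have "P (\<Sum>K\<in>A. Poly_Mapping.single K (Poly_Mapping.lookup p K))" if "finite A" for A
    using that
  proof (induction A rule: finite_induct)
    case empty show ?case using assms(1)[of undefined 0] by simp
  qed (simp add: assms)
  then show ?thesis using poly_mapping_expand[of p] finite_keys[of p] by metis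
qed

section \<open>Iterated derivations\<close>

definition iter3 :: "(3 \<Rightarrow> 'b \<Rightarrow> 'b) \<Rightarrow> mon \<Rightarrow> 'b \<Rightarrow> 'b" where
  "iter3 D K f = (D 1 ^^ (K $ 1)) ((D 2 ^^ (K $ 2)) ((D 3 ^^ (K $ 3)) f))"

lemma funpow_commute: "(\<And>f. D (E f) = E (D f)) \<Longrightarrow> D ((E ^^ n) f) = (E ^^ n) (D f)"
  by (induction n) simp_all

lemma iter3_zero [simp]: "iter3 D 0 f = f"
  by (simp add: iter3_def)

lemma iter3_outer:
  assumes "\<And>i f. E (D i f) = D i (E f)"
  shows "E (iter3 D K f) = iter3 D K (E f)"
  using assms by (simp add: iter3_def funpow_commute[of E])

lemma iter3_add_axis:
  assumes "\<And>i j f. D i (D j f) = D j (D i f)"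
  shows "iter3 D (K + axis i 1) f = iter3 D K (D i f)"
proof -
  have "i = 1 \<or> i = 2 \<or> i = 3" by (rule exhaust_3)
  then show ?thesis
  proof (elim disjE)
    assume i: "i = 1"
    have "D 1 ((D 2 ^^ (K $ 2)) ((D 3 ^^ (K $ 3)) f)) = (D 2 ^^ (K $ 2)) ((D 3 ^^ (K $ 3)) (D 1 f))"
      by (simp add: funpow_commute[of "D 1"] assms)
    then show ?thesis by (simp add: i iter3_def axis_def funpow_add funpow_swap1 One_nat_def)
  next
    assume i: "i = 2"
    have "D 2 ((D 3 ^^ (K $ 3)) f) = (D 3 ^^ (K $ 3)) (D 2 f)"
      by (simp add: funpow_commute[of "D 2"] assms)
    then show ?thesis by (simp add: i iter3_def axis_def funpow_add funpow_swap1 One_nat_def)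
  next
    assume i: "i = 3"
    then show ?thesis by (simp add: iter3_def axis_def funpow_add funpow_swap1 One_nat_def)
  qed
qed

lemma iter3_additive:
  assumes "\<And>i f g. D i (f + g) = D i f + D i g"
  shows "iter3 D K (f + g) = iter3 D K f + iter3 D K g"
proof -
  have "(D i ^^ n) (f + g) = (D i ^^ n) f + (D i ^^ n) g" for i n f g
    by (induction n) (simp_all add: assms)
  then show ?thesis by (simp add: iter3_def)
qed

lemma pderivs3_eq: "pderivs3 = iter3 pderiv3"
  by (simp add: pderivs3_def iter3_def fun_eq_iff)

definition neg_pderiv3 :: "3 \<Rightarrow> 'a::comm_ring_1 fps3 \<Rightarrow> 'a fps3" where
  "neg_pderiv3 i f = - pderiv3 i f"

abbreviation neg_pderivs3 :: "mon \<Rightarrow> 'a::comm_ring_1 fps3 \<Rightarrow> 'a fps3" where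
  "neg_pderivs3 \<equiv> iter3 neg_pderiv3"

lemma neg_pderivs3_add: "neg_pderivs3 K (f + g) = neg_pderivs3 K f + neg_pderivs3 K g"
  by (rule iter3_additive) (simp add: neg_pderiv3_def pderiv3_add)

lemma neg_pderivs3_zero [simp]: "neg_pderivs3 K 0 = 0"
  using neg_pderivs3_add[of K 0 0] by simp

lemma neg_pderivs3_pderiv3: "neg_pderivs3 K (pderiv3 i f) = pderiv3 i (neg_pderivs3 K f)"
  by (rule iter3_outer[symmetric]) (simp add: neg_pderiv3_def pderiv3_uminus pderiv3_commute[of i])

lemma neg_pderivs3_add_axis: "neg_pderivs3 (K + axis i 1) f = - pderiv3 i (neg_pderivs3 K f)"
proof -
  have "neg_pderivs3 (K + axis i 1) f = neg_pderivs3 K (neg_pderiv3 i f)"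
    by (rule iter3_add_axis) (simp add: neg_pderiv3_def pderiv3_uminus pderiv3_commute)
  also have "\<dots> = neg_pderiv3 i (neg_pderivs3 K f)"
    by (rule iter3_outer[symmetric]) (simp add: neg_pderiv3_def pderiv3_uminus pderiv3_commute[of i])
  finally show ?thesis by (simp add: neg_pderiv3_def)
qed

lemma neg_pderivs3_const3_mult: "neg_pderivs3 K (const3 c * f) = const3 c * neg_pderivs3 K f"
  by (rule iter3_outer[symmetric]) (simp add: neg_pderiv3_def)

lemma pderivs3_add_axis: "pderivs3 (K + axis i 1) f = pderivs3 K (pderiv3 i f)"
  unfolding pderivs3_eq by (rule iter3_add_axis) (rule pderiv3_commute)

lemma pderivs3_pderiv3: "pderivs3 K (pderiv3 i f) = pderiv3 i (pderivs3 K f)"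
  unfolding pderivs3_eq by (rule iter3_outer[symmetric]) (rule pderiv3_commute)

text \<open>
  \<open>ev\<close> lets \<open>lambda_i\<close> act as the derivation of the first series, and the derivation \<open>del_i\<close> of the
  module as minus the derivation of the product, as in the quotient by total derivatives.
  Hence \<open>- lambda_i - del_i\<close> acts as the derivation of the second series.
\<close>

definition ev_inner :: "'a::field_char_0 poly3 \<Rightarrow> 'a fps3 \<Rightarrow> 'a fps3" where
  "ev_inner P h = pm_sum (\<lambda>K c. const3 c * neg_pderivs3 K h) P"

definition ev :: "'a::field_char_0 poly3 poly3 \<Rightarrow> 'a fps3 \<Rightarrow> 'a fps3 \<Rightarrow> 'a fps3" where
  "ev Q f g = pm_sum (\<lambda>J P. ev_inner P (pderivs3 J f * g)) Q"

lemma ev_inner_add: "ev_inner (P + P') h = ev_inner P h + ev_inner P' h"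
  unfolding ev_inner_def by (rule pm_sum_add) (simp_all add: const3_add distrib_right)

lemma ev_inner_zero [simp]: "ev_inner 0 h = 0"
  by (simp add: ev_inner_def)

lemma ev_add: "ev (Q + Q') f g = ev Q f g + ev Q' f g"
  unfolding ev_def by (rule pm_sum_add) (simp_all add: ev_inner_add)

lemma ev_zero [simp]: "ev 0 f g = 0"
  by (simp add: ev_def)

lemma ev_uminus: "ev (- Q) f g = - ev Q f g"
  using ev_add[of Q "- Q" f g] by (simp add: minus_unique)

lemma ev_diff: "ev (Q - Q') f g = ev Q f g - ev Q' f g"
  using ev_add[of Q "- Q'" f g] by (simp add: ev_uminus)

lemma ev_single: "ev (Poly_Mapping.single J (Poly_Mapping.single K c)) f g =
    const3 c * neg_pderivs3 K (pderivs3 J f * g)"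
  by (simp add: ev_def ev_inner_def pm_sum_single)

lemma poly33_induct:
  assumes "\<And>J K a. P (Poly_Mapping.single J (Poly_Mapping.single K a))" "\<And>p q. P p \<Longrightarrow> P q \<Longrightarrow> P (p + q)"
  shows "P (Q :: 'a::comm_ring_1 poly3 poly3)"
proof (rule poly_mapping_additive_induct)
  show "P (Poly_Mapping.single J R)" for J R
  proof (rule poly_mapping_additive_induct[of "\<lambda>R. P (Poly_Mapping.single J R)"])
    show "P (Poly_Mapping.single J (p + q))" if "P (Poly_Mapping.single J p)" "P (Poly_Mapping.single J q)" for p q
      unfolding Poly_Mapping.single_add using that by (rule assms(2))
  qed (rule assms(1))
qed (rule assms(2))

lemma ev_lam_mult: "ev (lam i * Q) f g = ev Q (pderiv3 i f) g"
proof (induction Q rule: poly33_induct)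
  case (1 J K a)
  have "lam i * Poly_Mapping.single J (Poly_Mapping.single K a) = Poly_Mapping.single (J + axis i 1) (Poly_Mapping.single K a)"
    by (simp add: lam_def mult_single add.commute)
  then show ?case by (simp add: ev_single pderivs3_add_axis)
qed (simp add: distrib_left ev_add)

text \<open>All operators involved commute with the derivation, and \<open>f\<close> and
  \<open>g\<close> enter only through a product. It is this rule that turns the action of
  \<open>del i\<close> on the product into one on a single factor, once \<open>lam i\<close> is
  added.\<close>

lemma ev_leibniz: "pderiv3 i (ev Q f g) = ev Q (pderiv3 i f) g + ev Q f (pderiv3 i g)"
proof (induction Q rule: poly33_induct)
  case (1 J K a)
  show ?case
    by (simp add: ev_single pderiv3_mult pderivs3_pderiv3 neg_pderivs3_add flip: neg_pderivs3_pderiv3 distrib_left)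
qed (simp add: ev_add pderiv3_add)

lemma ev_del_mult: "ev (del i * Q) f g = - pderiv3 i (ev Q f g)"
proof (induction Q rule: poly33_induct)
  case (1 J K a)
  have "del i * Poly_Mapping.single J (Poly_Mapping.single K a) = Poly_Mapping.single J (Poly_Mapping.single (K + axis i 1) a)"
    by (simp add: del_def mult_single add.commute)
  then show ?case by (simp add: ev_single neg_pderivs3_add_axis)
qed (simp add: distrib_left ev_add pderiv3_add)

lemma ev_scal_mult: "ev (scal c * Q) f g = const3 c * ev Q f g"
proof (induction Q rule: poly33_induct)
  case (1 J K a)
  have "scal c * Poly_Mapping.single J (Poly_Mapping.single K a) = Poly_Mapping.single J (Poly_Mapping.single K (c * a))"
    by (simp add: scal_def mult_single)
  then show ?case by (simp add: ev_single const3_mult mult.assoc)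
qed (simp add: distrib_left ev_add)

lemma pderivs3_zero_index [simp]: "pderivs3 0 f = f"
  by (simp add: pderivs3_eq)

lemma ev_one [simp]: "ev 1 f g = f * g"
  using ev_single[of 0 0 1 f g] by simp

lemma ev_lam: "ev (lam i) f g = pderiv3 i f * g"
  using ev_lam_mult[of i 1 f g] by simp

lemma ev_del: "ev (del i) f g = - (pderiv3 i f * g) - f * pderiv3 i g"
  using ev_del_mult[of i 1 f g] by (simp add: pderiv3_mult)

lemma ev_scal: "ev (scal c) f g = const3 c * (f * g)"
  using ev_scal_mult[of c 1 f g] by simp

section \<open>Sesquilinearity and skew-symmetry after evaluation\<close>

lemma ev_power_left:
  assumes "\<And>Q f. ev (v * Q) f g = ev Q (D f) g"
  shows "ev (v ^ n * Q) f g = ev Q ((D ^^ n) f) g"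
  by (induction n arbitrary: f) (simp_all add: mult.assoc assms funpow_swap1)

lemma ev_power_right:
  assumes "\<And>Q g. ev (v * Q) f g = ev Q f (D g)"
  shows "ev (v ^ n * Q) f g = ev Q f ((D ^^ n) g)"
  by (induction n arbitrary: g) (simp_all add: mult.assoc assms funpow_swap1)

lemma ev_prod_left:
  assumes "\<And>i Q f. ev (v i * Q) f g = ev Q (D i f) g"
  shows "ev ((\<Prod>i\<in>UNIV. v i ^ (K $ i)) * Q) f g = ev Q (iter3 D K f) g"
proof -
  \<comment> \<open>The leftmost factor is absorbed into \<open>f\<close> first, and
    \<open>iter3\<close> applies the third operator first; hence this order of the factors.\<close>
  have "(\<Prod>i\<in>UNIV. v i ^ (K $ i)) * Q = v 3 ^ (K $ 3) * (v 2 ^ (K $ 2) * (v 1 ^ (K $ 1) * Q))"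
    by (simp add: prod_UNIV_3 mult_ac)
  then show ?thesis by (simp add: ev_power_left[OF assms] iter3_def)
qed

lemma ev_prod_right:
  assumes "\<And>i Q g. ev (v i * Q) f g = ev Q f (D i g)"
  shows "ev ((\<Prod>i\<in>UNIV. v i ^ (K $ i)) * Q) f g = ev Q f (iter3 D K g)"
proof -
  have "(\<Prod>i\<in>UNIV. v i ^ (K $ i)) * Q = v 3 ^ (K $ 3) * (v 2 ^ (K $ 2) * (v 1 ^ (K $ 1) * Q))"
    by (simp add: prod_UNIV_3 mult_ac)
  then show ?thesis by (simp add: ev_power_right[OF assms] iter3_def)
qed

lemma pderivs3_uminus: "pderivs3 J (- f) = - pderivs3 J f"
  unfolding pderivs3_eq by (rule iter3_outer[symmetric]) (simp add: pderiv3_uminus)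

lemma neg_pderivs3_uminus: "neg_pderivs3 J (- f) = - neg_pderivs3 J f"
  by (rule iter3_outer[symmetric]) (simp add: neg_pderiv3_def pderiv3_uminus)

lemma ev_uminus_args: "ev Q (- f) g = - ev Q f g" "ev Q f (- g) = - ev Q f g"
  by (induction Q rule: poly33_induct) (simp_all add: ev_single ev_add pderivs3_uminus neg_pderivs3_uminus)

text \<open>Sesquilinearity: \<open>- lam i\<close> acts as minus the derivation of \<open>f\<close>
  alone, and in \<open>ev_subst_right\<close> \<open>del i + lam i\<close> as minus that of
  \<open>g\<close> alone. These are the very operators that remove derivations in
  \<open>normal_form\<close>, so normal forms are compatible with the bracket.\<close>

lemma ev_subst_left: "ev ((\<Prod>i\<in>UNIV. (- lam i) ^ (K $ i)) * Q) f g = ev Q (neg_pderivs3 K f) g"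
  by (rule ev_prod_left)
    (simp_all add: ev_uminus ev_lam_mult ev_uminus_args neg_pderiv3_def pderiv3_uminus pderiv3_commute)

lemma ev_subst_right: "ev ((\<Prod>i\<in>UNIV. (del i + lam i) ^ (K $ i)) * Q) f g = ev Q f (neg_pderivs3 K g)"
  by (rule ev_prod_right)
    (simp_all add: distrib_right ev_add ev_lam_mult ev_del_mult ev_leibniz ev_uminus_args neg_pderiv3_def pderiv3_uminus pderiv3_commute)

lemma ev_reflect_prod: "ev ((\<Prod>i\<in>UNIV. (- lam i - del i) ^ (J $ i)) * Q) f g = ev Q f (pderivs3 J g)"
  unfolding pderivs3_eq
  by (rule ev_prod_right)
    (simp_all add: left_diff_distrib ev_diff ev_uminus ev_lam_mult ev_del_mult ev_leibniz pderiv3_commute)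

lemma lam_reflect_eq: "lam_reflect Q = pm_sum (\<lambda>J P. Poly_Mapping.single 0 P * (\<Prod>i\<in>UNIV. (- lam i - del i) ^ (J $ i))) Q"
  by (simp add: lam_reflect_def pm_sum_def)

text \<open>Reflection interchanges the operators differentiating \<open>f\<close> and
  \<open>g\<close>, so conformal skew-symmetry becomes the exchange of the two series.\<close>

lemma ev_lam_reflect: "ev (lam_reflect Q) f g = ev Q g f"
proof (induction Q rule: poly33_induct)
  case (1 J K a)
  have "ev (lam_reflect (Poly_Mapping.single J (Poly_Mapping.single K a))) f g
      = ev ((\<Prod>i\<in>UNIV. (- lam i - del i) ^ (J $ i)) * Poly_Mapping.single 0 (Poly_Mapping.single K a)) f g"
    by (simp add: lam_reflect_eq pm_sum_single mult.commute)
  then show ?case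
    by (simp only: ev_reflect_prod ev_single pderivs3_zero_index mult.commute[of f])
next
  case (2 p q)
  have "lam_reflect (p + q) = lam_reflect p + lam_reflect q"
    unfolding lam_reflect_eq by (rule pm_sum_add) (simp_all add: Poly_Mapping.single_add distrib_right)
  then show ?case using 2 by (simp add: ev_add)
qed

text \<open>The sign in \<open>a_i y^M \<mapsto> - x^M \<partial>_i\<close>.\<close>

definition gen_sign :: "gen \<Rightarrow> 'a::comm_ring_1 fps3 \<Rightarrow> 'a fps3" where
  "gen_sign g f = (case g of GA i \<Rightarrow> - f | _ \<Rightarrow> f)"

lemma gen_sign_simps [simp]:
  "gen_sign (GA i) f = - f" "gen_sign (GB h k) f = f" "gen_sign (GC z) f = f"
  "gen_sign g 0 = 0" "gen_sign g (gen_sign g f) = f"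
  by (simp_all add: gen_sign_def split: gen.split)

lemma gen_sign_add: "gen_sign g (f + f') = gen_sign g f + gen_sign g f'"
  and gen_sign_uminus: "gen_sign g (- f) = - gen_sign g f"
  and gen_sign_mult: "gen_sign g (c * f) = c * gen_sign g f"
  by (simp_all add: gen_sign_def split: gen.split)

section \<open>Evaluated brackets of the generators\<close>

definition ev_vec :: "'a::field_char_0 lam_re36 \<Rightarrow> 'a fps3 \<Rightarrow> 'a fps3 \<Rightarrow> 'a e36" where
  "ev_vec V f g = e36_of (\<lambda>u. gen_sign u (ev (V $ u) f g))"

lemma ev_vec_add: "ev_vec (V + W) f g = ev_vec V f g + ev_vec W f g"
  and ev_vec_zero [simp]: "ev_vec 0 f g = 0"
  and ev_vec_uminus: "ev_vec (- V) f g = - ev_vec V f g"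
  by (rule e36_eqI; simp add: ev_vec_def ev_add ev_uminus gen_sign_add gen_sign_uminus)+

lemma ev_vec_diff: "ev_vec (V - W) f g = ev_vec V f g - ev_vec W f g"
  using ev_vec_add[of V "- W"] by (simp add: ev_vec_uminus)

lemma ev_vec_sum: "ev_vec (sum V A) f g = (\<Sum>a\<in>A. ev_vec (V a) f g)"
  by (induction A rule: infinite_finite_induct) (simp_all add: ev_vec_add)

lemma ev_vec_gen: "ev_vec (Q *s gen_vec u) f g = e36_single u (gen_sign u (ev Q f g))"
  by (rule e36_eqI) (auto simp: ev_vec_def gen_vec_def coord_single axis_def)

lemma ev_vec_b_vec: "ev_vec (b_vec h v) f g = (\<Sum>k\<in>UNIV. e36_single (GB h k) (const3 (v $ k) * (f * g)))"
  and ev_vec_sl2_vec: "ev_vec (sl2_vec c) f g = (\<Sum>z\<in>UNIV. e36_single (GC z) (const3 (c $ z) * (f * g)))"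
  by (simp_all add: b_vec_def sl2_vec_def ev_vec_sum ev_vec_gen ev_scal)

lemma ev_vec_table_AA: "ev_vec (gen_bracket_table (GA i) (GA j)) f g =
    e36_bracket (e36_single (GA i) (- f)) (e36_single (GA j) (- g))"
  unfolding gen_bracket_table.simps ev_vec_add ev_vec_gen bracket_single_AA
  by (rule e36_eqI) (simp add: coord_single ev_add ev_lam ev_del pderiv3_uminus mult.commute)

lemma ev_vec_table_AC: "ev_vec (gen_bracket_table (GA i) (GC z)) f g =
    e36_bracket (e36_single (GA i) (- f)) (e36_single (GC z) g)"
  unfolding gen_bracket_table.simps ev_vec_gen bracket_single_AC
  by (simp add: ev_add ev_lam ev_del)

lemma ev_vec_table_CC: "ev_vec (gen_bracket_table (GC z) (GC z')) f g =
    e36_bracket (e36_single (GC z) f) (e36_single (GC z') g)"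
  by (simp add: ev_vec_sl2_vec bracket_single_CC mult.assoc)

lemma ev_vec_table_CB: "ev_vec (gen_bracket_table (GC z) (GB h k)) f g =
    e36_bracket (e36_single (GC z) f) (e36_single (GB h k) g)"
  by (simp add: ev_vec_b_vec bracket_single_CB mult.assoc)

lemma ev_vec_table_AB: "ev_vec (gen_bracket_table (GA i) (GB h k)) f g =
    e36_bracket (e36_single (GA i) (- f)) (e36_single (GB h k) g)"
proof -
  have "2 * const3 (1 / 2) = (1 :: 'a fps3)"
    by (simp flip: const3_mult const3_numeral)
  \<comment> \<open>In 3/2 = 1 + 1/2 the 1 cancels the derivative of \<open>f\<close> contained in
    \<open>del i\<close>; the remaining 1/2 is the twist of the 1-forms by the divergence.\<close>
  moreover have "const3 (3 / 2) = 1 + (const3 (1 / 2) :: 'a fps3)"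
    by (simp flip: const3_add const3_1)
  ultimately have e: "ev (del i + scal (3 / 2) * lam i) f g = - f * pderiv3 i g + const3 (1 / 2) * pderiv3 i f * g"
    by (simp add: ev_add ev_scal_mult ev_lam ev_del distrib_right mult.assoc)
  have "ev_vec (if i = h then \<Sum>j\<in>UNIV. lam j *s gen_vec (GB j k) else 0) f g =
      (if i = h then \<Sum>j\<in>UNIV. e36_single (GB j k) (pderiv3 j f * g) else 0)"
    by (simp add: ev_vec_sum ev_vec_gen ev_lam)
  then show ?thesis
    unfolding gen_bracket_table.simps ev_vec_diff ev_vec_gen bracket_single_AB e
    by (intro e36_eqI) (simp add: coord_single coord_sum pderiv3_uminus sum_negf[symmetric] if_distrib[of uminus] mult.commute cong: if_cong)
qed

lemma ev_vec_mult_sl2_vec: "ev_vec (Q *s sl2_vec c) f g = (\<Sum>z\<in>UNIV. e36_single (GC z) (const3 (c $ z) * ev Q f g))"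
proof -
  have "Q *s sl2_vec c = (\<Sum>z\<in>UNIV. (scal (c $ z) * Q) *s gen_vec (GC z))"
    by (simp add: sl2_vec_def vec_eq_iff sum_distrib_left mult_ac)
  then show ?thesis by (simp add: ev_vec_sum ev_vec_gen ev_scal_mult)
qed

text \<open>The operator \<open>lam t\<close> plus half of \<open>del t\<close> changes sign under
  the reflection of lambda. It evaluates to half of (\<partial>_t f) g - f \<partial>_t g, which is
  the sl2 part of the bracket of two odd elements of E(3,6).\<close>

lemma ev_vec_table_BB: "ev_vec (gen_bracket_table (GB h k) (GB i l)) f g =
    e36_bracket (e36_single (GB h k) f) (e36_single (GB i l) g)"
proof -
  have "2 * const3 (1 / 2) = (1 :: 'a fps3)"
    by (simp flip: const3_mult const3_numeral)
  then have half: "const3 (1 / 2) * x + const3 (1 / 2) * x = x" for x :: "'a fps3"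
    by (metis mult_2 distrib_right mult_1)
  have "ev (scal (1 / 2) * del t + lam t) f g = const3 (1 / 2) * (pderiv3 t f * g - f * pderiv3 t g)" for t
  proof -
    have "ev (scal (1 / 2) * del t + lam t) f g =
        const3 (1 / 2) * (- (pderiv3 t f * g) - f * pderiv3 t g) + pderiv3 t f * g"
      by (simp only: ev_add ev_scal_mult ev_lam ev_del)
    also have "\<dots> = const3 (1 / 2) * (- (pderiv3 t f * g) - f * pderiv3 t g)
        + (const3 (1 / 2) * (pderiv3 t f * g) + const3 (1 / 2) * (pderiv3 t f * g))"
      by (simp only: half)
    finally show ?thesis by (simp add: algebra_simps)
  qed
  then have e: "ev (scal c * (scal (1 / 2) * del t + lam t)) f g =
      const3 c * const3 (1 / 2) * (pderiv3 t f * g - f * pderiv3 t g)" for t c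
    by (simp add: ev_scal_mult mult.assoc)
  have "const3 (- c) = - const3 (c :: 'a)" for c by (rule const3_uminus)
  moreover have "label2 l - label2 k = - (label2 k - label2 l)" by simp
  ultimately have 1: "const3 (of_int (label2 l - label2 k) * eps h i :: 'a) = - const3 (of_int (label2 k - label2 l) * eps h i)"
    by (metis mult_minus_left of_int_minus)
  show ?thesis
    unfolding gen_bracket_table.simps ev_vec_add ev_vec_gen ev_vec_mult_sl2_vec e bracket_single_BB 1 ev_scal
    by (simp add: mult_ac)
qed

lemma ev_vec_reflect: "ev_vec (\<chi> u. - lam_reflect (V $ u)) f g = - ev_vec V g f"
  by (rule e36_eqI) (simp add: ev_vec_def ev_uminus ev_lam_reflect gen_sign_uminus)

text \<open>The three pairs defined by reflection each contain an even generator, so the exchange of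
  series matches plain antisymmetry in E(3,6).\<close>

lemma ev_vec_gen_bracket:
  "ev_vec (gen_bracket a b) f g = e36_bracket (e36_single a (gen_sign a f)) (e36_single b (gen_sign b g))"
  by (cases a; cases b)
    (simp_all only: gen_bracket.simps gen_sign_simps ev_vec_reflect ev_vec_table_AA ev_vec_table_AB ev_vec_table_AC
      ev_vec_table_CC ev_vec_table_CB ev_vec_table_BB single_skew_CA single_skew_BA single_skew_BC)

lemma poly3_subst_eq: "poly3_subst v P = pm_sum (\<lambda>K c. scal c * (\<Prod>i\<in>UNIV. v i ^ (K $ i))) P"
  by (simp add: poly3_subst_def pm_sum_def)

lemma scal_simps [simp]: "scal 0 = 0" "scal 1 = 1"
  by (simp_all add: scal_def)

lemma poly3_subst_zero [simp]: "poly3_subst v 0 = 0"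
  by (simp add: poly3_subst_eq)

lemma poly3_subst_single: "poly3_subst v (Poly_Mapping.single K 1) = (\<Prod>i\<in>UNIV. v i ^ (K $ i))"
  by (simp add: poly3_subst_eq pm_sum_single)

lemma lam_bracket_basis:
  "lam_bracket (basis_re36 a K) (basis_re36 b N) =
    ((\<Prod>i\<in>UNIV. (- lam i) ^ (K $ i)) * (\<Prod>i\<in>UNIV. (del i + lam i) ^ (N $ i))) *s gen_bracket a b"
proof -
  let ?p = "\<Prod>i\<in>UNIV. (- lam i) ^ (K $ i)" and ?q = "\<Prod>i\<in>UNIV. (del i + lam i) ^ (N $ i)"
  have "lam_bracket (basis_re36 a K) (basis_re36 b N) =
    (\<Sum>g\<in>UNIV. \<Sum>h\<in>UNIV. if g = a then (if h = b then (?p * ?q) *s gen_bracket g h else 0) else 0)"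
    unfolding lam_bracket_def
    by (intro sum.cong refl) (simp add: basis_re36_def axis_def poly3_subst_single)
  also have "\<dots> = (\<Sum>g\<in>UNIV. if g = a then (?p * ?q) *s gen_bracket g b else 0)"
  proof (intro sum.cong refl)
    show "(\<Sum>h\<in>UNIV. if g = a then (if h = b then (?p * ?q) *s gen_bracket g h else 0) else 0) =
      (if g = a then (?p * ?q) *s gen_bracket g b else 0)" for g
      by (cases "g = a") simp_all
  qed
  finally show ?thesis by simp
qed

text \<open>The series \<open>h\<close> such that the given element times a generator is congruent to \<open>h\<close> times that
  generator modulo total derivatives.\<close>

definition normal_form :: "'a::field_char_0 fps3 poly3 \<Rightarrow> 'a fps3" where
  "normal_form = pm_sum neg_pderivs3"

lemma normal_form_add: "normal_form (P + Q) = normal_form P + normal_form Q"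
  unfolding normal_form_def by (rule pm_sum_add) (simp_all add: neg_pderivs3_add)

lemma normal_form_zero [simp]: "normal_form 0 = 0"
  by (simp add: normal_form_def)

lemma normal_form_single [simp]: "normal_form (Poly_Mapping.single K f) = neg_pderivs3 K f"
  by (simp add: normal_form_def pm_sum_single)

lemma normal_form_sum: "normal_form (sum P A) = (\<Sum>a\<in>A. normal_form (P a))"
  by (induction A rule: infinite_finite_induct) (simp_all add: normal_form_add)

lemma normal_form_const3_mult: "normal_form (Poly_Mapping.single 0 (const3 c) * P) = const3 c * normal_form P"
  by (induction P rule: poly_mapping_additive_induct)
    (simp_all add: mult_single neg_pderivs3_const3_mult distrib_left normal_form_add)

section \<open>The map from the affinised module to E(3,6)\<close>

definition aff_to_e36 :: "'a::field_char_0 aff_re36 \<Rightarrow> 'a e36" where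
  "aff_to_e36 U = e36_of (\<lambda>g. gen_sign g (normal_form (U $ g)))"

lemma coord_aff_to_e36 [simp]: "e36_coord (aff_to_e36 U) g = gen_sign g (normal_form (U $ g))"
  by (simp add: aff_to_e36_def)

lemma aff_to_e36_add: "aff_to_e36 (U + V) = aff_to_e36 U + aff_to_e36 V"
  and aff_to_e36_zero [simp]: "aff_to_e36 0 = 0"
  and aff_to_e36_smult: "aff_to_e36 (aff_smult c U) = e36_smult c (aff_to_e36 U)"
  by (rule e36_eqI; simp add: normal_form_add gen_sign_add aff_smult_def normal_form_const3_mult gen_sign_mult)+

lemma aff_to_e36_sum: "aff_to_e36 (sum U A) = (\<Sum>a\<in>A. aff_to_e36 (U a))"
  by (induction A rule: infinite_finite_induct) (simp_all add: aff_to_e36_add)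

lemma keys_map_subset: "Poly_Mapping.keys (Poly_Mapping.map F P) \<subseteq> Poly_Mapping.keys P"
  by (auto simp: in_keys_iff Poly_Mapping.map.rep_eq when_def)

lemma normal_form_map:
  assumes "F 0 = 0"
  shows "normal_form (Poly_Mapping.map F P) = (\<Sum>K\<in>Poly_Mapping.keys P. neg_pderivs3 K (F (Poly_Mapping.lookup P K)))"
  unfolding normal_form_def
  by (subst pm_sum_superset[where S = "Poly_Mapping.keys P"])
    (auto simp: keys_map_subset Poly_Mapping.map.rep_eq when_def assms in_keys_iff intro!: sum.cong)

lemma normal_form_tensor: "normal_form (tensor a h $ u) = ev_inner (a $ u) h"
  by (simp add: tensor_def normal_form_map ev_inner_def pm_sum_def neg_pderivs3_const3_mult)

lemma ev_inner_scal: "ev_inner (Poly_Mapping.single 0 c * P) h = const3 c * ev_inner P h"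
proof (induction P rule: poly_mapping_additive_induct)
  case (1 K a)
  show ?case by (simp add: mult_single ev_inner_def pm_sum_single const3_mult mult.assoc)
qed (simp add: distrib_left ev_inner_add)

lemma mfact_nonzero [simp]: "mfact J \<noteq> (0 :: 'a::field_char_0)"
  by (simp add: mfact_def)

text \<open>The \<open>J!\<close> in \<open>j_product\<close> cancels against the
  \<open>1 / J!\<close> in the bracket, so the sum over \<open>J\<close> is the lambda-bracket with
  \<open>lambda^J\<close> acting as the J-th derivative of \<open>f\<close>.\<close>

lemma aff_to_e36_bracket_pure: "aff_to_e36 (aff_bracket_pure a f b g) = ev_vec (lam_bracket a b) f g"
proof (rule e36_eqI)
  fix u
  let ?L = "lam_bracket a b"
  let ?S = "{J. j_product J a b \<noteq> 0}"
  \<comment> \<open>In characteristic 0 multiplication by \<open>J!\<close> annihilates nothing, so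
    \<open>?S\<close> contains every exponent of lambda occurring in a coordinate of the
    bracket.\<close>
  have nz: "Poly_Mapping.single 0 (mfact J :: 'a) * P \<noteq> 0" if "P \<noteq> 0" for J and P :: "'a poly3"
  proof
    assume "Poly_Mapping.single 0 (mfact J :: 'a) * P = 0"
    then have "Poly_Mapping.single 0 (1 / mfact J :: 'a) * (Poly_Mapping.single 0 (mfact J) * P) = 0" by simp
    then have "P = 0" by (simp add: mult.assoc[symmetric] mult_single)
    with that show False ..
  qed
  have S: "?S \<subseteq> (\<Union>v. Poly_Mapping.keys (?L $ v))"
    by (auto simp: j_product_def vec_eq_iff in_keys_iff) (metis mult_zero_right)
  have fin: "finite ?S" by (rule finite_subset[OF S]) auto
  have keys: "Poly_Mapping.keys (?L $ u) \<subseteq> ?S"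
    using nz by (auto simp: j_product_def vec_eq_iff in_keys_iff)
  have "e36_coord (aff_to_e36 (aff_bracket_pure a f b g)) u =
      (\<Sum>J\<in>?S. const3 (1 / mfact J) * gen_sign u (ev_inner (j_product J a b $ u) (pderivs3 J f * g)))"
    by (simp add: aff_bracket_pure_def aff_to_e36_sum aff_to_e36_smult coord_sum normal_form_tensor
        del: mult_eq_0_iff)
  also have "\<dots> = (\<Sum>J\<in>?S. gen_sign u (ev_inner (Poly_Mapping.lookup (?L $ u) J) (pderivs3 J f * g)))"
  proof (intro sum.cong refl)
    fix J
    have "const3 (1 / mfact J) * (const3 (mfact J) * x) = x" for x :: "'a fps3"
      unfolding mult.assoc[symmetric] const3_mult[symmetric] by simp
    then show "const3 (1 / mfact J) * gen_sign u (ev_inner (j_product J a b $ u) (pderivs3 J f * g)) =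
      gen_sign u (ev_inner (Poly_Mapping.lookup (?L $ u) J) (pderivs3 J f * g))"
      by (simp add: j_product_def ev_inner_scal gen_sign_mult)
  qed
  also have "\<dots> = gen_sign u (\<Sum>J\<in>?S. ev_inner (Poly_Mapping.lookup (?L $ u) J) (pderivs3 J f * g))"
    by (cases u) (simp_all add: sum_negf)
  also have "(\<Sum>J\<in>?S. ev_inner (Poly_Mapping.lookup (?L $ u) J) (pderivs3 J f * g)) = ev (?L $ u) f g"
    unfolding ev_def by (rule pm_sum_superset[symmetric]) (use fin keys in auto)
  finally show "e36_coord (aff_to_e36 (aff_bracket_pure a f b g)) u = e36_coord (ev_vec ?L f g) u"
    by (simp add: ev_vec_def)
qed

lemma aff_to_e36_bracket_basis:
  "aff_to_e36 (aff_bracket_pure (basis_re36 a K) f (basis_re36 b N) g) =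
    e36_bracket (e36_single a (gen_sign a (neg_pderivs3 K f))) (e36_single b (gen_sign b (neg_pderivs3 N g)))"
proof -
  have "ev_vec (((\<Prod>i\<in>UNIV. (- lam i) ^ (K $ i)) * (\<Prod>i\<in>UNIV. (del i + lam i) ^ (N $ i))) *s V) f g =
     ev_vec V (neg_pderivs3 K f) (neg_pderivs3 N g)" for V
    by (rule e36_eqI) (simp add: ev_vec_def mult.assoc ev_subst_left ev_subst_right)
  then show ?thesis
    by (simp add: aff_to_e36_bracket_pure lam_bracket_basis ev_vec_gen_bracket)
qed

lemma gen_sign_sum: "gen_sign g (sum F A) = (\<Sum>a\<in>A. gen_sign g (F a))"
  by (induction A rule: infinite_finite_induct) (simp_all add: gen_sign_add)

lemma e36_single_sum: "e36_single g (sum F A) = (\<Sum>a\<in>A. e36_single g (F a :: 'a::comm_ring_1 fps3))"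
  by (induction A rule: infinite_finite_induct) (simp_all add: e36_single_add)

lemma aff_to_e36_expand: "aff_to_e36 U = (\<Sum>g\<in>UNIV. \<Sum>K\<in>Poly_Mapping.keys (U $ g).
   e36_single g (gen_sign g (neg_pderivs3 K (Poly_Mapping.lookup (U $ g) K))))"
  by (subst e36_expand) (simp add: normal_form_def pm_sum_def gen_sign_sum e36_single_sum)

text \<open>Bilinearity of \<open>aff_bracket\<close> is not invoked: its definition as a sum over
  the monomials of both arguments agrees term by term with the expansion of the right-hand
  side.\<close>

theorem aff_to_e36_bracket: "aff_to_e36 (aff_bracket U V) = e36_bracket (aff_to_e36 U) (aff_to_e36 V)"
  unfolding aff_bracket_def aff_to_e36_sum aff_to_e36_bracket_basis
  unfolding aff_to_e36_expand[of U] e36_bracket_sum(1)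
  unfolding aff_to_e36_expand[of V] e36_bracket_sum(2) ..

section \<open>Transport of structure and quotients\<close>

text \<open>No algebraic law is assumed of \<open>L\<close>, only closure and a bijection respecting
  the operations and families of subsets; all laws are to come from \<open>L'\<close>.\<close>

locale gs_transport =
  fixes L :: "('k::field, 'v) gsalg" and L' :: "('k, 'w) gsalg" and \<Phi> :: "'v \<Rightarrow> 'w"
  assumes bij: "bij_betw \<Phi> (gs_carrier L) (gs_carrier L')"
    and zero_closed: "gs_zero L \<in> gs_carrier L"
    and add_closed: "\<lbrakk>x \<in> gs_carrier L; y \<in> gs_carrier L\<rbrakk> \<Longrightarrow> gs_add L x y \<in> gs_carrier L"
    and smult_closed: "x \<in> gs_carrier L \<Longrightarrow> gs_smult L c x \<in> gs_carrier L"
    and bracket_closed: "\<lbrakk>x \<in> gs_carrier L; y \<in> gs_carrier L\<rbrakk> \<Longrightarrow> gs_bracket L x y \<in> gs_carrier L"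
    and map_zero: "\<Phi> (gs_zero L) = gs_zero L'"
    and map_add: "\<lbrakk>x \<in> gs_carrier L; y \<in> gs_carrier L\<rbrakk> \<Longrightarrow> \<Phi> (gs_add L x y) = gs_add L' (\<Phi> x) (\<Phi> y)"
    and map_smult: "x \<in> gs_carrier L \<Longrightarrow> \<Phi> (gs_smult L c x) = gs_smult L' c (\<Phi> x)"
    and map_bracket: "\<lbrakk>x \<in> gs_carrier L; y \<in> gs_carrier L\<rbrakk> \<Longrightarrow> \<Phi> (gs_bracket L x y) = gs_bracket L' (\<Phi> x) (\<Phi> y)"
    and parity_closed: "gs_parity L p \<subseteq> gs_carrier L"
    and comp_closed: "gs_comp L d \<subseteq> gs_carrier L"
    and filt_closed: "gs_filt L d \<subseteq> gs_carrier L"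
    and map_parity: "\<Phi> ` gs_parity L p = gs_parity L' p"
    and map_comp: "\<Phi> ` gs_comp L d = gs_comp L' d"
    and map_filt: "\<Phi> ` gs_filt L d = gs_filt L' d"
begin

lemma inj: "inj_on \<Phi> (gs_carrier L)" and onto: "\<Phi> ` gs_carrier L = gs_carrier L'"
  using bij by (auto simp: bij_betw_def)

lemma eqI: "\<lbrakk>x \<in> gs_carrier L; y \<in> gs_carrier L; \<Phi> x = \<Phi> y\<rbrakk> \<Longrightarrow> x = y"
  using inj by (auto dest: inj_onD)

lemma map_carrier: "x \<in> gs_carrier L \<Longrightarrow> \<Phi> x \<in> gs_carrier L'"
  using onto by auto

text \<open>Injectivity lets membership be tested after applying the map, so closure conditions
  transfer in the same way as equations.\<close>

lemma mem_iff: "\<lbrakk>S \<subseteq> gs_carrier L; x \<in> gs_carrier L\<rbrakk> \<Longrightarrow> x \<in> S \<longleftrightarrow> \<Phi> x \<in> \<Phi> ` S"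
  using eqI by blast

lemma map_Int: "\<lbrakk>S \<subseteq> gs_carrier L; T \<subseteq> gs_carrier L\<rbrakk> \<Longrightarrow> \<Phi> ` (S \<inter> T) = \<Phi> ` S \<inter> \<Phi> ` T"
  by (rule inj_on_image_Int[OF inj])

lemma subspace:
  assumes "gs_subspace L' (\<Phi> ` S)" "S \<subseteq> gs_carrier L"
  shows "gs_subspace L S"
  unfolding gs_subspace_def
proof (intro conjI ballI allI)
  note S = assms(1)[unfolded gs_subspace_def]
  show "gs_zero L \<in> S" using S by (subst mem_iff[OF assms(2) zero_closed]) (simp add: map_zero)
  show "gs_add L x y \<in> S" if "x \<in> S" "y \<in> S" for x y
  proof -
    have "x \<in> gs_carrier L" "y \<in> gs_carrier L" using that assms(2) by auto
    then show ?thesis using S that by (subst mem_iff[OF assms(2) add_closed]) (simp_all add: map_add)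
  qed
  show "gs_smult L c x \<in> S" if "x \<in> S" for c x
  proof -
    have "x \<in> gs_carrier L" using that assms(2) by auto
    then show ?thesis using S that by (subst mem_iff[OF assms(2) smult_closed]) (simp_all add: map_smult)
  qed
qed (rule assms(2))

lemma direct_sum:
  assumes D: "gs_direct_sum L' (\<Phi> ` S) (\<Phi> ` T) (\<Phi> ` U)"
    and sub: "S \<subseteq> gs_carrier L" "T \<subseteq> gs_carrier L" "U \<subseteq> gs_carrier L"
  shows "gs_direct_sum L S T U"
proof -
  have S: "\<Phi> ` S = {gs_add L' x y | x y. x \<in> \<Phi> ` T \<and> y \<in> \<Phi> ` U}" and Z: "\<Phi> ` T \<inter> \<Phi> ` U = {gs_zero L'}"
    using D by (auto simp: gs_direct_sum_def)
  have "S = {gs_add L x y | x y. x \<in> T \<and> y \<in> U}"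
  proof (intro equalityI subsetI)
    fix s assume s: "s \<in> S"
    then have "\<Phi> s \<in> {gs_add L' x y | x y. x \<in> \<Phi> ` T \<and> y \<in> \<Phi> ` U}" using S by blast
    then obtain x y where xy: "x \<in> T" "y \<in> U" "\<Phi> s = gs_add L' (\<Phi> x) (\<Phi> y)" by blast
    then have "s = gs_add L x y"
      using s sub by (intro eqI) (auto simp: map_add subset_iff intro!: add_closed)
    with xy show "s \<in> {gs_add L x y | x y. x \<in> T \<and> y \<in> U}" by blast
  next
    fix s assume "s \<in> {gs_add L x y | x y. x \<in> T \<and> y \<in> U}"
    then obtain x y where xy: "s = gs_add L x y" "x \<in> T" "y \<in> U" by blast
    then have c: "x \<in> gs_carrier L" "y \<in> gs_carrier L" using sub by auto
    have "\<Phi> s \<in> \<Phi> ` S" unfolding S using xy c by (auto simp: map_add)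
    then show "s \<in> S" using mem_iff[OF sub(1)] xy(1) c add_closed by blast
  qed
  moreover have "T \<inter> U = {gs_zero L}"
  proof -
    have "\<Phi> ` (T \<inter> U) = \<Phi> ` {gs_zero L}"
      using Z map_Int[OF sub(2,3)] by (simp add: map_zero)
    moreover have "T \<inter> U \<subseteq> gs_carrier L" "{gs_zero L} \<subseteq> gs_carrier L" using sub zero_closed by auto
    ultimately show ?thesis using inj_on_image_eq_iff[OF inj] by blast
  qed
  ultimately show ?thesis by (simp add: gs_direct_sum_def)
qed

lemma partial_sum:
  assumes "\<And>d. h d \<in> gs_carrier L"
  shows "gs_partial_sum L N h n \<in> gs_carrier L \<and> \<Phi> (gs_partial_sum L N h n) = gs_partial_sum L' N (\<Phi> \<circ> h) n"
  by (induction n) (use assms in \<open>auto simp: zero_closed map_zero add_closed map_add\<close>)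

lemma graded_lie_superalgebra:
  assumes "graded_lie_superalgebra L'"
  shows "graded_lie_superalgebra L"
proof -
  interpret L': graded_lie_superalgebra L' by (rule assms)
  note closed = zero_closed add_closed smult_closed bracket_closed map_carrier
  note maps = map_zero map_add map_smult map_bracket
  have parD: "x \<in> gs_carrier L" "\<Phi> x \<in> gs_parity L' p" if "x \<in> gs_parity L p" for x p
    using that parity_closed map_parity by blast+
  have compD: "x \<in> gs_carrier L" "\<Phi> x \<in> gs_comp L' d" if "x \<in> gs_comp L d" for x d
    using that comp_closed map_comp by blast+
  have filtD: "x \<in> gs_carrier L" "\<Phi> x \<in> gs_filt L' d" if "x \<in> gs_filt L d" for x d
    using that filt_closed map_filt by blast+
  have parI: "x \<in> gs_parity L p" if "x \<in> gs_carrier L" "\<Phi> x \<in> gs_parity L' p" for x p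
    using that mem_iff[OF parity_closed] map_parity by auto
  have compI: "x \<in> gs_comp L d" if "x \<in> gs_carrier L" "\<Phi> x \<in> gs_comp L' d" for x d
    using that mem_iff[OF comp_closed] map_comp by auto
  have filtI: "x \<in> gs_filt L d" if "x \<in> gs_carrier L" "\<Phi> x \<in> gs_filt L' d" for x d
    using that mem_iff[OF filt_closed] map_filt by auto
  show ?thesis
  proof
    show "gs_subspace L (gs_carrier L)"
      by (rule subspace) (simp_all add: onto L'.carrier_subspace)
    show "gs_subspace L (gs_parity L p)" for p
      by (rule subspace) (simp_all add: map_parity L'.parity_subspace parity_closed)
    show "gs_subspace L (gs_comp L d)" for d
      by (rule subspace) (simp_all add: map_comp L'.comp_subspace comp_closed)
    show "gs_subspace L (gs_filt L d)" for d
      by (rule subspace) (simp_all add: map_filt L'.filt_subspace filt_closed)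
    show "gs_direct_sum L (gs_carrier L) (gs_parity L 0) (gs_parity L 1)"
      by (rule direct_sum) (simp_all add: onto map_parity L'.parity_sum parity_closed)
    show "gs_direct_sum L (gs_comp L d) (gs_comp L d \<inter> gs_parity L 0) (gs_comp L d \<inter> gs_parity L 1)" for d
      by (rule direct_sum) (simp_all add: map_comp map_parity map_Int parity_closed comp_closed L'.comp_parity le_infI1)
    show "gs_direct_sum L (gs_filt L d) (gs_filt L d \<inter> gs_parity L 0) (gs_filt L d \<inter> gs_parity L 1)" for d
      by (rule direct_sum) (simp_all add: map_filt map_parity map_Int parity_closed filt_closed L'.filt_parity le_infI1)
    show "gs_direct_sum L (gs_filt L d) (gs_comp L d) (gs_filt L (d + 1))" for d
      by (rule direct_sum) (simp_all add: map_filt map_comp filt_closed comp_closed L'.filt_comp)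
    show "gs_add L (gs_add L x y) z = gs_add L x (gs_add L y z)"
      if "x \<in> gs_carrier L" "y \<in> gs_carrier L" "z \<in> gs_carrier L" for x y z
      using that by (intro eqI) (simp_all add: maps closed L'.add_assoc)
    show "gs_add L x y = gs_add L y x" if "x \<in> gs_carrier L" "y \<in> gs_carrier L" for x y
      using that by (intro eqI) (simp_all add: maps closed L'.add_commute)
    show "gs_add L (gs_zero L) x = x" if "x \<in> gs_carrier L" for x
      using that by (intro eqI) (simp_all add: maps closed L'.add_zero)
    show "gs_add L x (gs_smult L (- 1) x) = gs_zero L" if "x \<in> gs_carrier L" for x
      using that by (intro eqI) (simp_all add: maps closed L'.add_inverse)
    show "gs_smult L c (gs_add L x y) = gs_add L (gs_smult L c x) (gs_smult L c y)"
      if "x \<in> gs_carrier L" "y \<in> gs_carrier L" for c x y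
      using that by (intro eqI) (simp_all add: maps closed L'.smult_add_right)
    show "gs_smult L (c + c') x = gs_add L (gs_smult L c x) (gs_smult L c' x)" if "x \<in> gs_carrier L" for c c' x
      using that by (intro eqI) (simp_all add: maps closed L'.smult_add_left)
    show "gs_smult L c (gs_smult L c' x) = gs_smult L (c * c') x" if "x \<in> gs_carrier L" for c c' x
      using that by (intro eqI) (simp_all add: maps closed L'.smult_assoc)
    show "gs_smult L 1 x = x" if "x \<in> gs_carrier L" for x
      using that by (intro eqI) (simp_all add: maps closed L'.smult_one)
    show "gs_bracket L x y \<in> gs_carrier L" if "x \<in> gs_carrier L" "y \<in> gs_carrier L" for x y
      using that by (rule bracket_closed)
    show "gs_bracket L (gs_add L x y) z = gs_add L (gs_bracket L x z) (gs_bracket L y z)"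
      if "x \<in> gs_carrier L" "y \<in> gs_carrier L" "z \<in> gs_carrier L" for x y z
      using that by (intro eqI) (simp_all add: maps closed L'.bracket_add_left)
    show "gs_bracket L x (gs_add L y z) = gs_add L (gs_bracket L x y) (gs_bracket L x z)"
      if "x \<in> gs_carrier L" "y \<in> gs_carrier L" "z \<in> gs_carrier L" for x y z
      using that by (intro eqI) (simp_all add: maps closed L'.bracket_add_right)
    show "gs_bracket L (gs_smult L c x) y = gs_smult L c (gs_bracket L x y)"
      if "x \<in> gs_carrier L" "y \<in> gs_carrier L" for c x y
      using that by (intro eqI) (simp_all add: maps closed L'.bracket_smult_left)
    show "gs_bracket L x (gs_smult L c y) = gs_smult L c (gs_bracket L x y)"
      if "x \<in> gs_carrier L" "y \<in> gs_carrier L" for c x y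
      using that by (intro eqI) (simp_all add: maps closed L'.bracket_smult_right)
    show "gs_bracket L x y \<in> gs_parity L (p + q)" if "x \<in> gs_parity L p" "y \<in> gs_parity L q" for x y p q
      using parD[OF that(1)] parD[OF that(2)] by (intro parI) (simp_all add: maps closed L'.parity_bracket)
    show "gs_bracket L y x = gs_smult L (- super_sign p q) (gs_bracket L x y)"
      if "x \<in> gs_parity L p" "y \<in> gs_parity L q" for x y p q
      using parD[OF that(1)] parD[OF that(2)] L'.super_skew[of "\<Phi> x" p "\<Phi> y" q]
      by (intro eqI) (simp_all add: maps closed)
    show "gs_bracket L x (gs_bracket L y z) = gs_add L (gs_bracket L (gs_bracket L x y) z)
        (gs_smult L (super_sign p q) (gs_bracket L y (gs_bracket L x z)))"
      if "x \<in> gs_parity L p" "y \<in> gs_parity L q" "z \<in> gs_carrier L" for x y z p q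
      using parD[OF that(1)] parD[OF that(2)] that(3) L'.super_jacobi[of "\<Phi> x" p "\<Phi> y" q "\<Phi> z"]
      by (intro eqI) (simp_all add: maps closed)
    show "gs_bracket L x y \<in> gs_comp L (d + e)" if "x \<in> gs_comp L d" "y \<in> gs_comp L e" for x y d e
      using compD[OF that(1)] compD[OF that(2)] by (intro compI) (simp_all add: maps closed L'.comp_bracket)
    show "gs_bracket L x y \<in> gs_filt L (d + e)" if "x \<in> gs_filt L d" "y \<in> gs_filt L e" for x y d e
      using filtD[OF that(1)] filtD[OF that(2)] by (intro filtI) (simp_all add: maps closed L'.filt_bracket)
    obtain M where M: "gs_filt L' M = gs_carrier L'" using L'.filt_exhaustive by blast
    have "gs_filt L M = gs_carrier L" using filt_closed filtI M map_carrier by blast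
    then show "\<exists>N. gs_filt L N = gs_carrier L" ..
    show "(\<Inter>d. gs_filt L d) = {gs_zero L}"
    proof (intro equalityI subsetI)
      fix x assume "x \<in> (\<Inter>d. gs_filt L d)"
      then have x: "x \<in> gs_filt L d" for d by blast
      then have "\<Phi> x \<in> (\<Inter>d. gs_filt L' d)" using filtD(2) by blast
      then have "\<Phi> x = gs_zero L'" using L'.filt_separated by auto
      then show "x \<in> {gs_zero L}" using filtD(1)[OF x] by (auto intro!: eqI simp: zero_closed map_zero)
    next
      fix x assume "x \<in> {gs_zero L}"
      moreover have "gs_zero L' \<in> gs_filt L' d" for d using L'.filt_separated by blast
      ultimately show "x \<in> (\<Inter>d. gs_filt L d)" using zero_closed map_zero by (auto intro!: filtI)
    qed
  next
    fix h N assume h: "\<And>d. h d \<in> gs_comp L d"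
    then have hc: "\<And>d. h d \<in> gs_carrier L" using compD(1) by blast
    have "\<And>d. (\<Phi> \<circ> h) d \<in> gs_comp L' d" using h compD(2) by auto
    \<comment> \<open>The limit exists in \<open>L'\<close> for the image series. It is pulled back
      together with the remainders, as each filtration step maps onto its counterpart.\<close>
    from L'.complete[of "\<Phi> \<circ> h" N, OF this] obtain z' where z': "z' \<in> gs_carrier L'"
      and r': "\<And>n. \<exists>r\<in>gs_filt L' (N + int n). z' = gs_add L' (gs_partial_sum L' N (\<Phi> \<circ> h) n) r"
      by (elim bexE) blast
    obtain z where z: "z \<in> gs_carrier L" "\<Phi> z = z'" using z'[folded onto] by blast
    have "\<exists>r\<in>gs_filt L (N + int n). z = gs_add L (gs_partial_sum L N h n) r" for n
    proof -
      obtain r where r: "r \<in> gs_filt L (N + int n)" "z' = gs_add L' (gs_partial_sum L' N (\<Phi> \<circ> h) n) (\<Phi> r)"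
        using r'[of n, folded map_filt] by blast
      moreover have "z = gs_add L (gs_partial_sum L N h n) r"
        using partial_sum[of h N n, OF hc] filtD(1)[OF r(1)] z r(2)
        by (intro eqI) (simp_all add: maps closed)
      ultimately show ?thesis by blast
    qed
    then show "\<exists>z\<in>gs_carrier L. \<forall>n. \<exists>r\<in>gs_filt L (N + int n). z = gs_add L (gs_partial_sum L N h n) r"
      using z(1) by blast
  qed
qed

lemma gs_iso: "gs_iso L L' \<Phi>"
  using bij by (auto simp: gs_iso_def gs_linear_def map_carrier map_add map_smult map_bracket map_parity map_comp)

lemma gs_continuous: "gs_continuous L L' \<Phi>"
  unfolding gs_continuous_def using map_filt by blast

end

text \<open>The kernel condition compares arbitrary pairs rather than describing the preimage of 0,
  because \<open>L\<close> is not assumed to be a group. It says that the classes are the fibres of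
  the map.\<close>

locale gs_quotient_map =
  fixes L :: "('k::field, 'v) gsalg" and L' :: "('k, 'w) gsalg" and N :: "'v set" and \<theta> :: "'v \<Rightarrow> 'w"
  assumes kernel: "\<lbrakk>x \<in> gs_carrier L; y \<in> gs_carrier L\<rbrakk> \<Longrightarrow> (\<exists>n\<in>N. y = gs_add L x n) \<longleftrightarrow> \<theta> x = \<theta> y"
    and onto: "\<theta> ` gs_carrier L = gs_carrier L'"
    and zero_closed: "gs_zero L \<in> gs_carrier L"
    and add_closed: "\<lbrakk>x \<in> gs_carrier L; y \<in> gs_carrier L\<rbrakk> \<Longrightarrow> gs_add L x y \<in> gs_carrier L"
    and smult_closed: "x \<in> gs_carrier L \<Longrightarrow> gs_smult L c x \<in> gs_carrier L"
    and bracket_closed: "\<lbrakk>x \<in> gs_carrier L; y \<in> gs_carrier L\<rbrakk> \<Longrightarrow> gs_bracket L x y \<in> gs_carrier L"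
    and map_zero: "\<theta> (gs_zero L) = gs_zero L'"
    and map_add: "\<lbrakk>x \<in> gs_carrier L; y \<in> gs_carrier L\<rbrakk> \<Longrightarrow> \<theta> (gs_add L x y) = gs_add L' (\<theta> x) (\<theta> y)"
    and map_smult: "x \<in> gs_carrier L \<Longrightarrow> \<theta> (gs_smult L c x) = gs_smult L' c (\<theta> x)"
    and map_bracket: "\<lbrakk>x \<in> gs_carrier L; y \<in> gs_carrier L\<rbrakk> \<Longrightarrow> \<theta> (gs_bracket L x y) = gs_bracket L' (\<theta> x) (\<theta> y)"
    and parity_closed: "gs_parity L p \<subseteq> gs_carrier L"
    and comp_closed: "gs_comp L d \<subseteq> gs_carrier L"
    and filt_closed: "gs_filt L d \<subseteq> gs_carrier L"
    and map_parity: "\<theta> ` gs_parity L p = gs_parity L' p"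
    and map_comp: "\<theta> ` gs_comp L d = gs_comp L' d"
    and map_filt: "\<theta> ` gs_filt L d = gs_filt L' d"
begin

definition lift :: "'v set \<Rightarrow> 'w" where
  "lift X = the_elem (\<theta> ` X)"

lemma class_eq: "x \<in> gs_carrier L \<Longrightarrow> gs_class L N x = {y \<in> gs_carrier L. \<theta> y = \<theta> x}"
proof -
  assume x: "x \<in> gs_carrier L"
  have "gs_class L N x = {y \<in> gs_carrier L. \<exists>n\<in>N. y = gs_add L x n}"
    using x by (auto simp: gs_class_def gs_quot_rel_def)
  also have "\<dots> = {y \<in> gs_carrier L. \<theta> y = \<theta> x}"
    by (intro Collect_cong conj_cong refl) (simp only: kernel[OF x], rule eq_commute)
  finally show ?thesis .
qed

lemma lift_class: "x \<in> gs_carrier L \<Longrightarrow> lift (gs_class L N x) = \<theta> x"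
proof -
  assume x: "x \<in> gs_carrier L"
  then have "\<theta> ` gs_class L N x = {\<theta> x}" by (auto simp: class_eq)
  then show ?thesis by (simp add: lift_def)
qed

lemma class_cong: "\<lbrakk>x \<in> gs_carrier L; y \<in> gs_carrier L; \<theta> x = \<theta> y\<rbrakk> \<Longrightarrow> gs_class L N x = gs_class L N y"
  by (simp add: class_eq)

lemma quotient_carrier: "gs_carrier (gs_quotient L N) = gs_class L N ` gs_carrier L"
  by (auto simp: gs_quotient_def quotient_def gs_class_def)

text \<open>Operations on classes are unions over representatives; such a union collapses to one
  class when the family is constant on the fibre.\<close>

lemma UN_class:
  assumes "x \<in> gs_carrier L" "\<And>y. \<lbrakk>y \<in> gs_carrier L; \<theta> y = \<theta> x\<rbrakk> \<Longrightarrow> F y = F x"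
  shows "(\<Union>y\<in>gs_class L N x. F y) = F x"
  unfolding class_eq[OF assms(1)] by (rule SUP_eq_const) (use assms in blast)+

lemma quotient_add:
  assumes x: "x \<in> gs_carrier L" and y: "y \<in> gs_carrier L"
  shows "gs_add (gs_quotient L N) (gs_class L N x) (gs_class L N y) = gs_class L N (gs_add L x y)"
proof -
  have "(\<Union>y'\<in>gs_class L N y. gs_class L N (gs_add L x' y')) = gs_class L N (gs_add L x' y)"
    if "x' \<in> gs_carrier L" for x'
    using that y by (intro UN_class class_cong) (simp_all add: add_closed map_add)
  moreover have "(\<Union>x'\<in>gs_class L N x. gs_class L N (gs_add L x' y)) = gs_class L N (gs_add L x y)"
    using x y by (intro UN_class class_cong) (simp_all add: add_closed map_add)
  ultimately show ?thesis
    by (simp add: gs_quotient_def class_eq[OF x])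
qed

lemma quotient_smult:
  assumes x: "x \<in> gs_carrier L"
  shows "gs_smult (gs_quotient L N) c (gs_class L N x) = gs_class L N (gs_smult L c x)"
proof -
  have "(\<Union>x'\<in>gs_class L N x. gs_class L N (gs_smult L c x')) = gs_class L N (gs_smult L c x)"
    using x by (intro UN_class class_cong) (simp_all add: smult_closed map_smult)
  then show ?thesis by (simp add: gs_quotient_def)
qed

lemma quotient_bracket:
  assumes x: "x \<in> gs_carrier L" and y: "y \<in> gs_carrier L"
  shows "gs_bracket (gs_quotient L N) (gs_class L N x) (gs_class L N y) = gs_class L N (gs_bracket L x y)"
proof -
  have "(\<Union>y'\<in>gs_class L N y. gs_class L N (gs_bracket L x' y')) = gs_class L N (gs_bracket L x' y)"
    if "x' \<in> gs_carrier L" for x'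
    using that y by (intro UN_class class_cong) (simp_all add: bracket_closed map_bracket)
  moreover have "(\<Union>x'\<in>gs_class L N x. gs_class L N (gs_bracket L x' y)) = gs_class L N (gs_bracket L x y)"
    using x y by (intro UN_class class_cong) (simp_all add: bracket_closed map_bracket)
  ultimately show ?thesis
    by (simp add: gs_quotient_def class_eq[OF x])
qed

lemma quotient_transport: "gs_transport (gs_quotient L N) L' lift"
proof
  show "bij_betw lift (gs_carrier (gs_quotient L N)) (gs_carrier L')"
    unfolding bij_betw_def
  proof
    show "inj_on lift (gs_carrier (gs_quotient L N))"
      unfolding quotient_carrier
    proof (rule inj_onI)
      fix X Y assume "X \<in> gs_class L N ` gs_carrier L" "Y \<in> gs_class L N ` gs_carrier L" "lift X = lift Y"
      then show "X = Y" by (elim imageE, hypsubst, intro class_cong) (simp_all add: lift_class)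
    qed
    show "lift ` gs_carrier (gs_quotient L N) = gs_carrier L'"
      unfolding quotient_carrier onto[symmetric] image_image by (rule image_cong) (simp_all add: lift_class)
  qed
  have sub: "S \<subseteq> gs_carrier L \<Longrightarrow> lift ` gs_class L N ` S = \<theta> ` S" for S
    unfolding image_image by (rule image_cong) (auto simp: lift_class)
  show "lift ` gs_parity (gs_quotient L N) p = gs_parity L' p" for p
    using sub[OF parity_closed] by (simp add: gs_quotient_def map_parity)
  show "lift ` gs_comp (gs_quotient L N) d = gs_comp L' d" for d
    using sub[OF comp_closed] by (simp add: gs_quotient_def map_comp)
  show "lift ` gs_filt (gs_quotient L N) d = gs_filt L' d" for d
    using sub[OF filt_closed] by (simp add: gs_quotient_def map_filt)
  show "gs_parity (gs_quotient L N) p \<subseteq> gs_carrier (gs_quotient L N)" for p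
    using parity_closed unfolding quotient_carrier by (auto simp: gs_quotient_def)
  show "gs_comp (gs_quotient L N) d \<subseteq> gs_carrier (gs_quotient L N)" for d
    using comp_closed unfolding quotient_carrier by (auto simp: gs_quotient_def)
  show "gs_filt (gs_quotient L N) d \<subseteq> gs_carrier (gs_quotient L N)" for d
    using filt_closed unfolding quotient_carrier by (auto simp: gs_quotient_def)
  have z: "gs_zero (gs_quotient L N) = gs_class L N (gs_zero L)" by (simp add: gs_quotient_def)
  show "gs_zero (gs_quotient L N) \<in> gs_carrier (gs_quotient L N)" "lift (gs_zero (gs_quotient L N)) = gs_zero L'"
    by (simp_all add: z quotient_carrier zero_closed lift_class map_zero)
qed (auto simp: quotient_carrier quotient_add quotient_smult quotient_bracket lift_class
      add_closed smult_closed bracket_closed map_add map_smult map_bracket)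

end
section \<open>The annihilation algebra\<close>

lemma mon_induct [case_names zero add]:
  assumes "P 0" "\<And>K i. P K \<Longrightarrow> P (K + axis i 1)"
  shows "P (K :: mon)"
proof (induction "mdeg K" arbitrary: K)
  case 0
  then have "K = 0" by (simp add: mdeg_def vec_eq_iff)
  with assms(1) show ?case by simp
next
  case (Suc n)
  then have "\<exists>i. K $ i \<noteq> 0" unfolding mdeg_def by (metis sum.neutral nat.distinct(1))
  then obtain i where i: "K $ i \<noteq> 0" ..
  define K' where "K' = (\<chi> j. if j = i then K $ j - 1 else K $ j)"
  have K: "K = K' + axis i 1" using i by (simp add: K'_def axis_def vec_eq_iff)
  then have "mdeg K = mdeg K' + 1" by (simp add: mdeg_add)
  with Suc(2) have "n = mdeg K'" by simp
  then have "P K'" by (rule Suc(1))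
  then show ?case unfolding K by (rule assms(2))
qed

lemma lookup_map: "F 0 = 0 \<Longrightarrow> Poly_Mapping.lookup (Poly_Mapping.map F P) K = F (Poly_Mapping.lookup P K)"
  by (simp add: Poly_Mapping.map.rep_eq when_def)

lemma aff_del_add: "aff_del i (U + V) = aff_del i U + aff_del i V"
  by (simp add: aff_del_def vec_eq_iff distrib_left)

lemma aff_dy_add: "aff_dy i (U + V) = aff_dy i U + aff_dy i V"
  by (simp add: aff_dy_def vec_eq_iff poly_mapping_eq_iff fun_eq_iff lookup_map lookup_add pderiv3_add)

lemma aff_dy_zero [simp]: "aff_dy i 0 = 0" and aff_del_zero [simp]: "aff_del i 0 = 0"
  using aff_dy_add[of i 0 0] aff_del_add[of i 0 0] by simp_all

lemma normal_form_del: "normal_form (aff_del i U $ g) = - pderiv3 i (normal_form (U $ g))"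
proof -
  have "normal_form (Poly_Mapping.single (axis i 1) 1 * P) = - pderiv3 i (normal_form P)" for P :: "'a fps3 poly3"
    by (induction P rule: poly_mapping_additive_induct)
      (simp_all add: mult_single add.commute[of "axis i 1"] neg_pderivs3_add_axis distrib_left normal_form_add pderiv3_add)
  then show ?thesis by (simp add: aff_del_def)
qed

lemma normal_form_dy: "normal_form (aff_dy i U $ g) = pderiv3 i (normal_form (U $ g))"
  by (simp add: aff_dy_def normal_form_map neg_pderivs3_pderiv3)
    (simp add: normal_form_def pm_sum_def pderiv3_sum)

lemma aff_to_e36_total: "U \<in> aff_total \<Longrightarrow> aff_to_e36 U = 0"
  by (rule e36_eqI) (auto simp: aff_total_def normal_form_sum normal_form_add normal_form_del normal_form_dy)

lemma aff_total_zero: "0 \<in> aff_total"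
proof -
  have "0 = (\<Sum>i\<in>UNIV. aff_del i 0 + aff_dy i (0 :: 'a aff_re36))" by simp
  then show ?thesis unfolding aff_total_def by (auto intro!: exI[of _ "\<lambda>_. 0"])
qed

lemma aff_total_add: "U \<in> aff_total \<Longrightarrow> V \<in> aff_total \<Longrightarrow> U + V \<in> aff_total"
proof -
  assume "U \<in> aff_total" "V \<in> aff_total"
  then obtain U' V' where "U = (\<Sum>i\<in>UNIV. aff_del i (U' i) + aff_dy i (U' i))"
    "V = (\<Sum>i\<in>UNIV. aff_del i (V' i) + aff_dy i (V' i))" by (auto simp: aff_total_def)
  then have "U + V = (\<Sum>i\<in>UNIV. aff_del i (U' i + V' i) + aff_dy i (U' i + V' i))"
    by (simp add: aff_del_add aff_dy_add sum.distrib algebra_simps)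
  then show ?thesis unfolding aff_total_def by (auto intro!: exI[of _ "\<lambda>i. U' i + V' i"])
qed

lemma aff_total_sum: "(\<And>a. a \<in> A \<Longrightarrow> U a \<in> aff_total) \<Longrightarrow> sum U A \<in> aff_total"
  by (induction A rule: infinite_finite_induct) (simp_all add: aff_total_zero aff_total_add)

lemma aff_total_basic: "aff_del i U + aff_dy i U \<in> aff_total"
proof -
  have "(\<Sum>j\<in>UNIV. aff_del j (if j = i then U else 0) + aff_dy j (if j = i then U else 0)) =
     (\<Sum>j\<in>UNIV. if j = i then aff_del i U + aff_dy i U else 0)"
    by (rule sum.cong) auto
  then have "aff_del i U + aff_dy i U = (\<Sum>j\<in>UNIV. aff_del j (if j = i then U else 0) + aff_dy j (if j = i then U else 0))"
    by simp
  then show ?thesis unfolding aff_total_def by (auto intro!: exI[of _ "\<lambda>j. if j = i then U else 0"])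
qed

lemma axis_add: "axis g (a + b) = axis g a + axis g (b :: 'b::monoid_add)"
  by (simp add: axis_def vec_eq_iff)

text \<open>Each step trades one derivation of the module for minus one derivative of the series;
  \<open>f\<close> is generalised because the hypothesis is applied to
  \<open>- pderiv3 i f\<close>.\<close>

lemma axis_single_total:
  "axis g (Poly_Mapping.single K f) - axis g (Poly_Mapping.single 0 (neg_pderivs3 K f)) \<in> aff_total"
proof (induction K arbitrary: f rule: mon_induct)
  case zero
  show ?case by (simp add: aff_total_zero)
next
  case (add K i)
  have "aff_del i (axis g (Poly_Mapping.single K f)) = axis g (Poly_Mapping.single (K + axis i 1) f)"
    by (simp add: aff_del_def vec_eq_iff axis_def mult_single add.commute)
  moreover have "aff_dy i (axis g (Poly_Mapping.single K f)) = axis g (Poly_Mapping.single K (pderiv3 i f))"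
    by (auto simp: aff_dy_def vec_eq_iff axis_def poly_mapping_eq_iff fun_eq_iff lookup_map lookup_single when_def)
  ultimately have "axis g (Poly_Mapping.single (K + axis i 1) f) + axis g (Poly_Mapping.single K (pderiv3 i f)) \<in> aff_total"
    using aff_total_basic[of i "axis g (Poly_Mapping.single K f)"] by simp
  from aff_total_add[OF this add.IH[of "- pderiv3 i f"]]
  have "axis g (Poly_Mapping.single (K + axis i 1) f) + (axis g (Poly_Mapping.single K (pderiv3 i f))
      + axis g (Poly_Mapping.single K (- pderiv3 i f))) - axis g (Poly_Mapping.single 0 (neg_pderivs3 K (- pderiv3 i f))) \<in> aff_total"
    by (simp add: algebra_simps)
  then show ?case
    by (simp add: neg_pderivs3_add_axis neg_pderivs3_uminus neg_pderivs3_pderiv3 flip: axis_add Poly_Mapping.single_add)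
qed

lemma axis_normal_form_total: "axis g P - axis g (Poly_Mapping.single 0 (normal_form P)) \<in> aff_total"
proof (induction P rule: poly_mapping_additive_induct)
  case (1 K a)
  show ?case by (simp add: axis_single_total)
next
  case (2 p q)
  from aff_total_add[OF this] show ?case
    by (simp add: normal_form_add axis_add Poly_Mapping.single_add algebra_simps)
qed

text \<open>Every element differs from its normal form by a total derivative, so one with vanishing
  normal form is itself total.\<close>

lemma aff_total_iff: "U \<in> aff_total \<longleftrightarrow> aff_to_e36 U = 0"
proof
  assume "aff_to_e36 U = 0"
  then have "gen_sign g (gen_sign g (normal_form (U $ g))) = 0" for g
    by (metis coord_aff_to_e36 coord_zero gen_sign_simps(4))
  then have n: "normal_form (U $ g) = 0" for g by simp
  have "axis g (U $ g) \<in> aff_total" for g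
    using axis_normal_form_total[of g "U $ g"] by (simp add: n axis_def zero_vec_def[symmetric])
  then have "(\<Sum>g\<in>UNIV. axis g (U $ g)) \<in> aff_total" by (intro aff_total_sum)
  moreover have "(\<Sum>g\<in>UNIV. axis g (U $ g)) = U" by (simp add: vec_eq_iff axis_def)
  ultimately show "U \<in> aff_total" by simp
qed (rule aff_to_e36_total)

text \<open>A section of \<open>aff_to_e36\<close> without derivations. It preserves degrees and
  parity, which gives surjectivity onto each component and not merely overall.\<close>

definition e36_to_aff :: "'a::field_char_0 e36 \<Rightarrow> 'a aff_re36" where
  "e36_to_aff x = (\<chi> g. Poly_Mapping.single 0 (gen_sign g (e36_coord x g)))"

lemma aff_to_e36_to_aff [simp]: "aff_to_e36 (e36_to_aff x) = x"
  by (rule e36_eqI) (simp add: e36_to_aff_def)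

lemma coeff3_neg_pderivs3: "coeff3 (neg_pderivs3 K f) M \<noteq> 0 \<Longrightarrow> coeff3 f (M + K) \<noteq> 0"
proof (induction K arbitrary: M rule: mon_induct)
  case (add K i)
  then have "coeff3 (neg_pderivs3 K f) (M + axis i 1) \<noteq> 0"
    by (auto simp: neg_pderivs3_add_axis coeff3_uminus coeff3_pderiv3)
  then have "coeff3 f (M + axis i 1 + K) \<noteq> 0" by (rule add.IH)
  then show ?case by (simp add: add_ac)
qed simp

lemma coeff3_gen_sign: "coeff3 (gen_sign g f) M = 0 \<longleftrightarrow> coeff3 f M = (0 :: 'a::comm_ring_1)"
  by (cases g) (simp_all add: coeff3_uminus)

text \<open>A coefficient of the normal form at \<open>M\<close> stems from one at
  \<open>M + K\<close> of a term with derivation \<open>K\<close>; the degree -2|K| of that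
  derivation offsets the shift.\<close>

lemma aff_to_e36_degrees: "aff_to_e36 ` aff_degrees P = e36_degrees P"
proof (intro equalityI subsetI)
  fix x assume "x \<in> aff_to_e36 ` aff_degrees P"
  then obtain U where U: "x = aff_to_e36 U" and deg:
    "\<And>g K M. coeff3 (Poly_Mapping.lookup (U $ g) K) M \<noteq> 0 \<Longrightarrow> P (gen_degree g - 2 * int (mdeg K) + 2 * int (mdeg M))"
    unfolding aff_degrees_def by blast
  have "P (gen_degree g + 2 * int (mdeg M))" if "coeff3 (normal_form (U $ g)) M \<noteq> 0" for g M
  proof -
    have "(\<Sum>K\<in>Poly_Mapping.keys (U $ g). coeff3 (neg_pderivs3 K (Poly_Mapping.lookup (U $ g) K)) M) \<noteq> 0"
      using that by (simp add: normal_form_def pm_sum_def coeff3_sum)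
    then obtain K where "coeff3 (neg_pderivs3 K (Poly_Mapping.lookup (U $ g) K)) M \<noteq> 0"
      by (meson sum.not_neutral_contains_not_neutral)
    from deg[OF coeff3_neg_pderivs3[OF this]] show ?thesis by (simp add: mdeg_add)
  qed
  then show "x \<in> e36_degrees P" by (simp add: e36_degrees_coeff U coeff3_gen_sign)
next
  fix x assume "x \<in> e36_degrees P"
  then have "e36_to_aff x \<in> aff_degrees P"
    by (auto simp: e36_degrees_coeff aff_degrees_def e36_to_aff_def lookup_single when_def coeff3_gen_sign mdeg_def)
  then show "x \<in> aff_to_e36 ` aff_degrees P" by (intro image_eqI[of _ _ "e36_to_aff x"]) simp_all
qed

lemma aff_to_e36_parity:
  "aff_to_e36 ` {U. \<forall>g. U $ g \<noteq> 0 \<longrightarrow> gen_parity g = p} = e36_parity p"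
proof (intro equalityI subsetI)
  fix x assume "x \<in> aff_to_e36 ` {U. \<forall>g. U $ g \<noteq> 0 \<longrightarrow> gen_parity g = p}"
  then show "x \<in> e36_parity p" by (force simp: e36_parity_iff)
next
  fix x assume "x \<in> e36_parity p"
  then have "e36_to_aff x \<in> {U. \<forall>g. U $ g \<noteq> 0 \<longrightarrow> gen_parity g = p}"
    by (force simp: e36_parity_iff e36_to_aff_def)
  then show "x \<in> aff_to_e36 ` {U. \<forall>g. U $ g \<noteq> 0 \<longrightarrow> gen_parity g = p}"
    by (intro image_eqI[of _ _ "e36_to_aff x"]) simp_all
qed

section \<open>The quotient A(R)\<close>

lemma aff_to_e36_eq_iff: "(\<exists>n\<in>aff_total. y = x + n) \<longleftrightarrow> aff_to_e36 x = aff_to_e36 y"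
proof
  assume "aff_to_e36 x = aff_to_e36 y"
  then have "aff_to_e36 (y - x) = 0" using aff_to_e36_add[of x "y - x"] by simp
  then show "\<exists>n\<in>aff_total. y = x + n" by (intro bexI[of _ "y - x"]) (simp_all add: aff_total_iff)
qed (auto simp: aff_to_e36_add aff_to_e36_total)

interpretation aff: gs_quotient_map "aff_RE36 :: ('a::field_char_0, 'a aff_re36) gsalg" E36 aff_total aff_to_e36
proof
  show "aff_to_e36 ` gs_carrier aff_RE36 = (gs_carrier E36 :: 'a e36 set)"
    using surjI[of aff_to_e36 e36_to_aff] by (simp add: aff_RE36_def E36_def)
qed (simp_all add: aff_RE36_def E36_sel gs_parity_E36 aff_to_e36_eq_iff aff_to_e36_add aff_to_e36_smult
      aff_to_e36_bracket aff_to_e36_parity aff_to_e36_degrees)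

abbreviation A_to_e36 :: "'a::field_char_0 aff_re36 set \<Rightarrow> 'a e36" where
  "A_to_e36 \<equiv> aff.lift"

interpretation A: gs_transport "A_RE36 :: ('a::field_char_0, 'a aff_re36 set) gsalg" E36 A_to_e36
  unfolding A_RE36_def by (rule aff.quotient_transport)

abbreviation aff_class :: "'a::field_char_0 aff_re36 \<Rightarrow> 'a aff_re36 set" where
  "aff_class \<equiv> gs_class aff_RE36 aff_total"

lemma carrier_aff [simp]: "gs_carrier aff_RE36 = UNIV"
  by (simp add: aff_RE36_def)

lemma carrier_A: "gs_carrier A_RE36 = range aff_class"
  by (simp add: A_RE36_def aff.quotient_carrier)

lemma A_to_e36_class [simp]: "A_to_e36 (aff_class U) = aff_to_e36 U"
  by (rule aff.lift_class) simp

section \<open>The derivations in D and the constant vector fields\<close>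

definition const_field :: "'a::field_char_0 ^ 3 \<Rightarrow> 'a e36" where
  "const_field d = (\<chi> i. const3 (d $ i), 0, 0)"

lemma coord_const_field:
  "e36_coord (const_field d) g = (case g of GA i \<Rightarrow> const3 (d $ i) | _ \<Rightarrow> 0)"
  by (simp add: const_field_def split: gen.split)

lemma const_field_add: "const_field (d + d') = const_field d + const_field d'"
  and const_field_uminus: "const_field (- d) = - const_field d"
  and const_field_zero [simp]: "const_field 0 = 0"
  and const_field_smult: "const_field (c *s d) = e36_smult c (const_field d)"
  by (rule e36_eqI; simp add: coord_const_field const3_add const3_uminus const3_mult split: gen.split)+

lemma coord_bracket_const_field:
  "e36_coord (e36_bracket (const_field d) y) g = (\<Sum>i\<in>UNIV. const3 (d $ i) * pderiv3 i (e36_coord y g))"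
proof -
  obtain X c w where y: "y = (X, c, w)" by (metis prod_cases3)
  have "vf_div (\<chi> i. const3 (d $ i)) = 0" "sl2_act 0 v = 0" "sl2_act c' 0 = 0" for v :: "'a fps3 ^ 2" and c' :: "'a fps3 ^ sl2_basis"
    by (simp_all add: vf_div_def sl2_act_def vec_eq_iff)
  then show ?thesis
    by (cases g) (simp_all add: y const_field_def vf_bracket_def vf_apply_def e36_even_on_odd_def
        lie_deriv1_def odd_form_def)
qed

text \<open>A constant field has no divergence and constant coefficients, so its bracket merely
  differentiates every coordinate, as D does. In particular the action of D depends only on the
  class.\<close>

lemma aff_dy_const_field:
  "aff_to_e36 (\<Sum>i\<in>UNIV. aff_smult (d $ i) (aff_dy i U)) = e36_bracket (const_field d) (aff_to_e36 U)"
proof (rule e36_eqI)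
  fix g
  have "pderiv3 i (gen_sign g f) = gen_sign g (pderiv3 i f)" for i and f :: "'a fps3"
    by (cases g) (simp_all add: pderiv3_uminus)
  then show "e36_coord (aff_to_e36 (\<Sum>i\<in>UNIV. aff_smult (d $ i) (aff_dy i U))) g =
      e36_coord (e36_bracket (const_field d) (aff_to_e36 U)) g"
    by (simp add: aff_to_e36_sum coord_sum aff_to_e36_smult coord_bracket_const_field normal_form_dy del: sum_component)
qed

lemma D_act_class: "D_act d (aff_class U) = aff_class (\<Sum>i\<in>UNIV. aff_smult (d $ i) (aff_dy i U))"
  unfolding D_act_def
  by (intro aff.UN_class aff.class_cong) (simp_all add: aff_dy_const_field)

lemma D_act_closed: "X \<in> gs_carrier A_RE36 \<Longrightarrow> D_act d X \<in> gs_carrier A_RE36"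
  by (auto simp: carrier_A D_act_class)

lemma A_to_e36_D_act: "X \<in> gs_carrier A_RE36 \<Longrightarrow> A_to_e36 (D_act d X) = e36_bracket (const_field d) (A_to_e36 X)"
  by (auto simp: carrier_A D_act_class aff_dy_const_field)

lemma const_field_degree: "const_field d \<in> e36_degrees (\<lambda>e. e = - 2)"
proof -
  have "coeff3 (const3 c) M \<noteq> 0 \<Longrightarrow> mdeg M = 0" for c :: 'a and M
  proof -
    assume "coeff3 (const3 c) M \<noteq> 0"
    then have "coeff3 (const3 c * monom3 0) M \<noteq> 0" by (simp add: monom3_def)
    then have "M = 0" by (simp only: coeff3_const3_mult coeff3_monom3) (metis mult_zero_right)
    then show "mdeg M = 0" by (simp add: mdeg_def)
  qed
  then show ?thesis by (auto simp: e36_degrees_coeff coord_const_field split: gen.splits)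
qed

text \<open>On the b and c generators all degrees are at least -1, so degree -2 leaves only the
  constant terms of the coordinates at the a_i.\<close>

lemma degree_minus2_const_field:
  assumes "x \<in> e36_degrees (\<lambda>e. e = - 2)"
  obtains d where "x = const_field d"
proof
  let ?d = "\<chi> i. coeff3 (e36_coord x (GA i)) 0"
  show "x = const_field ?d"
  proof (rule e36_coeff_eqI)
    fix g M
    have mdeg0: "mdeg M = 0 \<longleftrightarrow> M = 0" by (simp add: mdeg_def vec_eq_iff)
    have *: "coeff3 (e36_coord x g) M = 0" if "gen_degree g + 2 * int (mdeg M) \<noteq> - 2"
      using assms that by (auto simp: e36_degrees_coeff)
    have c: "coeff3 (const3 c) M = (if M = 0 then c else (0 :: 'a))" for c
      using coeff3_const3_mult[of c "monom3 0" M] by (simp add: monom3_def coeff3_monom3[of 0, unfolded monom3_def, simplified])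
    show "coeff3 (e36_coord x g) M = coeff3 (e36_coord (const_field ?d) g) M"
      using * mdeg0 by (cases g) (auto simp: coord_const_field c)
  qed
qed

lemma pderiv3_var3: "pderiv3 i (var3 j) = (if i = j then 1 else (0 :: 'a::comm_ring_1 fps3))"
proof -
  have "i = 1 \<or> i = 2 \<or> i = 3" "j = 1 \<or> j = 2 \<or> j = 3" by (rule exhaust_3)+
  then show ?thesis
    by (elim disjE) (auto simp: pderiv3_def var3_def fps_eq_iff)
qed

lemma const_field_faithful:
  assumes "\<And>z. e36_bracket (const_field d) z = 0"
  shows "d = (0 :: 'a::field_char_0 ^ 3)"
proof -
  have "d $ j = 0" for j
  proof -
    \<comment> \<open>The test element is x_j tensor E: differentiating it along the constant field
      returns the j-th entry of \<open>d\<close>.\<close>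
    have "0 = e36_coord (e36_bracket (const_field d) (e36_single (GC bE) (var3 j))) (GC bE)"
      by (simp add: assms)
    also have "\<dots> = (\<Sum>i\<in>UNIV. if i = j then const3 (d $ i) else 0)"
      unfolding coord_bracket_const_field by (rule sum.cong) (simp_all add: coord_single pderiv3_var3)
    also have "\<dots> = const3 (d $ j)" by simp
    finally show ?thesis by (simp add: const3_def fps_const_eq_0_iff)
  qed
  then show ?thesis by (simp add: vec_eq_iff)
qed

section \<open>The semidirect product of D and A(R), and its ideal\<close>

definition D_A_to_e36 :: "('a::field_char_0 ^ 3) \<times> 'a aff_re36 set \<Rightarrow> 'a e36" where
  "D_A_to_e36 = (\<lambda>(d, X). A_to_e36 X + const_field d)"

lemma A_bracket_eq_D_act_iff:
  assumes X: "X \<in> gs_carrier A_RE36"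
  shows "(\<forall>z\<in>gs_carrier A_RE36. gs_bracket A_RE36 X z = D_act d z) \<longleftrightarrow>
    (\<forall>z. e36_bracket (A_to_e36 X) z = e36_bracket (const_field d) z)"
proof
  assume L: "\<forall>z\<in>gs_carrier A_RE36. gs_bracket A_RE36 X z = D_act d z"
  show "\<forall>z. e36_bracket (A_to_e36 X) z = e36_bracket (const_field d) z"
  proof
    fix z :: "'a e36"
    have "z \<in> A_to_e36 ` gs_carrier A_RE36" unfolding A.onto by (simp add: E36_sel)
    then obtain Z where Z: "Z \<in> gs_carrier A_RE36" "z = A_to_e36 Z" by blast
    have "A_to_e36 (gs_bracket A_RE36 X Z) = A_to_e36 (D_act d Z)" using L Z(1) by simp
    then show "e36_bracket (A_to_e36 X) z = e36_bracket (const_field d) z"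
      using X Z by (simp add: A.map_bracket A_to_e36_D_act E36_sel)
  qed
next
  assume R: "\<forall>z. e36_bracket (A_to_e36 X) z = e36_bracket (const_field d) z"
  show "\<forall>z\<in>gs_carrier A_RE36. gs_bracket A_RE36 X z = D_act d z"
    using X by (intro ballI A.eqI) (simp_all add: R[rule_format] A.bracket_closed D_act_closed A.map_bracket A_to_e36_D_act E36_sel)
qed

lemma g_ideal_iff: "(a, X) \<in> g_ideal \<longleftrightarrow> X \<in> gs_carrier A_RE36 \<and> D_A_to_e36 (a, X) = 0"
proof
  assume "(a, X) \<in> g_ideal"
  then have X2: "X \<in> gs_comp A_RE36 (- 2)"
    and b: "\<forall>z\<in>gs_carrier A_RE36. gs_bracket A_RE36 X z = D_act (- a) z"
    by (auto simp: g_ideal_def)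
  have X: "X \<in> gs_carrier A_RE36" using X2 A.comp_closed by blast
  have "A_to_e36 X \<in> gs_comp E36 (- 2)" using X2 A.map_comp by blast
  then obtain e where e: "A_to_e36 X = const_field e"
    by (auto simp: E36_sel elim: degree_minus2_const_field)
  \<comment> \<open>The first component of an element of \<open>g_ideal\<close> is minus the
    derivation, so \<open>X\<close> acts as \<open>const_field (- a)\<close>; it also acts as
    \<open>const_field e\<close>.\<close>
  have "e36_bracket (const_field (e + a)) z = 0" for z
    using b[unfolded A_bracket_eq_D_act_iff[OF X], rule_format, of z]
    by (simp add: e const_field_add const_field_uminus e36_bracket_add_left e36_bracket_uminus)
  then have "e + a = 0" by (rule const_field_faithful)
  then have "const_field e + const_field a = 0" by (simp flip: const_field_add)
  with X show "X \<in> gs_carrier A_RE36 \<and> D_A_to_e36 (a, X) = 0" by (simp add: D_A_to_e36_def e)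
next
  assume "X \<in> gs_carrier A_RE36 \<and> D_A_to_e36 (a, X) = 0"
  then have X: "X \<in> gs_carrier A_RE36" and e: "A_to_e36 X = const_field (- a)"
    by (auto simp: D_A_to_e36_def const_field_uminus add_eq_0_iff2)
  have "A_to_e36 X \<in> A_to_e36 ` gs_comp A_RE36 (- 2)"
    unfolding A.map_comp e by (simp add: E36_sel const_field_degree)
  then have "X \<in> gs_comp A_RE36 (- 2)" using A.mem_iff[OF A.comp_closed X] by blast
  moreover have "\<forall>z\<in>gs_carrier A_RE36. gs_bracket A_RE36 X z = D_act (- a) z"
    unfolding A_bracket_eq_D_act_iff[OF X] by (simp add: e)
  ultimately show "(a, X) \<in> g_ideal" unfolding g_ideal_def by (auto intro!: exI[of _ "- a"])
qed

lemma A_surj: obtains X where "X \<in> gs_carrier A_RE36" "A_to_e36 X = x"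
proof -
  have "x \<in> A_to_e36 ` gs_carrier A_RE36" unfolding A.onto by (simp add: E36_sel)
  then show thesis using that by blast
qed

text \<open>Carrier, parities, components and filtration of the semidirect product all have this
  shape; \<open>P\<close> forces d = 0 exactly where adding a constant field would leave
  \<open>T\<close>.\<close>

lemma D_A_image:
  assumes S: "S \<subseteq> gs_carrier A_RE36" "A_to_e36 ` S = T" and PT: "\<And>d x. P d \<Longrightarrow> x \<in> T \<Longrightarrow> x + const_field d \<in> T" and "P 0"
  shows "D_A_to_e36 ` {(d, X). X \<in> S \<and> P d} = T"
proof (intro equalityI subsetI)
  fix x assume "x \<in> D_A_to_e36 ` {(d, X). X \<in> S \<and> P d}"
  then obtain d X where x: "x = D_A_to_e36 (d, X)" "X \<in> S" "P d" by blast
  have "A_to_e36 X \<in> T" using S(2) x(2) by blast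
  from PT[OF x(3) this] show "x \<in> T" by (simp add: x(1) D_A_to_e36_def)
next
  fix x assume "x \<in> T"
  then obtain X where "X \<in> S" "x = A_to_e36 X" using S(2) by blast
  then show "x \<in> D_A_to_e36 ` {(d, X). X \<in> S \<and> P d}"
    using \<open>P 0\<close> by (intro image_eqI[of _ _ "(0, X)"]) (simp_all add: D_A_to_e36_def)
qed

text \<open>This matches the vanishing D-component of brackets in \<open>D_A_RE36\<close>: D is
  abelian.\<close>

lemma bracket_const_fields [simp]: "e36_bracket (const_field d) (const_field d') = 0"
  by (rule e36_eqI) (simp add: coord_bracket_const_field coord_const_field split: gen.split)

lemma D_A_sel:
  "gs_carrier D_A_RE36 = UNIV \<times> gs_carrier A_RE36"
  "gs_add D_A_RE36 (d, X) (d', X') = (d + d', gs_add A_RE36 X X')"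
  "gs_zero D_A_RE36 = (0, gs_zero A_RE36)"
  "gs_smult D_A_RE36 c (d, X) = (c *s d, gs_smult A_RE36 c X)"
  "gs_bracket D_A_RE36 (d, X) (d', X') = (0, gs_add A_RE36 (gs_bracket A_RE36 X X')
             (gs_add A_RE36 (D_act d X') (gs_smult A_RE36 (- 1) (D_act d' X))))"
  "gs_parity D_A_RE36 p = {(d, X). X \<in> gs_parity A_RE36 p \<and> (p \<noteq> 0 \<longrightarrow> d = 0)}"
  "gs_comp D_A_RE36 e = {(d, X). X \<in> gs_comp A_RE36 e \<and> (e \<noteq> - 2 \<longrightarrow> d = 0)}"
  "gs_filt D_A_RE36 e = {(d, X). X \<in> gs_filt A_RE36 e \<and> (e > - 2 \<longrightarrow> d = 0)}"
  by (simp_all add: D_A_RE36_def)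

lemma D_A_kernel:
  assumes X: "X \<in> gs_carrier A_RE36" and X': "X' \<in> gs_carrier A_RE36"
  shows "(\<exists>n\<in>g_ideal. (d', X') = gs_add D_A_RE36 (d, X) n) \<longleftrightarrow> D_A_to_e36 (d, X) = D_A_to_e36 (d', X')"
proof
  assume "\<exists>n\<in>g_ideal. (d', X') = gs_add D_A_RE36 (d, X) n"
  then obtain a Y where "(a, Y) \<in> g_ideal" and n: "d' = d + a" "X' = gs_add A_RE36 X Y"
    by (auto simp: D_A_sel)
  then have Y: "Y \<in> gs_carrier A_RE36" and 0: "A_to_e36 Y + const_field a = 0"
    by (auto simp: g_ideal_iff D_A_to_e36_def)
  have "D_A_to_e36 (d', X') = D_A_to_e36 (d, X) + (A_to_e36 Y + const_field a)"
    using X Y by (simp add: n D_A_to_e36_def A.map_add E36_sel const_field_add)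
  then show "D_A_to_e36 (d, X) = D_A_to_e36 (d', X')" by (simp add: 0)
next
  assume eq: "D_A_to_e36 (d, X) = D_A_to_e36 (d', X')"
  obtain Y where Y: "Y \<in> gs_carrier A_RE36" "A_to_e36 Y = A_to_e36 X' - A_to_e36 X" by (rule A_surj)
  have "A_to_e36 X + const_field d = A_to_e36 X' + const_field d'" using eq by (simp add: D_A_to_e36_def)
  then have "D_A_to_e36 (d' - d, Y) = 0"
    using const_field_add[of d "d' - d"] by (simp add: D_A_to_e36_def Y algebra_simps)
  then have "(d' - d, Y) \<in> g_ideal" using Y by (simp add: g_ideal_iff)
  moreover have "X' = gs_add A_RE36 X Y"
    using X X' Y by (intro A.eqI) (simp_all add: A.add_closed A.map_add E36_sel)
  then have "(d', X') = gs_add D_A_RE36 (d, X) (d' - d, Y)" by (simp add: D_A_sel)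
  ultimately show "\<exists>n\<in>g_ideal. (d', X') = gs_add D_A_RE36 (d, X) n" by blast
qed

lemma e36_filt_const_field: "e \<le> - 2 \<Longrightarrow> const_field d \<in> e36_degrees (\<lambda>n. e \<le> n)"
  using e36_degrees_mono[OF const_field_degree] by auto

interpretation D_A: gs_quotient_map "D_A_RE36 :: ('a::field_char_0, ('a ^ 3) \<times> 'a aff_re36 set) gsalg"
  E36 g_ideal D_A_to_e36
proof
  note maps = A.map_add A.map_smult A.map_bracket A.map_zero A_to_e36_D_act
  note closed = A.zero_closed A.add_closed A.smult_closed A.bracket_closed D_act_closed
  show "D_A_to_e36 ` gs_carrier D_A_RE36 = (gs_carrier E36 :: 'a e36 set)"
  proof -
    have "UNIV \<times> gs_carrier A_RE36 = {(d :: 'a ^ 3, X). X \<in> gs_carrier A_RE36 \<and> True}" by auto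
    then show ?thesis
      unfolding D_A_sel by (rule ssubst) (rule D_A_image[OF subset_refl A.onto], simp_all add: E36_sel)
  qed
  show "D_A_to_e36 ` gs_parity D_A_RE36 p = (gs_parity E36 p :: 'a e36 set)" for p
    unfolding D_A_sel
    by (rule D_A_image[OF A.parity_closed A.map_parity])
      (auto simp: gs_parity_E36 e36_parity_def const_field_def split: if_splits)
  show "D_A_to_e36 ` gs_comp D_A_RE36 e = (gs_comp E36 e :: 'a e36 set)" for e
    unfolding D_A_sel
    by (rule D_A_image[OF A.comp_closed A.map_comp])
      (auto simp: E36_sel const_field_degree intro!: e36_degrees_add)
  show "D_A_to_e36 ` gs_filt D_A_RE36 e = (gs_filt E36 e :: 'a e36 set)" for e
    unfolding D_A_sel
    by (rule D_A_image[OF A.filt_closed A.map_filt], case_tac "e > - 2")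
      (auto simp: E36_sel not_less intro!: e36_degrees_add e36_filt_const_field)
  fix x y :: "('a ^ 3) \<times> 'a aff_re36 set" and c :: 'a
  obtain d X d' X' where xy: "x = (d, X)" "y = (d', X')" by (metis surj_pair)
  show "D_A_to_e36 (gs_smult D_A_RE36 c x) = gs_smult E36 c (D_A_to_e36 x)" "gs_smult D_A_RE36 c x \<in> gs_carrier D_A_RE36"
    if "x \<in> gs_carrier D_A_RE36"
  proof -
    have "e36_smult c (u + v) = e36_smult c u + e36_smult c v" for u v :: "'a e36"
      by (rule e36_eqI) (simp add: distrib_left)
    then show "D_A_to_e36 (gs_smult D_A_RE36 c x) = gs_smult E36 c (D_A_to_e36 x)"
      using that by (simp add: xy D_A_sel D_A_to_e36_def maps E36_sel const_field_smult)
    show "gs_smult D_A_RE36 c x \<in> gs_carrier D_A_RE36" using that by (simp add: xy D_A_sel closed)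
  qed
  assume "x \<in> gs_carrier D_A_RE36" "y \<in> gs_carrier D_A_RE36"
  then have X: "X \<in> gs_carrier A_RE36" "X' \<in> gs_carrier A_RE36" by (simp_all add: xy D_A_sel)
  then show "(\<exists>n\<in>g_ideal. y = gs_add D_A_RE36 x n) \<longleftrightarrow> D_A_to_e36 x = D_A_to_e36 y"
    unfolding xy by (rule D_A_kernel)
  show "gs_add D_A_RE36 x y \<in> gs_carrier D_A_RE36" "gs_bracket D_A_RE36 x y \<in> gs_carrier D_A_RE36"
    using X by (simp_all add: xy D_A_sel closed)
  show "D_A_to_e36 (gs_add D_A_RE36 x y) = gs_add E36 (D_A_to_e36 x) (D_A_to_e36 y)"
    using X by (simp add: xy D_A_sel D_A_to_e36_def maps E36_sel const_field_add)
  \<comment> \<open>This gives the mixed term the form in which the semidirect product has it, with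
    the derivation acting from the left.\<close>
  have "e36_bracket z (const_field d') = - e36_bracket (const_field d') z" for z
    using e36_bracket_skew_even[of "\<chi> i. const3 (d' $ i)" 0 z] by (simp add: const_field_def)
  then show "D_A_to_e36 (gs_bracket D_A_RE36 x y) = gs_bracket E36 (D_A_to_e36 x) (D_A_to_e36 y)"
    using X by (simp add: xy D_A_sel D_A_to_e36_def maps closed E36_sel e36_smult_neg1
        e36_bracket_add_left e36_bracket_add_right)
next
  show "gs_zero D_A_RE36 \<in> gs_carrier (D_A_RE36 :: ('a, _) gsalg)" by (simp add: D_A_sel A.zero_closed)
  show "D_A_to_e36 (gs_zero D_A_RE36) = (gs_zero E36 :: 'a e36)" by (simp add: D_A_sel D_A_to_e36_def A.map_zero E36_sel)
qed (auto simp: D_A_sel dest: subsetD[OF A.parity_closed] subsetD[OF A.comp_closed] subsetD[OF A.filt_closed])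

abbreviation g_to_e36 :: "(('a::field_char_0 ^ 3) \<times> 'a aff_re36 set) set \<Rightarrow> 'a e36" where
  "g_to_e36 \<equiv> D_A.lift"

interpretation g: gs_transport "g_RE36 :: ('a::field_char_0, (('a ^ 3) \<times> 'a aff_re36 set) set) gsalg" E36 g_to_e36
  unfolding g_RE36_def by (rule D_A.quotient_transport)

lemma g_elt_carrier: "g_elt a f \<in> gs_carrier g_RE36"
  unfolding g_elt_def g_RE36_def D_A.quotient_carrier by (simp add: D_A_sel carrier_A)

lemma g_to_e36_g_elt: "g_to_e36 (g_elt a f) = e36_of (\<lambda>g. gen_sign g (ev_inner (a $ g) f))"
proof -
  have "g_to_e36 (g_elt a f) = D_A_to_e36 (0, aff_class (tensor a f))"
    unfolding g_elt_def by (rule D_A.lift_class) (simp add: D_A_sel carrier_A)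
  then show ?thesis by (simp add: D_A_to_e36_def aff_to_e36_def normal_form_tensor)
qed

lemma ev_inner_const: "ev_inner (Poly_Mapping.single 0 c) f = const3 c * f"
  by (simp add: ev_inner_def pm_sum_single)

lemma g_to_e36_gen: "g_to_e36 (g_elt (axis g 1) f) = e36_single g (gen_sign g f)"
proof -
  have "ev_inner 1 f = f" using ev_inner_const[of 1 f] by simp
  then show ?thesis unfolding g_to_e36_g_elt by (intro e36_eqI) (simp add: coord_single axis_def)
qed

lemma prescribed_values_g_to_e36: "prescribed_values g_to_e36"
proof -
  have "g_to_e36 (g_elt (c_elt c) f) = (0, (\<chi> z. const3 (c $ z) * f), 0)" for c :: "'a ^ sl2_basis" and f
    unfolding g_to_e36_g_elt
    by (rule e36_eqI, case_tac g) (simp_all add: c_elt_def ev_inner_const)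
  then show ?thesis
    by (simp add: prescribed_values_def g_to_e36_gen e36_single_GA e36_single_GB)
qed

section \<open>Uniqueness of the continuous extension\<close>

lemma e36_filter_finite:
  assumes "finite {(g, M). p g M}"
  shows "e36_filter p x = (\<Sum>(g, M)\<in>{(g, M). p g M}. e36_smult (coeff3 (e36_coord x g) M) (e36_single g (monom3 M)))"
proof (rule e36_coeff_eqI)
  fix h N
  have "coeff3 (e36_coord (\<Sum>(g, M)\<in>{(g, M). p g M}. e36_smult (coeff3 (e36_coord x g) M) (e36_single g (monom3 M))) h) N
    = (\<Sum>k\<in>{(g, M). p g M}. if k = (h, N) then coeff3 (e36_coord x h) N else 0)"
    unfolding coord_sum coeff3_sum
    by (intro sum.cong refl) (auto simp: coord_single coeff3_monom3 split: if_splits)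
  also have "\<dots> = (if p h N then coeff3 (e36_coord x h) N else 0)"
    using assms by simp
  finally show "coeff3 (e36_coord (e36_filter p x) h) N = coeff3 (e36_coord (\<Sum>(g, M)\<in>{(g, M). p g M}. e36_smult (coeff3 (e36_coord x g) M) (e36_single g (monom3 M))) h) N"
    by simp
qed

lemma finite_low_degree: "finite {(g, M). gen_degree g + 2 * int (mdeg M) < m}"
proof -
  have "finite {M :: mon. mdeg M < k}" for k
  proof -
    have "M $ i \<le> mdeg M" for M i unfolding mdeg_def by (rule member_le_sum) auto
    then have "{M :: mon. mdeg M < k} \<subseteq> {M. \<forall>i. M $ i \<in> {..k}}" by clarsimp (meson le_trans less_imp_le)
    moreover have "finite {M :: mon. \<forall>i. M $ i \<in> {..k}}"
    proof -
      have "{M :: mon. \<forall>i. M $ i \<in> {..k}} \<subseteq> (\<lambda>(a, b, c). \<chi> i. if i = 1 then a else if i = 2 then b else c) ` ({..k} \<times> {..k} \<times> {..k})"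
      proof
        fix M :: mon assume "M \<in> {M. \<forall>i. M $ i \<in> {..k}}"
        then show "M \<in> (\<lambda>(a, b, c). \<chi> i. if i = 1 then a else if i = 2 then b else c) ` ({..k} \<times> {..k} \<times> {..k})"
          by (intro image_eqI[of _ _ "(M $ 1, M $ 2, M $ 3)"]) (simp_all add: vec_eq_iff forall_3)
      qed
      then show ?thesis by (rule finite_subset) simp
    qed
    ultimately show ?thesis by (rule finite_subset)
  qed
  \<comment> \<open>Generators have degree at least -2, so a degree below \<open>m\<close> gives
    2|M| < m + 2, and in particular |M| < m + 2.\<close>
  then have "finite ((UNIV :: gen set) \<times> {M :: mon. mdeg M < nat (m + 2)})" by simp
  moreover have "mdeg M < nat (m + 2)" if "gen_degree g + 2 * int (mdeg M) < m" for g M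
  proof -
    have "gen_degree g \<ge> - 2" by (cases g) auto
    with that show ?thesis by linarith
  qed
  then have "{(g, M). gen_degree g + 2 * int (mdeg M) < m} \<subseteq> UNIV \<times> {M :: mon. mdeg M < nat (m + 2)}" by auto
  ultimately show ?thesis by (rule rev_finite_subset)
qed

text \<open>Up to any degree \<open>x\<close> is a polynomial, which \<open>F\<close> fixes, and
  continuity makes the image of the rest as deep as desired. Thus F x - x lies in every step of a
  separated filtration.\<close>

lemma e36_endo_unique:
  fixes F :: "'a::field_char_0 e36 \<Rightarrow> 'a e36"
  assumes add: "\<And>x y. F (x + y) = F x + F y" and smult: "\<And>c x. F (e36_smult c x) = e36_smult c (F x)"
    and cont: "\<And>n. \<exists>m. F ` e36_degrees (\<lambda>e. m \<le> e) \<subseteq> e36_degrees (\<lambda>e. n \<le> e)"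
    and single: "\<And>g M. F (e36_single g (monom3 M)) = e36_single g (monom3 M)"
  shows "F x = x"
proof -
  have zero: "F 0 = 0" using add[of 0 0] by simp
  have sum: "F (sum f A) = (\<Sum>a\<in>A. F (f a))" for f :: "gen \<times> mon \<Rightarrow> 'a e36" and A
    by (induction A rule: infinite_finite_induct) (simp_all add: zero add)
  have "F x - x \<in> e36_degrees (\<lambda>e. n \<le> e)" for n
  proof -
    obtain m0 where m0: "F ` e36_degrees (\<lambda>e. m0 \<le> e) \<subseteq> e36_degrees (\<lambda>e. n \<le> e)" using cont by blast
    \<comment> \<open>The bound \<open>m0\<close> makes the image of the remainder lie in step
      \<open>n\<close>, and the bound \<open>n\<close> does the same for the remainder
      itself.\<close>
    define m where "m = max m0 n"
    define p where "p g M \<longleftrightarrow> gen_degree g + 2 * int (mdeg M) < m" for g M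
    define r where "r = e36_filter (\<lambda>g M. \<not> p g M) x"
    have x: "x = e36_filter p x + r" by (simp add: r_def e36_filter_split)
    have "F (e36_filter p x) = e36_filter p x"
      using finite_low_degree[of m] unfolding p_def
      by (simp add: e36_filter_finite sum smult single case_prod_unfold)
    then have "F (e36_filter p x + r) - (e36_filter p x + r) = F r - r" by (simp add: add)
    then have "F x - x = F r - r" by (simp only: x[symmetric])
    moreover have r: "r \<in> e36_degrees (\<lambda>e. m \<le> e)"
      by (auto simp: e36_degrees_coeff r_def p_def)
    then have "r \<in> e36_degrees (\<lambda>e. m0 \<le> e)" "r \<in> e36_degrees (\<lambda>e. n \<le> e)"
      by (auto elim!: e36_degrees_mono simp: m_def)
    then have "F r - r \<in> e36_degrees (\<lambda>e. n \<le> e)" using m0 by (auto intro!: e36_degrees_diff)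
    ultimately show ?thesis by simp
  qed
  then have deg: "n \<le> gen_degree g + 2 * int (mdeg M)" if "coeff3 (e36_coord (F x - x) g) M \<noteq> 0" for n g M
    using that by (auto simp only: e36_degrees_coeff)
  have "F x - x = 0"
  proof (rule e36_coeff_eqI)
    show "coeff3 (e36_coord (F x - x) g) M = coeff3 (e36_coord 0 g) M" for g M
      using deg[where n = "gen_degree g + 2 * int (mdeg M) + 1" and g = g and M = M] by auto
  qed
  then show ?thesis by simp
qed

lemma g_to_e36_unique:
  fixes \<Psi> :: "(('a::field_char_0 ^ 3) \<times> 'a aff_re36 set) set \<Rightarrow> 'a e36"
  assumes lin: "gs_linear g_RE36 E36 \<Psi>" and cont: "gs_continuous g_RE36 E36 \<Psi>" and pre: "prescribed_values \<Psi>"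
    and x: "x \<in> gs_carrier g_RE36"
  shows "\<Psi> x = g_to_e36 x"
proof -
  \<comment> \<open>Composing with the inverse of \<open>g_to_e36\<close> turns uniqueness into a
    statement about an endomorphism of E(3,6).\<close>
  define G where "G = inv_into (gs_carrier g_RE36) (g_to_e36 :: _ \<Rightarrow> 'a e36)"
  have surj: "y \<in> g_to_e36 ` gs_carrier g_RE36" for y :: "'a e36" unfolding g.onto by (simp add: E36_sel)
  have G: "G y \<in> gs_carrier g_RE36" "g_to_e36 (G y) = y" for y
    using inv_into_into[OF surj] f_inv_into_f[OF surj] by (auto simp: G_def)
  have G': "G (g_to_e36 z) = z" if "z \<in> gs_carrier g_RE36" for z
    using that unfolding G_def by (rule inv_into_f_f[OF g.inj])
  have lin_add: "\<Psi> (gs_add g_RE36 z z') = \<Psi> z + \<Psi> z'" and lin_smult: "\<Psi> (gs_smult g_RE36 c z) = e36_smult c (\<Psi> z)"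
    if "z \<in> gs_carrier g_RE36" "z' \<in> gs_carrier g_RE36" for z z' c
    using lin that by (auto simp: gs_linear_def E36_sel)
  have G_add: "G (y + z) = gs_add g_RE36 (G y) (G z)" for y z
    by (rule g.eqI) (simp_all add: G g.add_closed g.map_add E36_sel)
  have G_smult: "G (e36_smult c y) = gs_smult g_RE36 c (G y)" for c y
    by (rule g.eqI) (simp_all add: G g.smult_closed g.map_smult E36_sel)
  have pv: "\<Psi> (g_elt (axis g 1) (monom3 M)) = e36_single g (gen_sign g (monom3 M))" for g M
  proof (cases g)
    case (GA i) then show ?thesis using pre by (simp add: prescribed_values_def e36_single_GA)
  next
    case (GB h k) then show ?thesis using pre by (simp add: prescribed_values_def e36_single_GB)
  next
    case (GC z)
    \<comment> \<open>The prescribed value for general elements of sl2 is specialised to a basis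
      vector.\<close>
    have "c_elt (axis z 1) = (axis (GC z) 1 :: 'a re36)"
      by (simp add: c_elt_def vec_eq_iff axis_def split: gen.split)
    moreover have "(\<chi> u. const3 ((axis z 1 :: 'a ^ sl2_basis) $ u) * f) = axis z f" for f :: "'a fps3"
      by (simp add: vec_eq_iff axis_def)
    ultimately show ?thesis using pre GC
      by (auto simp: prescribed_values_def e36_single_GC dest!: spec[where x = M] spec[where x = "axis z 1"])
  qed
  have "(\<Psi> \<circ> G) y = y" for y
  proof (rule e36_endo_unique)
    show add: "(\<Psi> \<circ> G) (y + z) = (\<Psi> \<circ> G) y + (\<Psi> \<circ> G) z" for y z
      by (simp add: G_add lin_add G)
    show smult: "(\<Psi> \<circ> G) (e36_smult c y) = e36_smult c ((\<Psi> \<circ> G) y)" for c y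
      by (simp add: G_smult lin_smult[OF G(1) G(1)])
    show "\<exists>m. (\<Psi> \<circ> G) ` e36_degrees (\<lambda>e. m \<le> e) \<subseteq> e36_degrees (\<lambda>e. n \<le> e)" for n
    proof -
      obtain m where m: "\<Psi> ` gs_filt g_RE36 m \<subseteq> gs_filt E36 n" using cont unfolding gs_continuous_def by blast
      have "G ` gs_filt E36 m \<subseteq> gs_filt g_RE36 m"
        unfolding g.map_filt[symmetric] image_image
        by (rule image_subsetI) (simp add: G'[OF subsetD[OF g.filt_closed[of m]]])
      with m show ?thesis unfolding E36_sel by (intro exI[of _ m]) auto
    qed
    show "(\<Psi> \<circ> G) (e36_single g (monom3 M)) = e36_single g (monom3 M)" for g M
    proof -
      have "(\<Psi> \<circ> G) (e36_single g (gen_sign g (monom3 M))) = e36_single g (gen_sign g (monom3 M))"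
        using pv[of g M] G'[OF g_elt_carrier[of "axis g 1" "monom3 M"]] by (simp add: g_to_e36_gen)
      then have *: "(\<Psi> \<circ> G) (e36_smult c (e36_single g (gen_sign g (monom3 M)))) = e36_smult c (e36_single g (gen_sign g (monom3 M)))" for c
        by (simp only: smult)
      \<comment> \<open>The prescribed values carry the sign of \<open>gen_sign\<close>; linearity
        removes it, with c = -1 for the vector fields and c = 1 otherwise.\<close>
      have "\<exists>c. e36_single g (monom3 M) = e36_smult c (e36_single g (gen_sign g (monom3 M)))"
      proof (cases g)
        case (GA i) then show ?thesis by (intro exI[of _ "- 1"]) (simp add: e36_smult_neg1 e36_single_uminus)
      qed (simp_all add: exI[of _ 1] e36_smult_1 exI[where x = 1])
      with * show ?thesis by metis
    qed
  qed
  then have "(\<Psi> \<circ> G) (g_to_e36 x) = g_to_e36 x" .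
  then show ?thesis by (simp add: G'[OF x])
qed

theorem theorem7p3:
  "graded_lie_superalgebra
     (g_RE36 :: ('a::{alg_closed_field, field_char_0}, (('a ^ 3) \<times> 'a aff_re36 set) set) gsalg) \<and>
   graded_lie_superalgebra (E36 :: ('a, 'a e36) gsalg) \<and>
   (\<exists>\<Phi> :: (('a ^ 3) \<times> 'a aff_re36 set) set \<Rightarrow> 'a e36.
      gs_iso g_RE36 E36 \<Phi> \<and> gs_continuous g_RE36 E36 \<Phi> \<and> prescribed_values \<Phi> \<and>
      (\<forall>\<Psi>. gs_linear g_RE36 E36 \<Psi> \<and> gs_continuous g_RE36 E36 \<Psi> \<and> prescribed_values \<Psi> \<longrightarrow>
           (\<forall>x\<in>gs_carrier g_RE36. \<Psi> x = \<Phi> x)))"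
  using g.graded_lie_superalgebra[OF graded_lie_superalgebra_E36] graded_lie_superalgebra_E36
    g.gs_iso g.gs_continuous prescribed_values_g_to_e36 g_to_e36_unique
  by blast

end
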